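(* Let $E$ be a locally compact Polish space and let $Q$ be a transition function on $E$, with $q(t,x)=Q(t,x,E)$, $(Q(t)F)(x)=\int_E F(y)\,Q(t,x,dy)$ and $L(t)F(x)=\int_E (F(y)-F(x))\,Q(t,x,dy)$. Assume that there exists a continuous function $V:E\to\mathbb{R}_+$ such that $(t,x)\mapsto Q(t)F(x)$ is continuous on $\mathbb{R}_+\times E$ for any $F\in C_V(E)$. Moreover, suppose that there exists a continuous function $c:\mathbb{R}_+\to\mathbb{R}_+$ such that the following hold: 1. For all $T>0$ there exists $a(T)>0$ such that $q(t,x)\le a(T)V(x)$ for all $t\in[0,T]$ and $x\in E$. 2. $\int_E V(y)\,Q(t,x,dy)\le c(t)V(x)+q(t,x)V(x)$ for all $t\ge 0$, $x\in E$. 3. For all $\varepsilon>0$, all compact $B\subset E$ and all $T>0$ there exists a compact $A\subset E$ such that $\int_0^T Q(r,x,A^c)\,dr<\varepsilon$ for all $x\in B$. Let $U(s,t)F(x)=\int_E F(y)\,P(s,x;t,dy)$, $0\le s\le t$, where $P$ is the minimal transition function associated with $Q$. Then $U(s,t)$ is a conservative Feller evolution system, i.e. $U(s,t)1=1$ and $(s,t,x)\mapsto U(s,t)F(x)$ is continuous for any $F\in C_b(E)$. Moreover, $U(s,t)$ can be extended to $BM_V(E)$ so that $$\|U(s,t)F\|_V\le e^{\int_s^t c(r)\,dr}\|F\|_V,\qquad 0\le s\le t .$$ Furthermore: (a) For any $F\in BM(E)$, $t>0$ and $x\in E$, the map $[0,t]\ni s\mapsto U(s,t)F(x)$ is continuously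 differentiable and satisfies $$\frac{\partial}{\partial s}U(s,t)F(x)=-L(s)U(s,t)F(x).$$ If $F\in C_V(E)$, then $s\mapsto U(s,t)F(x)$ is absolutely continuous and satisfies this equation for a.e. $s$. (b) Let $F\in BM(E)$. Then for any $x\in E$ and $s\ge 0$, the map $[s,\infty)\ni t\mapsto U(s,t)F(x)$ is absolutely continuous and satisfies for a.a. $t\ge s$ $$\frac{\partial}{\partial t}U(s,t)F(x)=U(s,t)L(t)F(x).$$ (c) Let $W(s,t)$ be a Feller evolution system on $C_b(E)$. If for any $F\in C_b(E)$, $W(s,t)F$ is a solution to the backward equation $\frac{\partial}{\partial s}W(s,t)F(x)=-L(s)W(s,t)F(x)$ or to the forward equation $\frac{\partial}{\partial t}W(s,t)F(x)=W(s,t)L(t)F(x)$, then $W(s,t)=U(s,t)$.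
   Context: $BM(E)$ is the space of bounded measurable real functions on $E$, $C_b(E)$ the subspace of bounded continuous functions, $C(E)$ the space of continuous functions, $\mathcal{B}(E)$ the Borel $\sigma$-algebra. For a nonnegative $V\in C(E)$: $\|F\|_V=\sup_{x\in E}\frac{|F(x)|}{1+V(x)}$, $BM_V(E)$ is the space of measurable $F$ with $\|F\|_V<\infty$, and $C_V(E)=BM_V(E)\cap C(E)$. A transition function on $E$ is a map $Q:\mathbb{R}_+\times E\times\mathcal{B}(E)\to\mathbb{R}_+$ such that: for all $t\ge0,x\in E$, $A\mapsto Q(t,x,A)$ is a finite Borel measure with $Q(t,x,\{x\})=0$; for all $A\in\mathcal{B}(E)$, $(t,x)\mapsto Q(t,x,A)$ is measurable; for all $T>0$ and compact $B\subset E$, $\sup_{(t,x)\in[0,T]\times B}Q(t,x,E)<\infty$. The minimal transition function $P$: put $P^{(0)}(s,x;t,A)=\mathbf{1}_A(x)e^{-\int_s^t q(r,x)dr}$ and, for $n\ge0$, $$P^{(n+1)}(s,x;t,A)=\int_s^t e^{-\int_s^r q(\tau,x)d\tau}\Big(\int_E P^{(n)}(r,y;t,A)\,Q(r,x,dy)\Big)dr,$$ and $P(s,x;t,A)=\sum_{n=0}^\infty P^{(n)}(s,x;t,A)$ for $0\le s\le t$. This is a sub-Markov transition function. An evolution system is a family $(U(s,t))_{0\le s\le t}$ of positive bounded linear operators with $U(s,s)F=F$ and $U(s,r)U(r,t)F=U(s,t)F$ for $0\le s\le r\le t$. A Feller evolution system on $C_b(E)$ is an evolution system on $C_b(E)$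 which is given by (sub-)probability kernels $W(s,t)F(x)=\int_E F(y)\widetilde P(s,x;t,dy)$ and for which $(s,t,x)\mapsto W(s,t)F(x)$ is continuous for every $F\in C_b(E)$; it is called conservative if $W(s,t)1=1$. In (c), being a solution of the backward equation means: for all $t>0$, $x\in E$, $s\mapsto W(s,t)F(x)$ is continuously differentiable on $[0,t]$ and satisfies the equation there. Being a solution of the forward equation means: for all $s\ge0$, $x\in E$, $t\mapsto W(s,t)F(x)$ is absolutely continuous on $[s,\infty)$ (locally) and the equation holds for a.a. $t\ge s$, where $W(s,t)L(t)F(x)=\int_E L(t)F(y)\widetilde P(s,x;t,dy)$ is assumed well defined.
   Formalization: In (a), the continuously differentiable backward equation is stated for F in C_b(E); for F in BM(E), where it fails in general (Q(t,x,·)=V(x)δ_{x+2+t}, F=1_[3,∞)), the map is absolutely continuous and the equation holds for a.e. s. *)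

theory Defs
  imports "HOL-Probability.Probability"
begin

definition BM :: "('a::topological_space \<Rightarrow> real) set" where
  "BM = {F \<in> borel_measurable borel. bounded (range F)}"

definition Cb :: "('a::topological_space \<Rightarrow> real) set" where
  "Cb = {F. continuous_on UNIV F \<and> bounded (range F)}"

definition sup_norm :: "('a \<Rightarrow> real) \<Rightarrow> real" where
  "sup_norm F = (SUP x. \<bar>F x\<bar>)"

definition weighted_norm :: "('a \<Rightarrow> real) \<Rightarrow> ('a \<Rightarrow> real) \<Rightarrow> real" where
  "weighted_norm V F = (SUP x. \<bar>F x\<bar> / (1 + V x))"

text \<open>A supremum over an unbounded set of reals is unspecified, so finiteness of the
  weighted norm is expressed by \<^const>\<open>bdd_above\<close>.\<close>

definition BM_V :: "('a::topological_space \<Rightarrow> real) \<Rightarrow> ('a \<Rightarrow> real) set" where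
  "BM_V V = {F \<in> borel_measurable borel. bdd_above (range (\<lambda>x. \<bar>F x\<bar> / (1 + V x)))}"

definition C_V :: "('a::topological_space \<Rightarrow> real) \<Rightarrow> ('a \<Rightarrow> real) set" where
  "C_V V = BM_V V \<inter> {F. continuous_on UNIV F}"

definition abs_continuous_on :: "real \<Rightarrow> real \<Rightarrow> (real \<Rightarrow> real) \<Rightarrow> bool" where
  "abs_continuous_on a b f \<longleftrightarrow>
    (\<forall>\<epsilon>>0. \<exists>\<delta>>0. \<forall>I :: (real \<times> real) set.
      finite I \<and> (\<forall>(u, v) \<in> I. a \<le> u \<and> u < v \<and> v \<le> b) \<and>
      pairwise (\<lambda>(u, v) (u', v'). disjnt {u<..<v} {u'<..<v'}) I \<and>
      (\<Sum>(u, v) \<in> I. v - u) < \<delta> \<longrightarrow>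
      (\<Sum>(u, v) \<in> I. \<bar>f v - f u\<bar>) < \<epsilon>)"

text \<open>Time is \<^typ>\<open>real\<close>; values at negative times are never constrained nor used.\<close>

definition transition_function :: "(real \<Rightarrow> 'a::topological_space \<Rightarrow> 'a measure) \<Rightarrow> bool" where
  "transition_function Q \<longleftrightarrow>
    (\<forall>t\<ge>0. \<forall>x. sets (Q t x) = sets borel \<and> finite_measure (Q t x) \<and> measure (Q t x) {x} = 0) \<and>
    (\<forall>A \<in> sets borel. (\<lambda>(t, x). measure (Q t x) A)
        \<in> borel_measurable (restrict_space borel {0..} \<Otimes>\<^sub>M borel)) \<and>
    (\<forall>T>0. \<forall>B. compact B \<longrightarrow> bdd_above ((\<lambda>(t, x). measure (Q t x) UNIV) ` ({0..T} \<times> B)))"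

definition rate :: "(real \<Rightarrow> 'a \<Rightarrow> 'a measure) \<Rightarrow> real \<Rightarrow> 'a \<Rightarrow> real" where
  "rate Q t x = measure (Q t x) UNIV"

definition Q_op :: "(real \<Rightarrow> 'a \<Rightarrow> 'a measure) \<Rightarrow> real \<Rightarrow> ('a \<Rightarrow> real) \<Rightarrow> 'a \<Rightarrow> real" where
  "Q_op Q t F x = (\<integral>y. F y \<partial>Q t x)"

definition L_op :: "(real \<Rightarrow> 'a \<Rightarrow> 'a measure) \<Rightarrow> real \<Rightarrow> ('a \<Rightarrow> real) \<Rightarrow> 'a \<Rightarrow> real" where
  "L_op Q t F x = (\<integral>y. (F y - F x) \<partial>Q t x)"

text \<open>All integrands are nonnegative except for the exponent, so the recursion takes values in
  \<^typ>\<open>ennreal\<close>.\<close>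

primrec jump_part ::
  "(real \<Rightarrow> 'a::topological_space \<Rightarrow> 'a measure) \<Rightarrow> nat \<Rightarrow> real \<Rightarrow> 'a \<Rightarrow> real \<Rightarrow> 'a set \<Rightarrow> ennreal"
where
  "jump_part Q 0 = (\<lambda>s x t A.
     indicator A x * ennreal (exp (- (LINT r:{s..t}|lborel. rate Q r x))))"
| "jump_part Q (Suc n) = (\<lambda>s x t A.
     \<integral>\<^sup>+r\<in>{s..t}. ennreal (exp (- (LINT \<tau>:{s..r}|lborel. rate Q \<tau> x))) *
        (\<integral>\<^sup>+y. jump_part Q n r y t A \<partial>Q r x) \<partial>lborel)"

definition minimal_transition ::
  "(real \<Rightarrow> 'a::topological_space \<Rightarrow> 'a measure) \<Rightarrow> real \<Rightarrow> 'a \<Rightarrow> real \<Rightarrow> 'a measure" where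
  "minimal_transition Q s x t =
     measure_of UNIV (sets borel) (\<lambda>A. \<Sum>n. jump_part Q n s x t A)"

text \<open>A family of kernels \<open>P s x t\<close> stands for \<open>P(s, x; t, dy)\<close>; \<^term>\<open>kernel_op P s t\<close> is the
  associated operator.\<close>

definition kernel_op ::
  "(real \<Rightarrow> 'a \<Rightarrow> real \<Rightarrow> 'a measure) \<Rightarrow> real \<Rightarrow> real \<Rightarrow> ('a \<Rightarrow> real) \<Rightarrow> 'a \<Rightarrow> real" where
  "kernel_op P s t F x = (\<integral>y. F y \<partial>P s x t)"

definition positive_bounded_linear_on ::
  "('a \<Rightarrow> real) set \<Rightarrow> (('a \<Rightarrow> real) \<Rightarrow> real) \<Rightarrow> (('a \<Rightarrow> real) \<Rightarrow> 'a \<Rightarrow> real) \<Rightarrow> bool" where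
  "positive_bounded_linear_on X N T \<longleftrightarrow>
    (\<forall>F\<in>X. T F \<in> X) \<and>
    (\<forall>F\<in>X. \<forall>G\<in>X. \<forall>a b. T (\<lambda>x. a * F x + b * G x) = (\<lambda>x. a * T F x + b * T G x)) \<and>
    (\<forall>F\<in>X. (\<forall>x. 0 \<le> F x) \<longrightarrow> (\<forall>x. 0 \<le> T F x)) \<and>
    (\<exists>K. \<forall>F\<in>X. N (T F) \<le> K * N F)"

definition evolution_system ::
  "('a \<Rightarrow> real) set \<Rightarrow> (('a \<Rightarrow> real) \<Rightarrow> real) \<Rightarrow>
    (real \<Rightarrow> real \<Rightarrow> ('a \<Rightarrow> real) \<Rightarrow> 'a \<Rightarrow> real) \<Rightarrow> bool" where
  "evolution_system X N U \<longleftrightarrow>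
    (\<forall>s t. 0 \<le> s \<and> s \<le> t \<longrightarrow> positive_bounded_linear_on X N (U s t)) \<and>
    (\<forall>s\<ge>0. \<forall>F\<in>X. U s s F = F) \<and>
    (\<forall>s r t. 0 \<le> s \<and> s \<le> r \<and> r \<le> t \<longrightarrow> (\<forall>F\<in>X. U s r (U r t F) = U s t F))"

text \<open>A Feller evolution system is represented by its kernels, since the forward equation below
  integrates the possibly unbounded function \<open>L(t)F\<close> against them.\<close>

definition feller_evolution_system ::
  "(real \<Rightarrow> 'a::topological_space \<Rightarrow> real \<Rightarrow> 'a measure) \<Rightarrow> bool" where
  "feller_evolution_system P \<longleftrightarrow>
    (\<forall>s t. 0 \<le> s \<and> s \<le> t \<longrightarrow> (\<lambda>x. P s x t) \<in> borel \<rightarrow>\<^sub>M subprob_algebra borel) \<and>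
    evolution_system Cb sup_norm (kernel_op P) \<and>
    (\<forall>F\<in>Cb. continuous_on {(s, t, x). 0 \<le> s \<and> s \<le> t} (\<lambda>(s, t, x). kernel_op P s t F x))"

definition conservative :: "(real \<Rightarrow> 'a \<Rightarrow> real \<Rightarrow> 'a measure) \<Rightarrow> bool" where
  "conservative P \<longleftrightarrow> (\<forall>s t. 0 \<le> s \<and> s \<le> t \<longrightarrow> kernel_op P s t (\<lambda>_. 1) = (\<lambda>_. 1))"

text \<open>Continuity of the right-hand side makes the solution continuously differentiable; at
  \<open>0\<close> and \<open>t\<close> the derivative is one-sided.\<close>

definition solves_backward ::
  "(real \<Rightarrow> 'a \<Rightarrow> 'a measure) \<Rightarrow> (real \<Rightarrow> 'a \<Rightarrow> real \<Rightarrow> 'a measure) \<Rightarrow> ('a \<Rightarrow> real) \<Rightarrow> bool" where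
  "solves_backward Q P F \<longleftrightarrow>
    (\<forall>t>0. \<forall>x.
      (\<forall>s\<in>{0..t}. ((\<lambda>r. kernel_op P r t F x) has_real_derivative
                      - L_op Q s (kernel_op P s t F) x) (at s within {0..t})) \<and>
      continuous_on {0..t} (\<lambda>s. - L_op Q s (kernel_op P s t F) x))"

definition solves_backward_ae ::
  "(real \<Rightarrow> 'a \<Rightarrow> 'a measure) \<Rightarrow> (real \<Rightarrow> 'a \<Rightarrow> real \<Rightarrow> 'a measure) \<Rightarrow> ('a \<Rightarrow> real) \<Rightarrow> bool" where
  "solves_backward_ae Q P F \<longleftrightarrow>
    (\<forall>t>0. \<forall>x.
      abs_continuous_on 0 t (\<lambda>s. kernel_op P s t F x) \<and>
      (AE s in lborel. s \<in> {0..t} \<longrightarrow>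
        integrable (Q s x) (kernel_op P s t F) \<and>
        ((\<lambda>r. kernel_op P r t F x) has_real_derivative
            - L_op Q s (kernel_op P s t F) x) (at s within {0..t})))"

definition solves_forward ::
  "(real \<Rightarrow> 'a \<Rightarrow> 'a measure) \<Rightarrow> (real \<Rightarrow> 'a \<Rightarrow> real \<Rightarrow> 'a measure) \<Rightarrow> ('a \<Rightarrow> real) \<Rightarrow> bool" where
  "solves_forward Q P F \<longleftrightarrow>
    (\<forall>s\<ge>0. \<forall>x.
      (\<forall>T>s. abs_continuous_on s T (\<lambda>t. kernel_op P s t F x)) \<and>
      (AE t in lborel. s \<le> t \<longrightarrow>
        integrable (P s x t) (L_op Q t F) \<and>
        ((\<lambda>r. kernel_op P s r F x) has_real_derivative
            kernel_op P s t (L_op Q t F) x) (at t within {s..})))"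

end

theory Submission
  imports Defs
begin

text \<open>Write \<open>q(t, x)\<close> for the jump rate, \<open>U(s, t)\<close> for the operators of the minimal transition
  function, and \<open>N\<^sub>n(s, t) F\<close> for the contribution of the paths with exactly \<open>n\<close> jumps, so that
  \<open>U = \<Sum>\<^sub>n N\<^sub>n\<close>. Everything rests on the recursion that removes the first jump:
  \<open>U(s, t) F(x)\<close> is \<open>F(x)\<close> times the probability \<open>e(s, t, x) = exp (- \<integral>\<^sub>s\<^sup>t q(r, x) dr)\<close> of no
  jump, plus \<open>\<integral>\<^sub>s\<^sup>t e(s, r, x) Q(r) U(r, t) F(x) dr\<close>.

  \<^bold>\<open>Moments and conservativity.\<close> The drift condition turns this recursion, by induction on the
  number of jumps, into \<open>U(s, t) V \<le> exp (\<integral>\<^sub>s\<^sup>t c) V\<close> (\<open>jump_sum_V_le\<close>). Removing the last jump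
  instead of the first one gives
  \<open>N\<^sub>n(s, t) F + \<integral>\<^sub>s\<^sup>t N\<^sub>n(s, r) (q(r) F) dr = \<integral>\<^sub>s\<^sup>t N\<^sub>n\<^sub>-\<^sub>1(s, r) Q(r) F dr\<close>, with right-hand side
  \<open>F\<close> for \<open>n = 0\<close> (\<open>jump_forward\<close>), whose sum over \<open>n\<close> is the forward equation in integrated form (\<open>P_forward_nn\<close>). As \<open>q \<le> a V\<close>,
  the moment bound makes both integrals finite, and for \<open>F = 1\<close> they are equal, so they cancel
  and leave \<open>U(s, t) 1 = 1\<close> (\<open>emeasure_P_UNIV\<close>).

  \<^bold>\<open>Equations almost everywhere.\<close> For fixed \<open>x\<close> the integrands of the backward and of the forward
  equation are bounded on compact time intervals. The solutions are therefore Lipschitz in time, and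
  Lebesgue's differentiation theorem, which follows from Vitali's covering theorem, yields the
  derivative at almost every time (\<open>solves_backward_ae_U\<close>, \<open>solves_forward_U\<close>).

  \<^bold>\<open>Continuity.\<close> For continuous \<open>F \<ge> 0\<close> the first-jump recursion is run with a continuous cut-off
  that vanishes where \<open>V \<ge> n\<close> after \<open>n\<close> steps. The rate is bounded on the remaining set, so these
  approximations are Lipschitz in both times up to any \<open>T\<close>, uniformly in space, hence jointly
  continuous, and they
  increase to \<open>U(s, t) F(x)\<close> (\<open>approx_tendsto_U\<close>). Thus \<open>U F\<close> is lower semicontinuous. The same
  holds for \<open>U (M - F)\<close>, which by conservativity is \<open>M - U F\<close>, and so \<open>U F\<close> is continuous
  (\<open>continuous_U\<close>). The same argument shows that \<open>r \<mapsto> Q(r) U(r, t) F(x)\<close> is continuous, which is what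
  makes the solution of the backward equation continuously differentiable.

  \<^bold>\<open>Uniqueness.\<close> Let \<open>W\<close> be a Feller evolution system as in the statement. Those \<open>F\<close> for which
  \<open>W F\<close> solves the backward equation form a linear space, and so do those for which it solves the
  forward equation; two subspaces whose union is the whole space cannot both be proper, so one of the
  two equations holds for all \<open>F\<close>. In either case \<open>W F \<ge> U F\<close> for \<open>F \<ge> 0\<close>: for the backward
  equation \<open>W F\<close> is a nonnegative fixed point of the first-jump recursion, which is monotone and whose
  iterates from \<open>0\<close> increase to \<open>U F\<close> (\<open>W_backward_ge_U\<close>), and for the forward equation \<open>r \<mapsto> W(s, r) G(r, t)\<close> is nondecreasing when
  \<open>G\<close> is one of the approximations of \<open>U F\<close> (\<open>pairing_mono\<close>). Applied to \<open>F + M\<close> and \<open>M - F\<close>, and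
  combined with \<open>W 1 \<le> 1 = U 1\<close>, this gives \<open>W F = U F\<close>.

  The rates at negative times are set equal to those at time \<open>0\<close>. All estimates then hold on the whole
  line, and no time has to be kept nonnegative until the end.\<close>

section \<open>Differentiation of indefinite integrals\<close>

text \<open>On intervals where the average of \<open>f\<close> is at least \<open>q\<close>, the values below \<open>p\<close> must be compensated by
  values outside \<open>A = {f < p}\<close>. Vitali's theorem covers the exceptional set, up to a null set, by
  disjoint such intervals within an open \<open>T \<supseteq> A\<close>; since \<open>T - A\<close> can be made small, so is the total
  length of the intervals. Intervals having \<open>x\<close> as an end point are allowed, as is needed for
  one-sided difference quotients.\<close>

lemma negligible_upper_averages:
  fixes f :: "real \<Rightarrow> real"
  assumes f_meas[measurable]: "f \<in> borel_measurable borel"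
    and f0: "\<And>x. 0 \<le> f x" and fM: "\<And>x. f x \<le> M" and p: "0 \<le> p" and pq: "p < q"
  shows "negligible {x \<in> {-N<..<N}. f x < p \<and>
    (\<forall>d>0. \<exists>u v. u \<le> x \<and> x \<le> v \<and> u < v \<and> v - u < d \<and>
       ennreal (q * (v - u)) \<le> (\<integral>\<^sup>+y\<in>{u..v}. ennreal (f y) \<partial>lborel))}" (is "negligible ?S")
  unfolding negligible_outer_le
proof (intro allI impI)
  fix e :: real assume e: "0 < e"
  define A where "A = {x \<in> {-N<..<N}. f x < p}"
  have A_sets[measurable]: "A \<in> sets borel"
    unfolding A_def by measurable
  have M: "0 \<le> M" using f0[of 0] fM[of 0] by linarith
  define \<delta> where "\<delta> = e * (q - p) / (M + 1)"
  have \<delta>: "\<delta> > 0" using e pq M by (simp add: \<delta>_def)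
  obtain T where T: "open T" "A \<subseteq> T" "T - A \<in> lmeasurable" "emeasure lebesgue (T - A) < ennreal \<delta>"
    using sets_lebesgue_outer_open[of A \<delta>] A_sets \<delta> by (metis sets_completionI_sets sets_lborel)
  have [measurable]: "T \<in> sets borel" using T(1) by simp
  have TA: "emeasure lborel (T - A) < ennreal \<delta>"
    using T(4) by simp
  define K where "K = {(u,v). u < v \<and> {u..v} \<subseteq> T \<and>
    ennreal (q * (v - u)) \<le> (\<integral>\<^sup>+y\<in>{u..v}. ennreal (f y) \<partial>lborel)}"
  define a :: "real \<times> real \<Rightarrow> real" where "a = (\<lambda>i. (fst i + snd i) / 2)"
  define r :: "real \<times> real \<Rightarrow> real" where "r = (\<lambda>i. (snd i - fst i) / 2)"
  have ball: "cball (a i) (r i) = {fst i..snd i}" for i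
    by (auto simp: cball_eq_atLeastAtMost a_def r_def field_simps)
  obtain C where C: "countable C" "C \<subseteq> K"
     "pairwise (\<lambda>i j. disjnt (cball (a i) (r i)) (cball (a j) (r j))) C"
     "negligible (?S - (\<Union>i \<in> C. cball (a i) (r i)))"
  proof (rule Vitali_covering_theorem_cballs[of K r ?S a])
    show "0 < r i" if "i \<in> K" for i
      using that by (auto simp: K_def r_def)
    fix x d :: real assume x: "x \<in> ?S" and d: "0 < d"
    then have "x \<in> T" using T(2) by (auto simp: A_def)
    then obtain d' where d': "d' > 0" "cball x d' \<subseteq> T"
      using T(1) open_contains_cball by blast
    have "0 < min d d'" using d d' by simp
    then obtain u v where uv: "u \<le> x" "x \<le> v" "u < v" "v - u < min d d'"
      "ennreal (q * (v - u)) \<le> (\<integral>\<^sup>+y\<in>{u..v}. ennreal (f y) \<partial>lborel)"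
      using x by blast
    have "{u..v} \<subseteq> cball x d'"
      using uv by (auto simp: cball_eq_atLeastAtMost)
    then have "(u, v) \<in> K" using uv d' by (auto simp: K_def)
    moreover have "x \<in> cball (a (u,v)) (r (u,v))" using uv ball by simp
    moreover have "r (u, v) < d" using uv d by (simp add: r_def)
    ultimately show "\<exists>i. i \<in> K \<and> x \<in> cball (a i) (r i) \<and> r i < d" by blast
  qed
  define U where "U = (\<Union>i\<in>C. {fst i..snd i})"
  have U_sets[measurable]: "U \<in> sets borel"
    unfolding U_def using C(1) by (intro sets.countable_UN') auto
  have disj: "disjoint_family_on (\<lambda>i. {fst i..snd i}) C"
    using C(3) unfolding ball by (auto simp: disjoint_family_on_def pairwise_def disjnt_def)
  have UT: "U \<subseteq> T" using C(2) unfolding U_def K_def by fastforce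
  have q: "0 < q" using p pq by simp
  define \<nu> where "\<nu> = density lborel (\<lambda>y. ennreal (f y))"
  have "ennreal q * emeasure lborel U = ennreal q * (\<integral>\<^sup>+i. emeasure lborel {fst i..snd i} \<partial>count_space C)"
    unfolding U_def by (subst emeasure_UN_countable) (use C(1) disj in auto)
  also have "\<dots> = (\<integral>\<^sup>+i. ennreal q * emeasure lborel {fst i..snd i} \<partial>count_space C)"
    by (simp add: nn_integral_cmult)
  also have "\<dots> \<le> (\<integral>\<^sup>+i. emeasure \<nu> {fst i..snd i} \<partial>count_space C)"
  proof (rule nn_integral_mono)
    fix i assume "i \<in> space (count_space C)"
    then have i: "i \<in> K" using C(2) by auto
    then have "ennreal q * emeasure lborel {fst i..snd i} = ennreal (q * (snd i - fst i))"
      using q by (auto simp: K_def ennreal_mult)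
    also have "\<dots> \<le> emeasure \<nu> {fst i..snd i}"
      using i by (auto simp: K_def \<nu>_def emeasure_density)
    finally show "ennreal q * emeasure lborel {fst i..snd i} \<le> emeasure \<nu> {fst i..snd i}" .
  qed
  also have "\<dots> = emeasure \<nu> U"
    unfolding U_def by (subst emeasure_UN_countable) (use C(1) disj in \<open>auto simp: \<nu>_def\<close>)
  also have "\<dots> = (\<integral>\<^sup>+y. ennreal (f y) * indicator U y \<partial>lborel)"
    by (simp add: \<nu>_def emeasure_density)
  also have "\<dots> \<le> (\<integral>\<^sup>+y. ennreal p * indicator U y + ennreal M * indicator (T - A) y \<partial>lborel)"
  proof (rule nn_integral_mono_AE)
    \<comment> \<open>points of \<open>U\<close> outside \<open>A\<close> lie in the small set \<open>T - A\<close>, where \<open>f \<le> M\<close> is enough\<close>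
    have "ennreal (f y) \<le> ennreal p" if "y \<in> A" for y
      using that by (intro ennreal_leI) (auto simp: A_def)
    moreover have "ennreal (f y) \<le> ennreal M" for y
      using fM by (intro ennreal_leI)
    ultimately show "AE y in lborel. ennreal (f y) * indicator U y
        \<le> ennreal p * indicator U y + ennreal M * indicator (T - A) y"
      using UT by (intro AE_I2) (auto simp: indicator_def add_increasing split: if_splits)
  qed
  also have "\<dots> = ennreal p * emeasure lborel U + ennreal M * emeasure lborel (T - A)"
    by (simp add: nn_integral_add nn_integral_cmult)
  also have "\<dots> \<le> ennreal p * emeasure lborel U + ennreal M * ennreal \<delta>"
    using TA by (intro add_left_mono mult_left_mono) auto
  finally have main: "ennreal q * emeasure lborel U \<le> ennreal p * emeasure lborel U + ennreal M * ennreal \<delta>" .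
  have "emeasure lborel U \<le> emeasure lborel ({-N<..<N} \<union> (T - A))"
    using UT by (intro emeasure_mono) (auto simp: A_def)
  also have "\<dots> \<le> emeasure lborel {-N<..<N} + emeasure lborel (T - A)"
    by (rule emeasure_subadditive) auto
  also have "\<dots> < \<infinity>"
  proof -
    have "emeasure lborel {-N<..<N} < \<infinity>" by (cases "-N \<le> N") auto
    then show ?thesis using TA by (auto simp: less_top[symmetric] top_unique)
  qed
  finally have fin: "emeasure lborel U < \<infinity>" .
  define m where "m = measure lborel U"
  have em: "emeasure lborel U = ennreal m"
    using fin by (simp add: m_def emeasure_eq_ennreal_measure)
  have m0: "0 \<le> m" by (simp add: m_def)
  have "q * m \<le> p * m + M * \<delta>"
    using main q p M \<delta> m0 unfolding em
    by (simp add: ennreal_mult[symmetric] ennreal_plus[symmetric] del: ennreal_plus)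
  then have "(q - p) * m \<le> M * \<delta>" by (simp add: algebra_simps)
  also have "M * \<delta> \<le> (q - p) * e"
    using M e pq by (simp add: \<delta>_def field_simps)
  finally have "m \<le> e" using pq by simp
  define Z where "Z = ?S - (\<Union>i \<in> C. cball (a i) (r i))"
  have Z: "negligible Z" using C(4) by (simp add: Z_def)
  have US: "?S \<subseteq> U \<union> Z" by (auto simp: U_def Z_def ball)
  have Ul: "U \<in> lmeasurable" using fin by (auto simp: fmeasurable_def)
  have Zl: "Z \<in> lmeasurable" using Z by (rule negligible_imp_measurable)
  have "measure lebesgue (U \<union> Z) \<le> measure lebesgue U + measure lebesgue Z"
    using Ul Zl by (rule measure_Un_le[OF fmeasurableD fmeasurableD])
  also have "\<dots> = m" using Z by (simp add: m_def negligible_imp_measure0)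
  finally have "measure lebesgue (U \<union> Z) \<le> e" using \<open>m \<le> e\<close> by simp
  then show "\<exists>T. ?S \<subseteq> T \<and> T \<in> lmeasurable \<and> measure lebesgue T \<le> e"
    using US Ul Zl by (intro exI[of _ "U \<union> Z"]) auto
qed

lemma set_integrable_bounded_interval:
  fixes m :: "real \<Rightarrow> real"
  assumes m[measurable]: "m \<in> borel_measurable borel" and bnd: "\<And>x. x \<in> {a..b} \<Longrightarrow> \<bar>m x\<bar> \<le> M"
  shows "set_integrable lborel {a..b} m"
  unfolding set_integrable_def
  by (rule integrableI_bounded_set[where A = "{a..b}" and B = M])
    (use bnd in \<open>auto simp: indicator_def emeasure_lborel_Icc_eq\<close>)

text \<open>Rational thresholds \<open>p < q\<close> separate \<open>f x\<close> from \<open>f x + e\<close>, so countably many null sets suffice. The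
  shift by \<open>M\<close> makes the function nonnegative; the lower estimate is this one for \<open>- f\<close>.\<close>

lemma AE_upper_difference_quotient:
  fixes f F :: "real \<Rightarrow> real"
  assumes f_meas[measurable]: "f \<in> borel_measurable borel" and fM: "\<And>x. \<bar>f x\<bar> \<le> M"
    and F: "\<And>u v. u \<le> v \<Longrightarrow> F v - F u = (LINT y:{u..v}|lborel. f y)"
  shows "AE x in lborel. \<forall>e>0. \<exists>d>0. \<forall>u v. u \<le> x \<longrightarrow> x \<le> v \<longrightarrow> u < v \<longrightarrow> v - u < d \<longrightarrow>
           F v - F u \<le> (f x + e) * (v - u)"
proof -
  define B where "B = (\<lambda>(p, q, n::nat). {x \<in> {- real n<..<real n}. f x + M < p \<and>
    (\<forall>d>0. \<exists>u v. u \<le> x \<and> x \<le> v \<and> u < v \<and> v - u < d \<and>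
       ennreal (q * (v - u)) \<le> (\<integral>\<^sup>+y\<in>{u..v}. ennreal (f y + M) \<partial>lborel))})"
  define I where "I = {(p, q, n) \<in> \<rat> \<times> \<rat> \<times> (UNIV :: nat set). 0 \<le> p \<and> p < (q::real)}"
  have bnd: "0 \<le> f x + M" "f x + M \<le> 2 * M" for x
    using fM[of x] by auto
  have "countable I"
    unfolding I_def
    by (rule countable_subset[of _ "\<rat> \<times> \<rat> \<times> UNIV"]) (auto intro!: countable_SIGMA countable_rat)
  moreover have "B i \<in> null_sets lebesgue" if i: "i \<in> I" for i
  proof -
    obtain p q n where pqn: "i = (p, q, n)" "0 \<le> p" "p < q" using i by (auto simp: I_def)
    show ?thesis
      using negligible_upper_averages[of "\<lambda>y. f y + M" "2 * M" p q "real n"] bnd pqn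
      by (simp add: B_def negligible_iff_null_sets)
  qed
  ultimately have "(\<Union>i\<in>I. B i) \<in> null_sets lebesgue"
    by (rule null_sets_UN')
  then have "AE x in lebesgue. x \<notin> (\<Union>i\<in>I. B i)" by (rule AE_not_in)
  then have "AE x in lborel. x \<notin> (\<Union>i\<in>I. B i)" by (simp add: AE_completion_iff)
  then show ?thesis
  proof (rule AE_mp, intro AE_I2 impI allI)
    fix x e :: real assume x: "x \<notin> (\<Union>i\<in>I. B i)" and e: "0 < e"
    obtain p where p: "p \<in> \<rat>" "f x + M < p" "p < f x + M + e"
      using Rats_dense_in_real[of "f x + M" "f x + M + e"] e by auto
    obtain q where q: "q \<in> \<rat>" "p < q" "q < f x + M + e"
      using Rats_dense_in_real[of p "f x + M + e"] p by auto
    obtain n :: nat where n: "\<bar>x\<bar> < real n" using reals_Archimedean2 by blast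
    have "(p, q, n) \<in> I" using p q bnd[of x] by (auto simp: I_def)
    then have "x \<notin> B (p, q, n)" using x by auto
    then obtain d where d: "d > 0" and nd: "\<And>u v. \<lbrakk>u \<le> x; x \<le> v; u < v; v - u < d\<rbrakk> \<Longrightarrow>
       \<not> ennreal (q * (v - u)) \<le> (\<integral>\<^sup>+y\<in>{u..v}. ennreal (f y + M) \<partial>lborel)"
      using n p(2) unfolding B_def by auto
    show "\<exists>d>0. \<forall>u v. u \<le> x \<longrightarrow> x \<le> v \<longrightarrow> u < v \<longrightarrow> v - u < d \<longrightarrow>
           F v - F u \<le> (f x + e) * (v - u)"
    proof (intro exI[of _ d] conjI allI impI d)
      fix u v assume uv: "u \<le> x" "x \<le> v" "u < v" "v - u < d"
      have int: "set_integrable lborel {u..v} f"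
        using fM by (intro set_integrable_bounded_interval) auto
      have int2: "set_integrable lborel {u..v} (\<lambda>y. M)"
        by (intro set_integrable_bounded_interval[where M = "\<bar>M\<bar>"]) auto
      have "(\<integral>\<^sup>+y\<in>{u..v}. ennreal (f y + M) \<partial>lborel) = (\<integral>\<^sup>+y. ennreal (indicator {u..v} y * (f y + M)) \<partial>lborel)"
        by (intro nn_integral_cong) (auto simp: indicator_def)
      also have "\<dots> = ennreal (LINT y:{u..v}|lborel. f y + M)"
        unfolding set_lebesgue_integral_def real_scaleR_def
      proof (rule nn_integral_eq_integral)
        show "integrable lborel (\<lambda>y. indicat_real {u..v} y * (f y + M))"
          using set_integral_add(1)[OF int int2] by (simp add: set_integrable_def)
      qed (use bnd in \<open>auto simp: indicator_def\<close>)
      also have "(LINT y:{u..v}|lborel. f y + M) = F v - F u + M * (v - u)"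
      proof -
        have "(LINT y:{u..v}|lborel. M) = M * (v - u)"
          using uv by (simp add: set_lebesgue_integral_def)
        then show ?thesis using uv by (simp add: set_integral_add(2)[OF int int2] F)
      qed
      finally have "\<not> ennreal (q * (v - u)) \<le> ennreal (F v - F u + M * (v - u))"
        using nd[OF uv] by simp
      then have "F v - F u + M * (v - u) < q * (v - u)"
        using ennreal_leI linorder_not_less by blast
      also have "\<dots> \<le> (f x + M + e) * (v - u)"
        using q uv by (intro mult_right_mono) auto
      finally show "F v - F u \<le> (f x + e) * (v - u)"
        by (simp add: algebra_simps)
    qed
  qed
qed

text \<open>Lebesgue's differentiation theorem for bounded functions on the line.\<close>

lemma AE_has_real_derivative_indefinite_integral:
  fixes f F :: "real \<Rightarrow> real"
  assumes f_meas[measurable]: "f \<in> borel_measurable borel" and fM: "\<And>x. \<bar>f x\<bar> \<le> M"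
    and F: "\<And>u v. u \<le> v \<Longrightarrow> F v - F u = (LINT y:{u..v}|lborel. f y)"
  shows "AE x in lborel. (F has_real_derivative f x) (at x)"
proof -
  have "AE x in lborel. \<forall>e>0. \<exists>d>0. \<forall>u v. u \<le> x \<longrightarrow> x \<le> v \<longrightarrow> u < v \<longrightarrow> v - u < d \<longrightarrow>
           F v - F u \<le> (f x + e) * (v - u)"
    by (rule AE_upper_difference_quotient[OF assms])
  moreover have "AE x in lborel. \<forall>e>0. \<exists>d>0. \<forall>u v. u \<le> x \<longrightarrow> x \<le> v \<longrightarrow> u < v \<longrightarrow> v - u < d \<longrightarrow>
           - F v - - F u \<le> (- f x + e) * (v - u)"
  proof (rule AE_upper_difference_quotient[where M = M])
    show "- F v - - F u = (LINT y:{u..v}|lborel. - f y)" if "u \<le> v" for u v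
      using F[OF that] by (simp add: set_lebesgue_integral_def)
  qed (use fM in auto)
  ultimately show ?thesis
  proof eventually_elim
    case (elim x)
    show ?case
      unfolding has_field_derivative_def has_derivative_at_alt
    proof (intro conjI allI impI)
      show "bounded_linear ((*) (f x))" by (rule bounded_linear_mult_right)
      fix e :: real assume e: "0 < e"
      obtain d1 where d1: "d1 > 0" "\<And>u v. \<lbrakk>u \<le> x; x \<le> v; u < v; v - u < d1\<rbrakk> \<Longrightarrow> F v - F u \<le> (f x + e) * (v - u)"
        using elim(1) e by blast
      obtain d2 where d2: "d2 > 0" "\<And>u v. \<lbrakk>u \<le> x; x \<le> v; u < v; v - u < d2\<rbrakk> \<Longrightarrow> - F v - - F u \<le> (- f x + e) * (v - u)"
        using elim(2) e by blast
      show "\<exists>d>0. \<forall>y. norm (y - x) < d \<longrightarrow> norm (F y - F x - f x * (y - x)) \<le> e * norm (y - x)"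
      proof (intro exI[of _ "min d1 d2"] conjI allI impI)
        fix y assume y: "norm (y - x) < min d1 d2"
        consider "y = x" | "x < y" | "y < x" by linarith
        then show "norm (F y - F x - f x * (y - x)) \<le> e * norm (y - x)"
        proof cases
          case 2
          then show ?thesis using d1(2)[of x y] d2(2)[of x y] y by (auto simp: algebra_simps abs_le_iff)
        next
          case 3
          then show ?thesis using d1(2)[of y x] d2(2)[of y x] y by (auto simp: algebra_simps abs_le_iff)
        qed auto
      qed (use d1 d2 in auto)
    qed
  qed
qed

lemma abs_continuous_on_subset:
  "abs_continuous_on a b f \<Longrightarrow> a \<le> a' \<Longrightarrow> b' \<le> b \<Longrightarrow> abs_continuous_on a' b' f"
  unfolding abs_continuous_on_def by (smt (verit, best) case_prodD case_prodI2)

lemma lipschitz_imp_abs_continuous_on: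
  assumes lip: "\<And>u v. \<lbrakk>a \<le> u; u \<le> v; v \<le> b\<rbrakk> \<Longrightarrow> \<bar>f v - f u\<bar> \<le> K * (v - u)"
  shows "abs_continuous_on a b f"
  unfolding abs_continuous_on_def
proof (intro allI impI)
  fix e :: real assume e: "0 < e"
  show "\<exists>\<delta>>0. \<forall>I. finite I \<and> (\<forall>(u, v)\<in>I. a \<le> u \<and> u < v \<and> v \<le> b) \<and>
      pairwise (\<lambda>(u, v) (u', v'). disjnt {u<..<v} {u'<..<v'}) I \<and> (\<Sum>(u, v)\<in>I. v - u) < \<delta> \<longrightarrow>
      (\<Sum>(u, v)\<in>I. \<bar>f v - f u\<bar>) < e"
  proof (intro exI[of _ "e / (\<bar>K\<bar> + 1)"] conjI allI impI)
    fix I :: "(real \<times> real) set"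
    assume I: "finite I \<and> (\<forall>(u, v)\<in>I. a \<le> u \<and> u < v \<and> v \<le> b) \<and>
      pairwise (\<lambda>(u, v) (u', v'). disjnt {u<..<v} {u'<..<v'}) I \<and> (\<Sum>(u, v)\<in>I. v - u) < e / (\<bar>K\<bar> + 1)"
    have "(\<Sum>(u, v)\<in>I. \<bar>f v - f u\<bar>) \<le> (\<Sum>(u, v)\<in>I. (\<bar>K\<bar> + 1) * (v - u))"
    proof (rule sum_mono, clarify)
      fix u v assume "(u, v) \<in> I"
      then have uv: "a \<le> u" "u < v" "v \<le> b" using I by auto
      have "\<bar>f v - f u\<bar> \<le> K * (v - u)" using uv by (intro lip) auto
      also have "\<dots> \<le> (\<bar>K\<bar> + 1) * (v - u)" using uv by (intro mult_right_mono) auto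
      finally show "\<bar>f v - f u\<bar> \<le> (\<bar>K\<bar> + 1) * (v - u)" .
    qed
    also have "\<dots> = (\<bar>K\<bar> + 1) * (\<Sum>(u, v)\<in>I. v - u)"
      by (simp add: sum_distrib_left case_prod_unfold)
    also have "\<dots> < (\<bar>K\<bar> + 1) * (e / (\<bar>K\<bar> + 1))"
      using I by (intro mult_strict_left_mono) auto
    also have "\<dots> = e" by (simp add: field_simps add_nonneg_eq_0_iff)
    finally show "(\<Sum>(u, v)\<in>I. \<bar>f v - f u\<bar>) < e" .
  qed (use e in \<open>auto intro!: divide_pos_pos add_nonneg_pos\<close>)
qed

lemma abs_continuous_on_diff:
  assumes f: "abs_continuous_on a b f" and g: "abs_continuous_on a b g"
  shows "abs_continuous_on a b (\<lambda>x. f x - g x)"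
  unfolding abs_continuous_on_def
proof (intro allI impI)
  fix e :: real assume "0 < e"
  then have e2: "0 < e / 2" by simp
  from f e2 obtain d1 where d1: "d1 > 0" "\<And>I. finite I \<and> (\<forall>(u, v)\<in>I. a \<le> u \<and> u < v \<and> v \<le> b) \<and>
      pairwise (\<lambda>(u, v) (u', v'). disjnt {u<..<v} {u'<..<v'}) I \<and> (\<Sum>(u, v)\<in>I. v - u) < d1 \<Longrightarrow>
      (\<Sum>(u, v)\<in>I. \<bar>f v - f u\<bar>) < e / 2" unfolding abs_continuous_on_def by meson
  from g e2 obtain d2 where d2: "d2 > 0" "\<And>I. finite I \<and> (\<forall>(u, v)\<in>I. a \<le> u \<and> u < v \<and> v \<le> b) \<and>
      pairwise (\<lambda>(u, v) (u', v'). disjnt {u<..<v} {u'<..<v'}) I \<and> (\<Sum>(u, v)\<in>I. v - u) < d2 \<Longrightarrow>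
      (\<Sum>(u, v)\<in>I. \<bar>g v - g u\<bar>) < e / 2" unfolding abs_continuous_on_def by meson
  show "\<exists>\<delta>>0. \<forall>I. finite I \<and> (\<forall>(u, v)\<in>I. a \<le> u \<and> u < v \<and> v \<le> b) \<and>
      pairwise (\<lambda>(u, v) (u', v'). disjnt {u<..<v} {u'<..<v'}) I \<and> (\<Sum>(u, v)\<in>I. v - u) < \<delta> \<longrightarrow>
      (\<Sum>(u, v)\<in>I. \<bar>f v - g v - (f u - g u)\<bar>) < e"
  proof (intro exI[of _ "min d1 d2"] conjI allI impI)
    fix I :: "(real \<times> real) set"
    assume I: "finite I \<and> (\<forall>(u, v)\<in>I. a \<le> u \<and> u < v \<and> v \<le> b) \<and>
      pairwise (\<lambda>(u, v) (u', v'). disjnt {u<..<v} {u'<..<v'}) I \<and> (\<Sum>(u, v)\<in>I. v - u) < min d1 d2"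
    have "(\<Sum>(u, v)\<in>I. \<bar>f v - g v - (f u - g u)\<bar>) \<le> (\<Sum>(u, v)\<in>I. \<bar>f v - f u\<bar> + \<bar>g v - g u\<bar>)"
      by (rule sum_mono) auto
    also have "\<dots> = (\<Sum>(u, v)\<in>I. \<bar>f v - f u\<bar>) + (\<Sum>(u, v)\<in>I. \<bar>g v - g u\<bar>)"
      by (simp add: sum.distrib case_prod_unfold)
    also have "\<dots> < e" using d1(2)[of I] d2(2)[of I] I by simp
    finally show "(\<Sum>(u, v)\<in>I. \<bar>f v - g v - (f u - g u)\<bar>) < e" .
  qed (use d1 d2 in auto)
qed

text \<open>Cousin's lemma provides a tagged division that is fine for the following gauge. At a point where the
  derivative exists and is nonnegative, \<open>\<phi>\<close> loses at most \<open>\<epsilon>\<close> times the length of a short interval.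
  The intervals tagged by the exceptional null set are kept inside an open set of length less than
  \<open>\<delta>\<close>, so that absolute continuity bounds the loss on all of them together.\<close>

lemma abs_continuous_on_AE_deriv_nonneg_imp_le:
  fixes \<phi> :: "real \<Rightarrow> real"
  assumes ab: "a \<le> b" and AC: "abs_continuous_on a b \<phi>"
    and deriv: "AE x in lborel. x \<in> {a..b} \<longrightarrow> (\<exists>D\<ge>0. (\<phi> has_real_derivative D) (at x within {a..b}))"
  shows "\<phi> a \<le> \<phi> b"
proof -
  have "\<phi> a - \<phi> b \<le> e" if e: "0 < e" for e
  proof -
    define \<epsilon> where "\<epsilon> = e / (2 * (b - a + 1))"
    have \<epsilon>: "0 < \<epsilon>" using e ab by (simp add: \<epsilon>_def)
    have e2: "0 < e / 2" using e by simp
    obtain \<delta> where \<delta>: "\<delta> > 0" "\<And>I. finite I \<and> (\<forall>(u, v)\<in>I. a \<le> u \<and> u < v \<and> v \<le> b) \<and>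
        pairwise (\<lambda>(u, v) (u', v'). disjnt {u<..<v} {u'<..<v'}) I \<and> (\<Sum>(u, v)\<in>I. v - u) < \<delta> \<Longrightarrow>
        (\<Sum>(u, v)\<in>I. \<bar>\<phi> v - \<phi> u\<bar>) < e / 2"
      using AC e2 unfolding abs_continuous_on_def by meson
    obtain N where N: "{x. \<not> (x \<in> {a..b} \<longrightarrow> (\<exists>D\<ge>0. (\<phi> has_real_derivative D) (at x within {a..b})))} \<subseteq> N"
      "emeasure lborel N = 0" "N \<in> sets borel"
      using AE_E[OF deriv] by auto
    obtain T where T: "open T" "N \<subseteq> T" "T - N \<in> lmeasurable" "emeasure lebesgue (T - N) < ennreal \<delta>"
      using sets_lebesgue_outer_open[of N \<delta>] N(3) \<delta>(1) by (metis sets_completionI_sets sets_lborel)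
    have T_sets: "T \<in> sets borel" using T(1) by simp
    have "emeasure lborel T = emeasure lborel (T - N) + emeasure lborel N"
      using T_sets N T(2) by (subst plus_emeasure) (auto simp: Un_absorb2)
    also have "\<dots> < ennreal \<delta>" using T(4) T_sets N by simp
    finally have emT: "emeasure lborel T < ennreal \<delta>" .
    define good where "good = (\<lambda>x d. d > 0 \<and> (\<forall>u v. a \<le> u \<longrightarrow> u \<le> x \<longrightarrow> x \<le> v \<longrightarrow> v \<le> b \<longrightarrow>
        \<bar>u - x\<bar> < d \<longrightarrow> \<bar>v - x\<bar> < d \<longrightarrow> \<phi> v - \<phi> u \<ge> - \<epsilon> * (v - u)))"
    have good_ex: "\<exists>d. good x d" if x: "x \<notin> N" for x
    proof (cases "x \<in> {a..b}")
      case True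
      then obtain D where D: "D \<ge> 0" "(\<phi> has_real_derivative D) (at x within {a..b})"
        using x N(1) by blast
      from D(2) \<epsilon> obtain d where d: "d > 0"
        "\<And>y. y \<in> {a..b} \<Longrightarrow> norm (y - x) < d \<Longrightarrow> norm (\<phi> y - \<phi> x - D * (y - x)) \<le> \<epsilon> * norm (y - x)"
        unfolding has_field_derivative_def has_derivative_within_alt by blast
      have "good x d"
        unfolding good_def
      proof (intro conjI allI impI d)
        fix u v assume uv: "a \<le> u" "u \<le> x" "x \<le> v" "v \<le> b" "\<bar>u - x\<bar> < d" "\<bar>v - x\<bar> < d"
        have 1: "\<phi> v - \<phi> x - D * (v - x) \<ge> - (\<epsilon> * (v - x))"
          using d(2)[of v] uv by auto
        have 2: "\<phi> u - \<phi> x - D * (u - x) \<le> \<epsilon> * (x - u)"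
          using d(2)[of u] uv by auto
        have "D * (v - x) \<ge> 0" "D * (x - u) \<ge> 0" using D uv by auto
        with 1 2 show "\<phi> v - \<phi> u \<ge> - \<epsilon> * (v - u)" by (simp add: algebra_simps)
      qed
      then show ?thesis by blast
    next
      case False
      then show ?thesis by (intro exI[of _ 1]) (auto simp: good_def)
    qed
    define d where "d = (\<lambda>x. SOME d. good x d)"
    have d: "good x (d x)" if "x \<notin> N" for x
      unfolding d_def using good_ex[OF that] by (rule someI_ex)
    \<comment> \<open>good tags control their own interval; bad tags only keep theirs inside \<open>T\<close>\<close>
    define \<gamma> where "\<gamma> = (\<lambda>x. if x \<in> N then T else ball x (d x))"
    have "gauge \<gamma>"
      unfolding gauge_def \<gamma>_def using T d by (auto simp: good_def)
    then obtain p where p: "p tagged_division_of {a..b}" "\<gamma> fine p"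
      by (rule fine_division_exists_real)
    have fin: "finite p" using p(1) by auto
    have K: "\<exists>u v. K = {u..v} \<and> a \<le> u \<and> u \<le> x \<and> x \<le> v \<and> v \<le> b \<and> Inf K = u \<and> Sup K = v"
      if xK: "(x, K) \<in> p" for x K
    proof -
      obtain u v where uv: "K = cbox u v" using tagged_division_ofD(4)[OF p(1)] xK by blast
      have "x \<in> K" "K \<subseteq> {a..b}" using tagged_division_ofD(2,3)[OF p(1) xK] by auto
      then show ?thesis using uv by (intro exI[of _ u] exI[of _ v]) auto
    qed
    \<comment> \<open>degenerate intervals are split off, since absolute continuity is about proper ones\<close>
    define p1 where "p1 = {(x, K) \<in> p. x \<notin> N}"
    define p2 where "p2 = {(x, K) \<in> p. x \<in> N \<and> Inf K < Sup K}"
    define p3 where "p3 = {(x, K) \<in> p. x \<in> N \<and> Inf K = Sup K}"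
    have pp: "p = p1 \<union> p2 \<union> p3"
    proof -
      have "Inf K \<le> Sup K" if "(x, K) \<in> p" for x K using K[OF that] by auto
      then show ?thesis by (auto simp: p1_def p2_def p3_def order_le_less)
    qed
    have fin3: "finite p1" "finite p2" "finite p3" using fin pp by auto
    have sum_split: "sum g p = sum g p1 + sum g p2 + sum g p3" for g :: "real \<times> real set \<Rightarrow> real"
    proof -
      have "p1 \<inter> p2 = {}" "(p1 \<union> p2) \<inter> p3 = {}" by (auto simp: p1_def p2_def p3_def)
      then show ?thesis using fin3 unfolding pp by (simp add: sum.union_disjoint)
    qed
    have len: "(\<Sum>(x,K)\<in>p. Sup K - Inf K) = b - a"
      using additive_tagged_division_1[OF ab p(1), of "\<lambda>x. x"] .
    have len3: "(\<Sum>(x,K)\<in>p3. Sup K - Inf K) = 0" by (rule sum.neutral) (auto simp: p3_def)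
    have len2: "(\<Sum>(x,K)\<in>p2. Sup K - Inf K) \<ge> 0" by (rule sum_nonneg) (auto simp: p2_def)
    have part1: "(\<Sum>(x,K)\<in>p1. \<phi> (Sup K) - \<phi> (Inf K)) \<ge> - (e / 2)"
    proof -
      have "(\<Sum>(x,K)\<in>p1. \<phi> (Sup K) - \<phi> (Inf K)) \<ge> (\<Sum>(x,K)\<in>p1. - \<epsilon> * (Sup K - Inf K))"
      proof (rule sum_mono, clarify)
        fix x K assume xK: "(x, K) \<in> p1"
        then have x: "(x, K) \<in> p" "x \<notin> N" by (auto simp: p1_def)
        obtain u v where uv: "K = {u..v}" "a \<le> u" "u \<le> x" "x \<le> v" "v \<le> b" "Inf K = u" "Sup K = v"
          using K[OF x(1)] by blast
        have "K \<subseteq> ball x (d x)" using fineD[OF p(2) x(1)] x(2) by (simp add: \<gamma>_def)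
        moreover have "u \<in> K" "v \<in> K" using uv by simp_all
        ultimately have "u \<in> ball x (d x)" "v \<in> ball x (d x)" by blast+
        then have "\<bar>u - x\<bar> < d x" "\<bar>v - x\<bar> < d x" by (auto simp: dist_real_def)
        then show "- \<epsilon> * (Sup K - Inf K) \<le> \<phi> (Sup K) - \<phi> (Inf K)"
          using d[OF x(2)] uv unfolding good_def by auto
      qed
      also have "(\<Sum>(x,K)\<in>p1. - \<epsilon> * (Sup K - Inf K)) = - \<epsilon> * (\<Sum>(x,K)\<in>p1. Sup K - Inf K)"
        by (simp add: sum_distrib_left case_prod_unfold)
      also have "(\<Sum>(x,K)\<in>p1. Sup K - Inf K) \<le> b - a"
        using len len2 len3 sum_split[of "\<lambda>(x,K). Sup K - Inf K"] by simp
      then have "- \<epsilon> * (\<Sum>(x,K)\<in>p1. Sup K - Inf K) \<ge> - \<epsilon> * (b - a)"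
        using \<epsilon> by (intro mult_left_mono_neg) auto
      moreover have "\<epsilon> * (b - a) \<le> e / 2"
        using ab e by (simp add: \<epsilon>_def field_simps)
      ultimately show ?thesis by linarith
    qed
    have part2: "(\<Sum>(x,K)\<in>p2. \<phi> (Sup K) - \<phi> (Inf K)) \<ge> - (e / 2)"
    proof -
      define I where "I = (\<lambda>(x,K). (Inf K, Sup K)) ` p2"
      have disj: "{Inf K<..<Sup K} \<inter> {Inf K'<..<Sup K'} = {}"
        if "(x, K) \<in> p2" "(x', K') \<in> p2" "(x, K) \<noteq> (x', K')" for x K x' K'
      proof -
        have in_p: "(x, K) \<in> p" "(x', K') \<in> p" using that by (auto simp: p2_def)
        have "interior K \<inter> interior K' = {}"
          using tagged_division_ofD(5)[OF p(1) in_p that(3)] .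
        moreover have "interior K = {Inf K<..<Sup K}" "interior K' = {Inf K'<..<Sup K'}"
          using K[OF in_p(1)] K[OF in_p(2)] interior_atLeastAtMost_real by metis+
        ultimately show ?thesis by simp
      qed
      have inj: "inj_on (\<lambda>(x,K). (Inf K, Sup K)) p2"
      proof (rule inj_onI, clarify)
        fix x K x' K'
        assume A: "(x, K) \<in> p2" "(x', K') \<in> p2" "Inf K = Inf K'" "Sup K = Sup K'"
        have "{Inf K<..<Sup K} \<noteq> {}" using A(1) by (auto simp: p2_def)
        then show "x = x' \<and> K = K'" using disj[OF A(1,2)] A(3,4) by auto
      qed
      have sumI: "(\<Sum>(u,v)\<in>I. g u v) = (\<Sum>(x,K)\<in>p2. g (Inf K) (Sup K))" for g :: "real \<Rightarrow> real \<Rightarrow> real"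
        unfolding I_def by (subst sum.reindex[OF inj]) (simp add: case_prod_unfold o_def)
      have finI: "finite I" using fin3 by (simp add: I_def)
      have pwI: "pairwise (\<lambda>(u, v) (u', v'). disjnt {u<..<v} {u'<..<v'}) I"
        unfolding pairwise_def I_def disjnt_def using disj by fastforce
      have rangeI: "\<forall>(u, v)\<in>I. a \<le> u \<and> u < v \<and> v \<le> b"
      proof (clarsimp simp: I_def)
        fix x K assume xK: "(x, K) \<in> p2"
        then have "(x, K) \<in> p" "Inf K < Sup K" by (auto simp: p2_def)
        then show "a \<le> Inf K \<and> Inf K < Sup K \<and> Sup K \<le> b" using K[of x K] by auto
      qed
      have "ennreal (\<Sum>(u,v)\<in>I. v - u) = (\<Sum>i\<in>I. emeasure lborel {fst i<..<snd i})"
        using rangeI by (subst sum_ennreal[symmetric]) (auto simp: case_prod_unfold less_imp_le intro!: sum.cong)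
      also have "\<dots> = emeasure lborel (\<Union>i\<in>I. {fst i<..<snd i})"
        using finI pwI by (intro sum_emeasure)
          (auto simp: disjoint_family_on_def pairwise_def disjnt_def case_prod_unfold)
      also have "\<dots> \<le> emeasure lborel T"
      proof (rule emeasure_mono)
        have "{Inf K<..<Sup K} \<subseteq> T" if "(x, K) \<in> p2" for x K
        proof -
          have x: "(x, K) \<in> p" "x \<in> N" using that by (auto simp: p2_def)
          have "K \<subseteq> T" using fineD[OF p(2) x(1)] x(2) by (simp add: \<gamma>_def)
          then show ?thesis using K[OF x(1)] by auto
        qed
        then show "(\<Union>i\<in>I. {fst i<..<snd i}) \<subseteq> T" unfolding I_def by fastforce
      qed (use T_sets in auto)
      also note emT
      finally have "(\<Sum>(u, v)\<in>I. v - u) < \<delta>"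
      proof (subst (asm) ennreal_less_iff)
        show "0 \<le> (\<Sum>(u, v)\<in>I. v - u)" using rangeI by (intro sum_nonneg) auto
      qed
      then have "(\<Sum>(u, v)\<in>I. \<bar>\<phi> v - \<phi> u\<bar>) < e / 2"
        using finI pwI rangeI by (intro \<delta>(2)) auto
      moreover have "- (\<Sum>(u, v)\<in>I. \<bar>\<phi> v - \<phi> u\<bar>) \<le> (\<Sum>(u, v)\<in>I. \<phi> v - \<phi> u)"
        unfolding sum_negf[symmetric] by (rule sum_mono) auto
      ultimately show ?thesis unfolding sumI by linarith
    qed
    have part3: "(\<Sum>(x,K)\<in>p3. \<phi> (Sup K) - \<phi> (Inf K)) = 0"
      by (rule sum.neutral) (auto simp: p3_def)
    have "\<phi> b - \<phi> a = (\<Sum>(x,K)\<in>p. \<phi> (Sup K) - \<phi> (Inf K))"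
      using additive_tagged_division_1[OF ab p(1), of \<phi>] by simp
    also have "\<dots> \<ge> - e"
      using part1 part2 part3 sum_split[of "\<lambda>(x,K). \<phi> (Sup K) - \<phi> (Inf K)"] by linarith
    finally show ?thesis by simp
  qed
  then have "\<phi> a - \<phi> b \<le> 0" by (rule field_le_epsilon[of _ 0, simplified])
  then show ?thesis by simp
qed

lemma set_integral_interval_split:
  fixes m :: "real \<Rightarrow> real"
  assumes m: "set_integrable lborel {a..c} m" and abc: "a \<le> b" "b \<le> c"
  shows "(LINT x:{a..c}|lborel. m x) = (LINT x:{a..b}|lborel. m x) + (LINT x:{b..c}|lborel. m x)"
proof -
  have s: "set_integrable lborel {a..b} m" "set_integrable lborel {b..c} m"
    using m abc by (auto intro: set_integrable_subset)
  have un: "{a..c} = {a..b} \<union> {b..c}" using abc by auto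
  show ?thesis unfolding un
  proof (rule set_integral_Un_AE[OF _ _ _ s])
    show "AE x in lborel. \<not> (x \<in> {a..b} \<and> x \<in> {b..c})"
      using AE_lborel_singleton[of b] by eventually_elim auto
  qed auto
qed

lemma abs_set_integral_interval_le:
  fixes m :: "real \<Rightarrow> real"
  assumes m: "m \<in> borel_measurable borel" and bnd: "\<And>x. x \<in> {a..b} \<Longrightarrow> \<bar>m x\<bar> \<le> M" and ab: "a \<le> b"
  shows "\<bar>LINT x:{a..b}|lborel. m x\<bar> \<le> M * (b - a)"
proof -
  have i: "set_integrable lborel {a..b} m" by (rule set_integrable_bounded_interval[OF m bnd])
  have "\<bar>LINT x:{a..b}|lborel. m x\<bar> \<le> (LINT x:{a..b}|lborel. \<bar>m x\<bar>)"
    using set_integral_norm_bound[OF i] by simp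
  also have "\<dots> \<le> (LINT x:{a..b}|lborel. M)"
    using m bnd by (intro set_integral_mono set_integrable_bounded_interval[where M = "\<bar>M\<bar>"]) fastforce+
  also have "\<dots> = M * (b - a)" using ab by (simp add: set_lebesgue_integral_def)
  finally show ?thesis .
qed

lemma bounded_measurable_AE_antiderivative:
  fixes m :: "real \<Rightarrow> real"
  assumes m[measurable]: "m \<in> borel_measurable borel" and mM: "\<And>u. \<bar>m u\<bar> \<le> M"
  obtains F where "\<And>x y. x \<le> y \<Longrightarrow> F y - F x = (LINT u:{x..y}|lborel. m u)"
    "AE x in lborel. (F has_real_derivative m x) (at x)"
proof -
  define F where "F = (\<lambda>t. if 0 \<le> t then LINT u:{0..t}|lborel. m u else - (LINT u:{t..0}|lborel. m u))"
  have int: "set_integrable lborel {c..d} m" for c d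
    using mM by (intro set_integrable_bounded_interval) auto
  have FF: "F y - F x = (LINT u:{x..y}|lborel. m u)" if "x \<le> y" for x y
    using that set_integral_interval_split[OF int, of 0 x y] set_integral_interval_split[OF int, of x 0 y]
      set_integral_interval_split[OF int, of x y 0]
    by (auto simp: F_def)
  then show thesis
    using AE_has_real_derivative_indefinite_integral[OF m mM FF] by (rule that)
qed

text \<open>The comparison that replaces the fundamental theorem of calculus for absolutely continuous functions:
  a lower bound on the derivative suffices, and the derivative need not be known to be integrable.\<close>

lemma abs_continuous_on_increment_ge:
  fixes v m :: "real \<Rightarrow> real"
  assumes ab: "a \<le> b" and AC: "abs_continuous_on a b v"
    and m[measurable]: "m \<in> borel_measurable borel" and mM: "\<And>u. \<bar>m u\<bar> \<le> M"
    and deriv: "AE x in lborel. x \<in> {a..b} \<longrightarrow> (\<exists>D\<ge>m x. (v has_real_derivative D) (at x within {a..b}))"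
  shows "(LINT u:{a..b}|lborel. m u) \<le> v b - v a"
proof -
  obtain F where FF: "\<And>x y. x \<le> y \<Longrightarrow> F y - F x = (LINT u:{x..y}|lborel. m u)"
    and dF: "AE x in lborel. (F has_real_derivative m x) (at x)"
    using bounded_measurable_AE_antiderivative[OF m mM] by blast
  have "abs_continuous_on a b F"
    by (rule lipschitz_imp_abs_continuous_on[where K = M])
       (use abs_set_integral_interval_le[OF m] mM FF in auto)
  with AC have "abs_continuous_on a b (\<lambda>x. v x - F x)" by (rule abs_continuous_on_diff)
  then have "v a - F a \<le> v b - F b"
  proof (rule abs_continuous_on_AE_deriv_nonneg_imp_le[OF ab])
    show "AE x in lborel. x \<in> {a..b} \<longrightarrow> (\<exists>D\<ge>0. ((\<lambda>x. v x - F x) has_real_derivative D) (at x within {a..b}))"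
      using dF deriv
    proof eventually_elim
      case (elim x)
      show ?case
      proof
        assume "x \<in> {a..b}"
        then obtain D where D: "D \<ge> m x" "(v has_real_derivative D) (at x within {a..b})" using elim by blast
        have "((\<lambda>x. v x - F x) has_real_derivative D - m x) (at x within {a..b})"
          using D(2) has_field_derivative_at_within[OF elim(1)] by (rule DERIV_diff)
        then show "\<exists>D\<ge>0. ((\<lambda>x. v x - F x) has_real_derivative D) (at x within {a..b})"
          using D(1) by (intro exI[of _ "D - m x"]) auto
      qed
    qed
  qed
  then show ?thesis using FF[OF ab] by simp
qed

section \<open>The jump kernel and its minimal transition function\<close>

lemma suminf_ennreal_Cauchy_product:
  fixes a :: "nat \<Rightarrow> nat \<Rightarrow> ennreal"
  shows "(\<Sum>n. \<Sum>k\<le>n. a k (n - k)) = (\<Sum>k. \<Sum>m. a k m)"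
proof (rule antisym)
  have tri: "(\<Sum>n<N. \<Sum>k\<le>n. a k (n - k)) = (\<Sum>(i,j)\<in>{(i,j). i + j < N}. a i j)" for N
    by (rule sum.triangle_reindex[symmetric])
  have fin: "finite {(i::nat,j). i + j < N}" for N
    by (rule finite_subset[of _ "{..<N} \<times> {..<N}"]) auto
  show "(\<Sum>n. \<Sum>k\<le>n. a k (n - k)) \<le> (\<Sum>k. \<Sum>m. a k m)"
    unfolding suminf_eq_SUP[of "\<lambda>n. \<Sum>k\<le>n. a k (n - k)"]
  proof (rule SUP_least)
    fix N
    have "(\<Sum>n<N. \<Sum>k\<le>n. a k (n - k)) \<le> (\<Sum>(i,j)\<in>{..<N} \<times> {..<N}. a i j)"
      unfolding tri by (rule sum_mono2) auto
    also have "\<dots> = (\<Sum>i<N. \<Sum>j<N. a i j)" by (simp add: sum.cartesian_product)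
    also have "\<dots> \<le> (\<Sum>i<N. \<Sum>j. a i j)" by (intro sum_mono sum_le_suminf) auto
    also have "\<dots> \<le> (\<Sum>k. \<Sum>m. a k m)" by (rule sum_le_suminf) auto
    finally show "(\<Sum>n<N. \<Sum>k\<le>n. a k (n - k)) \<le> (\<Sum>k. \<Sum>m. a k m)" .
  qed
  show "(\<Sum>k. \<Sum>m. a k m) \<le> (\<Sum>n. \<Sum>k\<le>n. a k (n - k))"
    unfolding suminf_eq_SUP[of "\<lambda>k. \<Sum>m. a k m"]
  proof (rule SUP_least)
    fix N
    have "(\<Sum>k<N. \<Sum>m. a k m) = (\<Sum>m. \<Sum>k<N. a k m)" by (rule suminf_sum[symmetric]) auto
    also have "\<dots> = (SUP M. \<Sum>m<M. \<Sum>k<N. a k m)" by (rule suminf_eq_SUP)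
    also have "\<dots> \<le> (\<Sum>n. \<Sum>k\<le>n. a k (n - k))"
    proof (rule SUP_least)
      fix M
      have "(\<Sum>m<M. \<Sum>k<N. a k m) = (\<Sum>(i,j)\<in>{..<N} \<times> {..<M}. a i j)"
        by (subst sum.swap) (simp add: sum.cartesian_product)
      also have "\<dots> \<le> (\<Sum>(i,j)\<in>{(i,j). i + j < N + M}. a i j)"
        by (rule sum_mono2[OF fin]) auto
      also have "\<dots> \<le> (\<Sum>n. \<Sum>k\<le>n. a k (n - k))"
        unfolding tri[symmetric] by (rule sum_le_suminf) auto
      finally show "(\<Sum>m<M. \<Sum>k<N. a k m) \<le> (\<Sum>n. \<Sum>k\<le>n. a k (n - k))" .
    qed
    finally show "(\<Sum>k<N. \<Sum>m. a k m) \<le> (\<Sum>n. \<Sum>k\<le>n. a k (n - k))" .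
  qed
qed

lemma suminf_ennreal_commute:
  fixes a :: "nat \<Rightarrow> nat \<Rightarrow> ennreal"
  shows "(\<Sum>i. \<Sum>n. a i n) = (\<Sum>n. \<Sum>i. a i n)"
  using nn_integral_suminf[of "\<lambda>i n. a i n" "count_space UNIV"]
  by (simp add: nn_integral_count_space_nat)

text \<open>Rates are given for all real times, so that \<open>cum_rate\<close> below is differentiable everywhere.\<close>

locale jump_kernel =
  fixes Q :: "real \<Rightarrow> 'a::polish_space \<Rightarrow> 'a measure"
  assumes sets_Q[simp, measurable_cong]: "sets (Q t x) = sets borel"
    and finite_Q: "finite_measure (Q t x)"
    and measurable_Q: "A \<in> sets borel \<Longrightarrow>
          (\<lambda>(t, x). measure (Q t x) A) \<in> borel_measurable (borel \<Otimes>\<^sub>M borel)"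
    and continuous_rate: "continuous_on UNIV (\<lambda>(t, x). rate Q t x)"
begin

lemma space_Q[simp]: "space (Q t x) = UNIV"
  using sets_eq_imp_space_eq[OF sets_Q] by simp

lemma measurable_Q_eq[simp]: "measurable (Q t x) M = measurable borel M"
  by (rule measurable_cong_sets) auto

lemma rate_nonneg[simp]: "0 \<le> rate Q t x"
  by (simp add: rate_def)

lemma emeasure_Q_UNIV: "emeasure (Q t x) UNIV = ennreal (rate Q t x)"
  using finite_measure.emeasure_eq_measure[OF finite_Q] by (simp add: rate_def)

lemma rate_measurable[measurable]: "(\<lambda>(t, x). rate Q t x) \<in> borel_measurable (borel \<Otimes>\<^sub>M borel)"
  unfolding rate_def by (rule measurable_Q) simp

text \<open>A finite kernel is a bounded multiple of a subprobability kernel, which gives access to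
  the measurability of integrals with respect to the latter.\<close>

lemma measurable_nn_integral_Q:
  assumes f: "(\<lambda>(p, y). f p y) \<in> borel_measurable (N \<Otimes>\<^sub>M borel)"
    and R[measurable]: "R \<in> borel_measurable N" and X[measurable]: "X \<in> borel_measurable N"
  shows "(\<lambda>p. \<integral>\<^sup>+y. f p y \<partial>Q (R p) (X p)) \<in> borel_measurable N"
proof -
  define K where "K = (\<lambda>p. scale_measure (ennreal (1 / (1 + rate Q (R p) (X p)))) (Q (R p) (X p)))"
  have K: "K \<in> measurable N (subprob_algebra borel)"
  proof (rule measurable_subprob_algebra)
    fix p
    show "subprob_space (K p)"
    proof (rule subprob_spaceI)
      have "emeasure (K p) (space (K p)) = ennreal (1 / (1 + rate Q (R p) (X p)) * rate Q (R p) (X p))"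
        by (simp add: K_def space_scale_measure emeasure_Q_UNIV del: times_divide_eq_left flip: ennreal_mult)
      also have "\<dots> \<le> ennreal 1"
      proof (rule ennreal_leI)
        have "1 / (1 + q) * q \<le> 1" if "0 \<le> q" for q :: real using that by (simp add: field_simps)
        then show "1 / (1 + rate Q (R p) (X p)) * rate Q (R p) (X p) \<le> 1" using rate_nonneg by blast
      qed
      finally show "emeasure (K p) (space (K p)) \<le> 1" by simp
    qed (simp add: K_def space_scale_measure)
    show "sets (K p) = sets borel" by (simp add: K_def)
  next
    fix A :: "'a set" assume A: "A \<in> sets borel"
    have "(\<lambda>p. (R p, X p)) \<in> measurable N (borel \<Otimes>\<^sub>M borel)" by measurable
    from measurable_compose[OF this measurable_Q[OF A]]
    have [measurable]: "(\<lambda>p. measure (Q (R p) (X p)) A) \<in> borel_measurable N" by simp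
    have "(\<lambda>p. ennreal (1 / (1 + rate Q (R p) (X p))) * ennreal (measure (Q (R p) (X p)) A)) \<in> borel_measurable N"
      by measurable
    then show "(\<lambda>p. emeasure (K p) A) \<in> borel_measurable N"
      by (simp add: K_def finite_measure.emeasure_eq_measure[OF finite_Q])
  qed
  have meas: "(\<lambda>p. ennreal (1 + rate Q (R p) (X p)) * (\<integral>\<^sup>+y. f p y \<partial>K p)) \<in> borel_measurable N"
    using nn_integral_measurable_subprob_algebra2[OF f K] by measurable
  show ?thesis
  proof (rule measurable_cong[THEN iffD1, OF _ meas])
    fix p assume p: "p \<in> space N"
    have [measurable]: "f p \<in> borel_measurable borel"
      using measurable_compose[OF measurable_Pair1'[OF p] f] by simp
    have "(\<integral>\<^sup>+y. f p y \<partial>K p) = ennreal (1 / (1 + rate Q (R p) (X p))) * (\<integral>\<^sup>+y. f p y \<partial>Q (R p) (X p))"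
      unfolding K_def by (rule nn_integral_scale_measure) simp
    moreover have "ennreal (1 + rate Q (R p) (X p)) * ennreal (1 / (1 + rate Q (R p) (X p))) = 1"
      by (subst ennreal_mult[symmetric]) (auto simp: add_nonneg_eq_0_iff)
    ultimately show "ennreal (1 + rate Q (R p) (X p)) * (\<integral>\<^sup>+y. f p y \<partial>K p) = (\<integral>\<^sup>+y. f p y \<partial>Q (R p) (X p))"
      by (simp add: mult.assoc[symmetric])
  qed
qed

lemma isCont_rate: "isCont (\<lambda>t. rate Q t x) t"
proof -
  have "continuous_on UNIV (\<lambda>t. (case (t, x) of (t, x) \<Rightarrow> rate Q t x))"
    by (rule continuous_on_compose2[OF continuous_rate]) (auto intro!: continuous_intros)
  then show ?thesis by (simp add: continuous_on_eq_continuous_at)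
qed

text \<open>An antiderivative of the rate; only its increments matter, whence the arbitrary choice.\<close>

definition cum_rate :: "'a \<Rightarrow> real \<Rightarrow> real" where
  "cum_rate x = (SOME F. \<forall>t. (F has_real_derivative rate Q t x) (at t))"

lemma DERIV_cum_rate: "(cum_rate x has_real_derivative rate Q t x) (at t)"
proof -
  have "\<exists>F. \<forall>t. (F has_real_derivative rate Q t x) (at t)"
    using einterval_antiderivative[of "-\<infinity>" "\<infinity>" "\<lambda>t. rate Q t x"] isCont_rate
    by (simp add: has_real_derivative_iff_has_vector_derivative)
  then show ?thesis unfolding cum_rate_def by (rule someI2_ex) simp
qed

text \<open>The probability of no jump out of \<open>x\<close> during \<open>[s, t]\<close>. It is \<open>1\<close> when \<open>t < s\<close>, which makes the
  formulas below meaningful for all pairs of times.\<close>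

definition hold :: "real \<Rightarrow> real \<Rightarrow> 'a \<Rightarrow> real" where
  "hold s t x = exp (- (LINT r:{s..t}|lborel. rate Q r x))"

lemma hold_eq_cum_rate: "s \<le> t \<Longrightarrow> hold s t x = exp (cum_rate x s - cum_rate x t)"
  using integral_FTC_Icc_nonneg[of "\<lambda>r. rate Q r x" s t "cum_rate x"] DERIV_cum_rate
  by (simp add: hold_def set_lebesgue_integral_def mult.commute)

lemma hold_pos[simp]: "0 < hold s t x" and hold_nonneg[simp]: "0 \<le> hold s t x"
  by (simp_all add: hold_def)

lemma hold_refl[simp]: "hold s s x = 1"
  by (simp add: hold_eq_cum_rate)

lemma hold_le_1[simp]: "hold s t x \<le> 1"
  by (simp add: hold_def set_lebesgue_integral_def integral_nonneg_AE)

lemma hold_trans: "s \<le> r \<Longrightarrow> r \<le> t \<Longrightarrow> hold s t x = hold s r x * hold r t x"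
  by (simp add: hold_eq_cum_rate exp_add[symmetric])

lemma hold_measurable[measurable]:
  assumes [measurable]: "S \<in> borel_measurable N" "T \<in> borel_measurable N" "X \<in> borel_measurable N"
  shows "(\<lambda>p. hold (S p) (T p) (X p)) \<in> borel_measurable N"
proof -
  have "(\<lambda>p. exp (- (\<integral>r. (if S p \<le> r \<and> r \<le> T p then rate Q r (X p) else 0) \<partial>lborel))) \<in> borel_measurable N"
    by measurable
  also have "(\<lambda>p. exp (- (\<integral>r. (if S p \<le> r \<and> r \<le> T p then rate Q r (X p) else 0) \<partial>lborel))) =
      (\<lambda>p. hold (S p) (T p) (X p))"
    unfolding hold_def set_lebesgue_integral_def
    by (intro ext arg_cong[where f = exp] arg_cong[where f = uminus] Bochner_Integration.integral_cong)
       (auto simp: indicator_def)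
  finally show ?thesis .
qed

text \<open>The \<open>n\<close>-jump part \<open>N\<^sub>n(s, t) f\<close> of the minimal transition function, applied to functions instead
  of sets. Values in \<^typ>\<open>ennreal\<close> let Tonelli's theorem and monotone convergence apply freely.\<close>

primrec jump :: "nat \<Rightarrow> real \<Rightarrow> real \<Rightarrow> ('a \<Rightarrow> ennreal) \<Rightarrow> 'a \<Rightarrow> ennreal" where
  "jump 0 = (\<lambda>s t f x. ennreal (hold s t x) * f x)"
| "jump (Suc n) = (\<lambda>s t f x. \<integral>\<^sup>+r\<in>{s..t}. ennreal (hold s r x) * (\<integral>\<^sup>+y. jump n r t f y \<partial>Q r x) \<partial>lborel)"

lemma jump_part_eq_jump: "jump_part Q n s x t A = jump n s t (indicator A) x"
  by (induction n arbitrary: s x) (simp_all add: hold_def mult.commute)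

text \<open>The parameter \<open>w\<close> lets the integrated function depend on the terminal time, as \<open>q(t) F\<close> and \<open>Q(t) F\<close>
  do in the forward equation.\<close>

lemma jump_measurable_aux:
  assumes f: "(\<lambda>(w, x). f w x) \<in> borel_measurable (M \<Otimes>\<^sub>M borel)"
  shows "(\<lambda>(s, t, w, x). jump n s t (f w) x) \<in> borel_measurable (borel \<Otimes>\<^sub>M borel \<Otimes>\<^sub>M M \<Otimes>\<^sub>M borel)"
proof (induction n)
  case 0
  note f[measurable]
  show ?case by (simp add: case_prod_unfold) measurable
next
  case (Suc n)
  note Suc[measurable]
  let ?N = "borel \<Otimes>\<^sub>M borel \<Otimes>\<^sub>M M \<Otimes>\<^sub>M borel :: (real \<times> real \<times> 'b \<times> 'a) measure"
  have [measurable]: "(\<lambda>(p, r). \<integral>\<^sup>+y. jump n r (fst (snd p)) (f (fst (snd (snd p)))) y \<partial>Q r (snd (snd (snd p))))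
      \<in> borel_measurable (?N \<Otimes>\<^sub>M lborel)"
    unfolding case_prod_unfold
  proof (rule measurable_nn_integral_Q)
    have g: "(\<lambda>(p, y). (snd p, fst (snd (fst p)), fst (snd (snd (fst p))), y))
        \<in> measurable ((?N \<Otimes>\<^sub>M lborel) \<Otimes>\<^sub>M borel) (borel \<Otimes>\<^sub>M borel \<Otimes>\<^sub>M M \<Otimes>\<^sub>M borel)"
      by measurable
    show "(\<lambda>(p, y). jump n (snd p) (fst (snd (fst p))) (f (fst (snd (snd (fst p))))) y)
      \<in> borel_measurable ((?N \<Otimes>\<^sub>M lborel) \<Otimes>\<^sub>M borel)"
      using measurable_compose[OF g Suc] by (simp add: case_prod_unfold)
  qed measurable
  have "(\<lambda>p. \<integral>\<^sup>+r. (if fst p \<le> r \<and> r \<le> fst (snd p) then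
      ennreal (hold (fst p) r (snd (snd (snd p)))) *
        (\<integral>\<^sup>+y. jump n r (fst (snd p)) (f (fst (snd (snd p)))) y \<partial>Q r (snd (snd (snd p)))) else 0) \<partial>lborel)
      \<in> borel_measurable ?N"
    by measurable
  also have "(\<lambda>p. \<integral>\<^sup>+r. (if fst p \<le> r \<and> r \<le> fst (snd p) then
      ennreal (hold (fst p) r (snd (snd (snd p)))) *
        (\<integral>\<^sup>+y. jump n r (fst (snd p)) (f (fst (snd (snd p)))) y \<partial>Q r (snd (snd (snd p)))) else 0) \<partial>lborel) =
      (\<lambda>(s, t, w, x). jump (Suc n) s t (f w) x)"
    by (auto simp: fun_eq_iff indicator_def intro!: nn_integral_cong)
  finally show ?case .
qed

lemma jump_measurable:
  assumes f: "(\<lambda>(w, x). f w x) \<in> borel_measurable (N \<Otimes>\<^sub>M borel)"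
    and [measurable]: "S \<in> borel_measurable N" "T \<in> borel_measurable N" "X \<in> borel_measurable N"
  shows "(\<lambda>p. jump n (S p) (T p) (f p) (X p)) \<in> borel_measurable N"
proof -
  have "(\<lambda>p. (S p, T p, p, X p)) \<in> measurable N (borel \<Otimes>\<^sub>M borel \<Otimes>\<^sub>M N \<Otimes>\<^sub>M borel)" by measurable
  from measurable_compose[OF this jump_measurable_aux[OF f, of n]] show ?thesis by simp
qed

lemma jump_measurable_const[measurable]:
  assumes f[measurable]: "f \<in> borel_measurable borel"
    and [measurable]: "S \<in> borel_measurable N" "T \<in> borel_measurable N" "X \<in> borel_measurable N"
  shows "(\<lambda>p. jump n (S p) (T p) f (X p)) \<in> borel_measurable N"
  by (rule jump_measurable) measurable

lemma jump_nn_integral_measurable[measurable]: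
  assumes f[measurable]: "f \<in> borel_measurable borel"
    and [measurable]: "S \<in> borel_measurable N" "T \<in> borel_measurable N" "X \<in> borel_measurable N" "R \<in> borel_measurable N"
  shows "(\<lambda>p. \<integral>\<^sup>+y. jump n (S p) (T p) f y \<partial>Q (R p) (X p)) \<in> borel_measurable N"
  by (rule measurable_nn_integral_Q) measurable

lemma jump_self: "jump n s s f x = (if n = 0 then f x else 0)"
proof (cases n)
  case (Suc m)
  have "(\<integral>\<^sup>+r. g r * indicator {s..s} r \<partial>lborel) = 0" for g :: "real \<Rightarrow> ennreal"
  proof -
    have "AE r in lborel. g r * indicator {s..s} r = 0"
      using AE_lborel_singleton[of s] by eventually_elim (simp add: indicator_def)
    then show ?thesis by (simp add: nn_integral_cong_AE[where v = "\<lambda>_. 0"])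
  qed
  then show ?thesis using Suc by simp
qed simp

lemma jump_mono: "(\<And>y. f y \<le> g y) \<Longrightarrow> jump n s t f x \<le> jump n s t g x"
proof (induction n arbitrary: s x)
  case (Suc n)
  then show ?case by (auto intro!: nn_integral_mono mult_mono mult_right_mono mult_left_mono)
qed (auto intro: mult_left_mono)

lemma jump_cmult:
  assumes [measurable]: "f \<in> borel_measurable borel"
  shows "jump n s t (\<lambda>y. c * f y) x = c * jump n s t f x"
proof (induction n arbitrary: s x)
  case (Suc n)
  then have "jump n r t (\<lambda>y. c * f y) = (\<lambda>y. c * jump n r t f y)" for r by (simp add: fun_eq_iff)
  then show ?case by (simp add: nn_integral_cmult mult.assoc mult.left_commute[of _ c])
qed (simp add: mult_ac)

lemma jump_add:
  assumes [measurable]: "f \<in> borel_measurable borel" "g \<in> borel_measurable borel"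
  shows "jump n s t (\<lambda>y. f y + g y) x = jump n s t f x + jump n s t g x"
proof (induction n arbitrary: s x)
  case (Suc n)
  then have "jump n r t (\<lambda>y. f y + g y) = (\<lambda>y. jump n r t f y + jump n r t g y)" for r
    by (simp add: fun_eq_iff)
  then show ?case by (simp add: nn_integral_add distrib_left distrib_right)
qed (simp add: distrib_left)

lemma jump_SUP:
  assumes [measurable]: "\<And>i::nat. f i \<in> borel_measurable borel" and inc: "\<And>y. incseq (\<lambda>i. f i y)"
  shows "jump n s t (\<lambda>y. SUP i. f i y) x = (SUP i. jump n s t (f i) x)"
proof (induction n arbitrary: s x)
  case 0
  then show ?case by (simp add: SUP_mult_left_ennreal)
next
  case (Suc n)
  have inc': "incseq (\<lambda>i. jump n s t (f i) x)" for n s x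
    using inc by (auto simp: incseq_def intro!: jump_mono)
  have "(\<integral>\<^sup>+y. jump n r t (\<lambda>y. SUP i. f i y) y \<partial>Q r x) = (SUP i. \<integral>\<^sup>+y. jump n r t (f i) y \<partial>Q r x)" for r
    unfolding Suc using inc'
    by (intro nn_integral_monotone_convergence_SUP) (auto simp: incseq_def le_fun_def)
  then have "jump (Suc n) s t (\<lambda>y. SUP i. f i y) x =
      (\<integral>\<^sup>+r. (SUP i. ennreal (hold s r x) * (\<integral>\<^sup>+y. jump n r t (f i) y \<partial>Q r x) * indicator {s..t} r) \<partial>lborel)"
    by (simp add: SUP_mult_left_ennreal SUP_mult_right_ennreal)
  also have "\<dots> = (SUP i. jump (Suc n) s t (f i) x)"
    unfolding jump.simps
    using inc'
    by (intro nn_integral_monotone_convergence_SUP)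
       (auto simp: incseq_def le_fun_def intro!: mult_right_mono mult_left_mono nn_integral_mono)
  finally show ?case .
qed

lemma jump_zero: "jump n s t (\<lambda>y. 0) x = 0"
  using jump_cmult[of "\<lambda>y. 0" n s t 0 x] by simp

lemma jump_sum:
  assumes [measurable]: "\<And>i. i \<in> I \<Longrightarrow> f i \<in> borel_measurable borel" and "finite I"
  shows "jump n s t (\<lambda>y. \<Sum>i\<in>I. f i y) x = (\<Sum>i\<in>I. jump n s t (f i) x)"
  using assms(2,1)
proof (induction I rule: finite_induct)
  case empty
  show ?case by (simp add: jump_zero)
next
  case (insert i I)
  then show ?case by (simp add: jump_add)
qed

lemma jump_suminf:
  assumes [measurable]: "\<And>i::nat. f i \<in> borel_measurable borel"
  shows "jump n s t (\<lambda>y. \<Sum>i. f i y) x = (\<Sum>i. jump n s t (f i) x)"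
proof -
  have "jump n s t (\<lambda>y. \<Sum>i. f i y) x = jump n s t (\<lambda>y. SUP N. \<Sum>i<N. f i y) x"
    by (simp add: suminf_eq_SUP)
  also have "\<dots> = (SUP N. jump n s t (\<lambda>y. \<Sum>i<N. f i y) x)"
    by (rule jump_SUP) (auto simp: incseq_def intro!: sum_mono2)
  also have "\<dots> = (\<Sum>i. jump n s t (f i) x)"
    by (simp add: jump_sum suminf_eq_SUP)
  finally show ?thesis .
qed

abbreviation P where "P \<equiv> minimal_transition Q"

lemma measure_space_jump: "measure_space UNIV (sets borel) (\<lambda>A. \<Sum>n. jump_part Q n s x t A)"
  unfolding measure_space_def
proof (intro conjI)
  show "sigma_algebra UNIV (sets (borel :: 'a measure))" using sets.sigma_algebra_axioms[of borel] by simp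
  show "positive (sets borel) (\<lambda>A. \<Sum>n. jump_part Q n s x t A)"
  proof -
    have "indicator ({} :: 'a set) = (\<lambda>y. 0 :: ennreal)" by (simp add: fun_eq_iff)
    then show ?thesis by (simp add: positive_def jump_part_eq_jump jump_zero)
  qed
  show "countably_additive (sets borel) (\<lambda>A. \<Sum>n. jump_part Q n s x t A)"
    unfolding countably_additive_def
  proof (intro allI impI)
    fix A :: "nat \<Rightarrow> 'a set"
    assume A: "range A \<subseteq> sets borel" "disjoint_family A"
    then have [measurable]: "A i \<in> sets borel" for i by auto
    have "indicator (\<Union>(range A)) = (\<lambda>y. \<Sum>i. indicator (A i) y :: ennreal)"
      using suminf_indicator[OF A(2)] by (simp add: fun_eq_iff)
    then have "jump n s t (indicator (\<Union>(range A))) x = (\<Sum>i. jump n s t (indicator (A i)) x)" for n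
      by (simp add: jump_suminf)
    then show "(\<Sum>i. \<Sum>n. jump_part Q n s x t (A i)) = (\<Sum>n. jump_part Q n s x t (\<Union>(range A)))"
      unfolding jump_part_eq_jump by (subst suminf_ennreal_commute) simp
  qed
qed

lemma space_P[simp]: "space (P s x t) = UNIV"
  unfolding minimal_transition_def using sets.space_closed[of borel] by (subst space_measure_of) auto

lemma sets_P[simp, measurable_cong]: "sets (P s x t) = sets borel"
  unfolding minimal_transition_def using sets.space_closed[of borel] sets.sigma_sets_eq[of borel]
  by (subst sets_measure_of) auto

lemma measurable_P_eq[simp]: "measurable (P s x t) M = measurable borel M"
  by (rule measurable_cong_sets) auto

lemma emeasure_P: "A \<in> sets borel \<Longrightarrow> emeasure (P s x t) A = (\<Sum>n. jump n s t (indicator A) x)"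
  using measure_space_jump[of s x t]
  by (subst emeasure_measure_of[OF minimal_transition_def])
     (auto simp: jump_part_eq_jump measure_space_def)

lemma nn_integral_P:
  assumes "f \<in> borel_measurable borel"
  shows "(\<integral>\<^sup>+y. f y \<partial>P s x t) = (\<Sum>n. jump n s t f x)"
  using assms
proof (induction f rule: borel_measurable_induct)
  case (cong f g)
  then have "f = g" by auto
  with cong show ?case by simp
next
  case (set A)
  then show ?case by (simp add: emeasure_P)
next
  case (mult u c)
  then show ?case by (simp add: nn_integral_cmult jump_cmult)
next
  case (add u v)
  then show ?case by (simp add: nn_integral_add jump_add suminf_add)
next
  case (seq U)
  have inc: "incseq (\<lambda>i. U i y)" for y using seq by (auto simp: incseq_def le_fun_def)
  have eq: "(SUP i. U i) = (\<lambda>y. SUP i. U i y)" by (auto simp: fun_eq_iff SUP_apply image_comp)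
  have "(\<integral>\<^sup>+y. (SUP i. U i) y \<partial>P s x t) = (SUP i. \<integral>\<^sup>+y. U i y \<partial>P s x t)"
    unfolding eq using seq by (intro nn_integral_monotone_convergence_SUP) auto
  also have "\<dots> = (SUP i. \<Sum>n. jump n s t (U i) x)" using seq by simp
  also have "\<dots> = (\<Sum>n. SUP i. jump n s t (U i) x)"
    using inc by (intro ennreal_suminf_SUP_eq[symmetric]) (auto simp: incseq_def intro!: jump_mono)
  also have "\<dots> = (\<Sum>n. jump n s t (SUP i. U i) x)"
    unfolding eq using seq inc by (simp add: jump_SUP)
  finally show ?case .
qed

end

section \<open>The semigroup property and the integrated forward equation\<close>

lemma suminf_ennreal_split_head:
  fixes f :: "nat \<Rightarrow> ennreal"
  shows "(\<Sum>n. f n) = f 0 + (\<Sum>n. f (Suc n))"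
  using suminf_offset[of f 1] by (simp add: add.commute)

context jump_kernel
begin

text \<open>Among \<open>n\<close> jumps in \<open>[s, t]\<close> some number \<open>k\<close> happens before \<open>r\<close>. In the induction the first jump
  falls either before \<open>r\<close>, which gives the terms \<open>k \<ge> 1\<close>, or after \<open>r\<close>, which gives \<open>k = 0\<close>.\<close>

lemma jump_split_time:
  assumes [measurable]: "f \<in> borel_measurable borel" and "s \<le> r" "r \<le> t"
  shows "jump n s t f x = (\<Sum>k\<le>n. jump k s r (jump (n - k) r t f) x)"
  using assms(2)
proof (induction n arbitrary: s x)
  case 0
  then show ?case using assms(3) by (simp add: hold_trans[of s r t] ennreal_mult mult.assoc)
next
  case (Suc n)
  let ?g = "\<lambda>u. ennreal (hold s u x) * (\<integral>\<^sup>+y. jump n u t f y \<partial>Q u x)"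
  have "jump (Suc n) s t f x = (\<integral>\<^sup>+u. ?g u * indicator {s..r} u + ?g u * indicator {r..t} u \<partial>lborel)"
    unfolding jump.simps
  proof (rule nn_integral_cong_AE)
    show "AE u in lborel. ?g u * indicator {s..t} u = ?g u * indicator {s..r} u + ?g u * indicator {r..t} u"
      using AE_lborel_singleton[of r]
    proof eventually_elim
      case (elim u)
      then show ?case using Suc.prems assms(3) by (auto simp: indicator_def)
    qed
  qed
  also have "\<dots> = (\<integral>\<^sup>+u\<in>{s..r}. ?g u \<partial>lborel) + (\<integral>\<^sup>+u\<in>{r..t}. ?g u \<partial>lborel)"
    by (rule nn_integral_add) measurable
  also have "(\<integral>\<^sup>+u\<in>{s..r}. ?g u \<partial>lborel) =
    (\<integral>\<^sup>+u. (\<Sum>k\<le>n. ennreal (hold s u x) * (\<integral>\<^sup>+y. jump k u r (jump (n - k) r t f) y \<partial>Q u x) * indicator {s..r} u) \<partial>lborel)"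
  proof (rule nn_integral_cong)
    fix u :: real
    have "(\<integral>\<^sup>+y. jump n u t f y \<partial>Q u x) = (\<Sum>k\<le>n. \<integral>\<^sup>+y. jump k u r (jump (n - k) r t f) y \<partial>Q u x)" if "u \<in> {s..r}"
      using that Suc.IH[of u] by (subst nn_integral_sum[symmetric]) (auto intro!: nn_integral_cong)
    then show "?g u * indicator {s..r} u =
      (\<Sum>k\<le>n. ennreal (hold s u x) * (\<integral>\<^sup>+y. jump k u r (jump (n - k) r t f) y \<partial>Q u x) * indicator {s..r} u)"
      by (auto simp: sum_distrib_left sum_distrib_right indicator_def)
  qed
  also have "\<dots> = (\<Sum>k\<le>n. jump (Suc k) s r (jump (n - k) r t f) x)"
    unfolding jump.simps by (rule nn_integral_sum) measurable
  also have "(\<integral>\<^sup>+u\<in>{r..t}. ?g u \<partial>lborel) = jump 0 s r (jump (Suc n) r t f) x"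
  proof -
    have "(\<integral>\<^sup>+u\<in>{r..t}. ?g u \<partial>lborel) =
      (\<integral>\<^sup>+u. ennreal (hold s r x) * (ennreal (hold r u x) * (\<integral>\<^sup>+y. jump n u t f y \<partial>Q u x) * indicator {r..t} u) \<partial>lborel)"
    proof (rule nn_integral_cong)
      fix u :: real
      show "?g u * indicator {r..t} u =
        ennreal (hold s r x) * (ennreal (hold r u x) * (\<integral>\<^sup>+y. jump n u t f y \<partial>Q u x) * indicator {r..t} u)"
        using hold_trans[of s r u x] Suc.prems by (auto simp: indicator_def ennreal_mult mult.assoc)
    qed
    also have "\<dots> = jump 0 s r (jump (Suc n) r t f) x"
      by (simp add: nn_integral_cmult)
    finally show ?thesis .
  qed
  also have "(\<Sum>k\<le>n. jump (Suc k) s r (jump (n - k) r t f) x) + jump 0 s r (jump (Suc n) r t f) x =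
      (\<Sum>k\<le>Suc n. jump k s r (jump (Suc n - k) r t f) x)"
    unfolding sum.atMost_Suc_shift by (simp add: add.commute)
  finally show ?case .
qed

lemma Chapman_Kolmogorov:
  assumes f[measurable]: "f \<in> borel_measurable borel" and srt: "s \<le> r" "r \<le> t"
  shows "(\<integral>\<^sup>+y. (\<integral>\<^sup>+z. f z \<partial>P r y t) \<partial>P s x r) = (\<integral>\<^sup>+z. f z \<partial>P s x t)"
proof -
  have "(\<integral>\<^sup>+y. (\<integral>\<^sup>+z. f z \<partial>P r y t) \<partial>P s x r) = (\<Sum>k. jump k s r (\<lambda>y. \<Sum>m. jump m r t f y) x)"
    by (simp add: nn_integral_P)
  also have "\<dots> = (\<Sum>k. \<Sum>m. jump k s r (jump m r t f) x)"
    by (simp add: jump_suminf)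
  also have "\<dots> = (\<Sum>n. jump n s t f x)"
    unfolding suminf_ennreal_Cauchy_product[symmetric]
    using srt by (simp add: jump_split_time[OF f])
  also have "\<dots> = (\<integral>\<^sup>+z. f z \<partial>P s x t)" by (simp add: nn_integral_P)
  finally show ?thesis .
qed

lemma nn_integral_P_measurable:
  assumes f: "(\<lambda>(p, y). f p y) \<in> borel_measurable (N \<Otimes>\<^sub>M borel)"
    and [measurable]: "S \<in> borel_measurable N" "T \<in> borel_measurable N" "X \<in> borel_measurable N"
  shows "(\<lambda>p. \<integral>\<^sup>+y. f p y \<partial>P (S p) (X p) (T p)) \<in> borel_measurable N"
proof (rule measurable_cong[THEN iffD1])
  note jump_measurable[OF f, measurable]
  show "(\<lambda>p. \<Sum>n. jump n (S p) (T p) (f p) (X p)) \<in> borel_measurable N" by measurable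
  fix p assume "p \<in> space N"
  then have "f p \<in> borel_measurable borel"
    using measurable_compose[OF measurable_Pair1' f] by simp
  then show "(\<Sum>n. jump n (S p) (T p) (f p) (X p)) = (\<integral>\<^sup>+y. f p y \<partial>P (S p) (X p) (T p))"
    by (simp add: nn_integral_P)
qed

lemma nn_integral_P_first_jump:
  assumes f[measurable]: "f \<in> borel_measurable borel"
  shows "(\<integral>\<^sup>+y. f y \<partial>P s x t) = ennreal (hold s t x) * f x +
     (\<integral>\<^sup>+r\<in>{s..t}. ennreal (hold s r x) * (\<integral>\<^sup>+y. (\<integral>\<^sup>+z. f z \<partial>P r y t) \<partial>Q r x) \<partial>lborel)"
proof -
  have "(\<integral>\<^sup>+y. f y \<partial>P s x t) = jump 0 s t f x + (\<Sum>n. jump (Suc n) s t f x)"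
    unfolding nn_integral_P[OF f]
    by (rule suminf_ennreal_split_head)
  also have "(\<Sum>n. jump (Suc n) s t f x) =
      (\<integral>\<^sup>+r. (\<Sum>n. ennreal (hold s r x) * (\<integral>\<^sup>+y. jump n r t f y \<partial>Q r x) * indicator {s..t} r) \<partial>lborel)"
    unfolding jump.simps by (rule nn_integral_suminf[symmetric]) measurable
  also have "\<dots> = (\<integral>\<^sup>+r\<in>{s..t}. ennreal (hold s r x) * (\<integral>\<^sup>+y. (\<integral>\<^sup>+z. f z \<partial>P r y t) \<partial>Q r x) \<partial>lborel)"
    by (simp add: nn_integral_P nn_integral_suminf)
  finally show ?thesis by simp
qed

lemma jump_sum_Suc:
  assumes [measurable]: "f \<in> borel_measurable borel"
  shows "(\<Sum>k<Suc N. jump k s t f x) = ennreal (hold s t x) * f x +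
    (\<integral>\<^sup>+r\<in>{s..t}. ennreal (hold s r x) * (\<integral>\<^sup>+y. (\<Sum>k<N. jump k r t f y) \<partial>Q r x) \<partial>lborel)"
proof -
  have "(\<Sum>k<Suc N. jump k s t f x) = jump 0 s t f x + (\<Sum>k<N. jump (Suc k) s t f x)"
    by (rule sum.lessThan_Suc_shift)
  also have "(\<Sum>k<N. jump (Suc k) s t f x) = (\<integral>\<^sup>+u. (\<Sum>k<N.
      ennreal (hold s u x) * (\<integral>\<^sup>+y. jump k u t f y \<partial>Q u x) * indicator {s..t} u) \<partial>lborel)"
    unfolding jump.simps by (rule nn_integral_sum[symmetric]) measurable
  also have "\<dots> = (\<integral>\<^sup>+u\<in>{s..t}. ennreal (hold s u x) * (\<integral>\<^sup>+y. (\<Sum>k<N. jump k u t f y) \<partial>Q u x) \<partial>lborel)"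
    by (auto simp: indicator_def nn_integral_sum sum_distrib_left intro!: nn_integral_cong)
  finally show ?thesis by simp
qed

text \<open>Tonelli's theorem on the triangle \<open>s \<le> u \<le> r \<le> t\<close>: it moves the integral over the terminal time
  inside the first-jump recursion.\<close>

lemma jump_time_integral:
  assumes h: "(\<lambda>(r, y). h r y) \<in> borel_measurable (borel \<Otimes>\<^sub>M borel)"
  shows "(\<integral>\<^sup>+r\<in>{s..t}. jump (Suc n) s r (h r) x \<partial>lborel) =
    (\<integral>\<^sup>+u\<in>{s..t}. ennreal (hold s u x) *
        (\<integral>\<^sup>+y. (\<integral>\<^sup>+r\<in>{u..t}. jump n u r (h r) y \<partial>lborel) \<partial>Q u x) \<partial>lborel)"
proof -
  note h[measurable]
  have J: "(\<lambda>p. jump n (S p) (R p) (h (R p)) (X p)) \<in> borel_measurable N"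
    if [measurable]: "S \<in> borel_measurable N" "R \<in> borel_measurable N" "X \<in> borel_measurable N"
    for S R X and N :: "'b measure"
    by (rule jump_measurable) measurable
  note J[measurable]
  have [measurable]: "(\<lambda>p. \<integral>\<^sup>+y. jump n (S p) (R p) (h (R p)) y \<partial>Q (S p) x) \<in> borel_measurable N"
    if [measurable]: "S \<in> borel_measurable N" "R \<in> borel_measurable N"
    for S R and N :: "'b measure"
    by (rule measurable_nn_integral_Q) (simp_all add: case_prod_unfold jump_measurable)
  let ?g = "\<lambda>u r. ennreal (hold s u x) * (\<integral>\<^sup>+y. jump n u r (h r) y \<partial>Q u x) *
      (if s \<le> u \<and> u \<le> r \<and> r \<le> t then 1 else 0)"
  have "(\<integral>\<^sup>+r\<in>{s..t}. jump (Suc n) s r (h r) x \<partial>lborel) = (\<integral>\<^sup>+r. \<integral>\<^sup>+u. ?g u r \<partial>lborel \<partial>lborel)"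
  proof (rule nn_integral_cong)
    fix r :: real
    show "jump (Suc n) s r (h r) x * indicator {s..t} r = (\<integral>\<^sup>+u. ?g u r \<partial>lborel)"
    proof (cases "r \<in> {s..t}")
      case True
      then show ?thesis by (auto intro!: nn_integral_cong simp: indicator_def)
    next
      case False
      then have "(\<integral>\<^sup>+u. ?g u r \<partial>lborel) = (\<integral>\<^sup>+u. 0 \<partial>(lborel :: real measure))"
        by (intro nn_integral_cong) auto
      then show ?thesis using False by simp
    qed
  qed
  also have "\<dots> = (\<integral>\<^sup>+u. \<integral>\<^sup>+r. ?g u r \<partial>lborel \<partial>lborel)"
    by (rule lborel_pair.Fubini') measurable
  also have "\<dots> = (\<integral>\<^sup>+u\<in>{s..t}. ennreal (hold s u x) *
        (\<integral>\<^sup>+y. (\<integral>\<^sup>+r\<in>{u..t}. jump n u r (h r) y \<partial>lborel) \<partial>Q u x) \<partial>lborel)"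
  proof (rule nn_integral_cong)
    fix u :: real
    interpret Qu: finite_measure "Q u x" by (rule finite_Q)
    interpret pair_sigma_finite "Q u x" lborel ..
    let ?j = "\<lambda>y r. jump n u r (h r) y * (if u \<le> r \<and> r \<le> t then 1 else 0)"
    have "(\<integral>\<^sup>+y. (\<integral>\<^sup>+r\<in>{u..t}. jump n u r (h r) y \<partial>lborel) \<partial>Q u x) =
          (\<integral>\<^sup>+y. (\<integral>\<^sup>+r. ?j y r \<partial>lborel) \<partial>Q u x)"
      by (intro nn_integral_cong) (auto simp: indicator_def)
    also have "\<dots> = (\<integral>\<^sup>+r. (\<integral>\<^sup>+y. ?j y r \<partial>Q u x) \<partial>lborel)"
      by (rule Fubini'[symmetric]) measurable
    also have "\<dots> = (\<integral>\<^sup>+r. (\<integral>\<^sup>+y. jump n u r (h r) y \<partial>Q u x) * (if u \<le> r \<and> r \<le> t then 1 else 0) \<partial>lborel)"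
      by (intro nn_integral_cong nn_integral_multc) measurable
    finally have eq: "(\<integral>\<^sup>+y. (\<integral>\<^sup>+r\<in>{u..t}. jump n u r (h r) y \<partial>lborel) \<partial>Q u x) =
       (\<integral>\<^sup>+r. (\<integral>\<^sup>+y. jump n u r (h r) y \<partial>Q u x) * (if u \<le> r \<and> r \<le> t then 1 else 0) \<partial>lborel)" .
    have "(\<integral>\<^sup>+r. ?g u r \<partial>lborel) = (\<integral>\<^sup>+r. (ennreal (hold s u x) * indicator {s..t} u) *
        ((\<integral>\<^sup>+y. jump n u r (h r) y \<partial>Q u x) * (if u \<le> r \<and> r \<le> t then 1 else 0)) \<partial>lborel)"
      by (intro nn_integral_cong) (auto simp: indicator_def mult_ac)
    also have "\<dots> = (ennreal (hold s u x) * indicator {s..t} u) *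
        (\<integral>\<^sup>+y. (\<integral>\<^sup>+r\<in>{u..t}. jump n u r (h r) y \<partial>lborel) \<partial>Q u x)"
      unfolding eq by (rule nn_integral_cmult) measurable
    finally show "(\<integral>\<^sup>+r. ?g u r \<partial>lborel) = ennreal (hold s u x) *
        (\<integral>\<^sup>+y. (\<integral>\<^sup>+r\<in>{u..t}. jump n u r (h r) y \<partial>lborel) \<partial>Q u x) * indicator {s..t} u"
      by (simp add: mult_ac)
  qed
  finally show ?thesis .
qed

lemma hold_forward:
  assumes "s \<le> t"
  shows "ennreal (hold s t x) + (\<integral>\<^sup>+r\<in>{s..t}. ennreal (hold s r x * rate Q r x) \<partial>lborel) = 1"
proof -
  have "(\<integral>\<^sup>+r\<in>{s..t}. ennreal (hold s r x * rate Q r x) \<partial>lborel) =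
      (\<integral>\<^sup>+r\<in>{s..t}. ennreal (exp (cum_rate x s - cum_rate x r) * rate Q r x) \<partial>lborel)"
    by (intro nn_integral_cong) (auto simp: indicator_def hold_eq_cum_rate)
  also have "\<dots> = ennreal (- exp (cum_rate x s - cum_rate x t) - - exp (cum_rate x s - cum_rate x s))"
  proof (rule nn_integral_FTC_Icc[OF _ _ _ assms])
    show "(\<lambda>r. exp (cum_rate x s - cum_rate x r) * rate Q r x) \<in> borel_measurable borel"
    proof -
      have "continuous_on UNIV (cum_rate x)" using DERIV_isCont[OF DERIV_cum_rate]
        by (simp add: continuous_on_eq_continuous_at)
      then have [measurable]: "cum_rate x \<in> borel_measurable borel"
        by (rule borel_measurable_continuous_onI)
      show ?thesis by measurable
    qed
    show "((\<lambda>r. - exp (cum_rate x s - cum_rate x r)) has_real_derivative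
        exp (cum_rate x s - cum_rate x r) * rate Q r x) (at r)" for r
      by (auto intro!: derivative_eq_intros DERIV_cum_rate[of x r])
  qed auto
  also have "\<dots> = ennreal (1 - hold s t x)" using assms by (simp add: hold_eq_cum_rate)
  also have "ennreal (hold s t x) + \<dots> = ennreal (hold s t x + (1 - hold s t x))"
    by (subst ennreal_plus) auto
  finally show ?thesis by simp
qed

text \<open>The decomposition at the last jump. For \<open>n = 0\<close> it says that the density of the first jump time is
  \<open>q\<close> times the probability of no jump; the induction step applies the first-jump recursion to all
  three terms.\<close>

lemma jump_forward:
  assumes F[measurable]: "F \<in> borel_measurable borel" and st: "s \<le> t"
  shows "jump n s t F x + (\<integral>\<^sup>+r\<in>{s..t}. jump n s r (\<lambda>y. ennreal (rate Q r y) * F y) x \<partial>lborel) =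
    (case n of 0 \<Rightarrow> F x | Suc m \<Rightarrow> (\<integral>\<^sup>+r\<in>{s..t}. jump m s r (\<lambda>y. \<integral>\<^sup>+z. F z \<partial>Q r y) x \<partial>lborel))"
  using st
proof (induction n arbitrary: s x)
  case 0
  have "(\<integral>\<^sup>+r\<in>{s..t}. jump 0 s r (\<lambda>y. ennreal (rate Q r y) * F y) x \<partial>lborel) =
      (\<integral>\<^sup>+r. ennreal (hold s r x * rate Q r x) * indicator {s..t} r * F x \<partial>lborel)"
    by (intro nn_integral_cong) (simp add: ennreal_mult mult_ac)
  also have "\<dots> = (\<integral>\<^sup>+r\<in>{s..t}. ennreal (hold s r x * rate Q r x) \<partial>lborel) * F x"
    by (rule nn_integral_multc) measurable
  finally show ?case using hold_forward[OF 0, of x] by (simp add: distrib_right[symmetric])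
next
  case (Suc n)
  let ?h = "\<lambda>r y. ennreal (rate Q r y) * F y"
  let ?k = "\<lambda>r y. \<integral>\<^sup>+z. F z \<partial>Q r y"
  have [measurable]: "(\<lambda>p. \<integral>\<^sup>+z. F z \<partial>Q (R p) (X p)) \<in> borel_measurable N"
    if [measurable]: "R \<in> borel_measurable N" "X \<in> borel_measurable N" for R X and N :: "'b measure"
    by (rule measurable_nn_integral_Q) measurable
  have [measurable]: "(\<lambda>p. jump n (S p) (R p) (?h (R p)) (X p)) \<in> borel_measurable N"
    if [measurable]: "S \<in> borel_measurable N" "R \<in> borel_measurable N" "X \<in> borel_measurable N"
    for S R X and N :: "'b measure"
    by (rule jump_measurable) measurable
  have [measurable]: "(\<lambda>p. \<integral>\<^sup>+r\<in>{S p..t}. jump n (S p) r (?h r) (X p) \<partial>lborel) \<in> borel_measurable N"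
    if [measurable]: "S \<in> borel_measurable N" "X \<in> borel_measurable N"
    for S X and N :: "'b measure"
  proof -
    have "(\<lambda>p. \<integral>\<^sup>+r. jump n (S p) r (?h r) (X p) * (if S p \<le> r \<and> r \<le> t then 1 else 0) \<partial>lborel) \<in> borel_measurable N"
      by measurable
    also have "(\<lambda>p. \<integral>\<^sup>+r. jump n (S p) r (?h r) (X p) * (if S p \<le> r \<and> r \<le> t then 1 else 0) \<partial>lborel) =
       (\<lambda>p. \<integral>\<^sup>+r\<in>{S p..t}. jump n (S p) r (?h r) (X p) \<partial>lborel)"
      by (intro ext nn_integral_cong) (auto simp: indicator_def)
    finally show ?thesis .
  qed
  have [measurable]: "(\<lambda>p. \<integral>\<^sup>+y. (\<integral>\<^sup>+r\<in>{S p..t}. jump n (S p) r (?h r) y \<partial>lborel) \<partial>Q (S p) x) \<in> borel_measurable N"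
    if [measurable]: "S \<in> borel_measurable N" for S and N :: "'b measure"
    by (rule measurable_nn_integral_Q) measurable
  have "jump (Suc n) s t F x + (\<integral>\<^sup>+r\<in>{s..t}. jump (Suc n) s r (?h r) x \<partial>lborel) =
      (\<integral>\<^sup>+u\<in>{s..t}. ennreal (hold s u x) * (\<integral>\<^sup>+y. jump n u t F y \<partial>Q u x) \<partial>lborel) +
      (\<integral>\<^sup>+u\<in>{s..t}. ennreal (hold s u x) *
        (\<integral>\<^sup>+y. (\<integral>\<^sup>+r\<in>{u..t}. jump n u r (?h r) y \<partial>lborel) \<partial>Q u x) \<partial>lborel)"
    by (subst jump_time_integral) simp_all
  also have "\<dots> = (\<integral>\<^sup>+u\<in>{s..t}. ennreal (hold s u x) * (\<integral>\<^sup>+y. jump n u t F y +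
        (\<integral>\<^sup>+r\<in>{u..t}. jump n u r (?h r) y \<partial>lborel) \<partial>Q u x) \<partial>lborel)"
    by (subst nn_integral_add[symmetric])
       (simp_all add: nn_integral_add distrib_left distrib_right)
  also have "\<dots> = (\<integral>\<^sup>+u\<in>{s..t}. ennreal (hold s u x) * (\<integral>\<^sup>+y. (case n of 0 \<Rightarrow> F y
        | Suc m \<Rightarrow> (\<integral>\<^sup>+r\<in>{u..t}. jump m u r (?k r) y \<partial>lborel)) \<partial>Q u x) \<partial>lborel)"
    using Suc.IH by (intro nn_integral_cong) (auto simp: indicator_def)
  also have "\<dots> = (\<integral>\<^sup>+r\<in>{s..t}. jump n s r (?k r) x \<partial>lborel)"
  proof (cases n)
    case (Suc m)
    show ?thesis unfolding Suc by (subst jump_time_integral) simp_all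
  qed simp
  finally show ?case by simp
qed

text \<open>Written as an equality of sums, because the two integrals may both be infinite at this level of
  generality.\<close>

lemma P_forward_nn:
  assumes F[measurable]: "F \<in> borel_measurable borel" and st: "s \<le> t"
  shows "(\<integral>\<^sup>+y. F y \<partial>P s x t) + (\<integral>\<^sup>+r\<in>{s..t}. (\<integral>\<^sup>+y. ennreal (rate Q r y) * F y \<partial>P s x r) \<partial>lborel) =
    F x + (\<integral>\<^sup>+r\<in>{s..t}. (\<integral>\<^sup>+y. (\<integral>\<^sup>+z. F z \<partial>Q r y) \<partial>P s x r) \<partial>lborel)"
proof -
  let ?h = "\<lambda>r y. ennreal (rate Q r y) * F y"
  let ?k = "\<lambda>r y. \<integral>\<^sup>+z. F z \<partial>Q r y"
  have [measurable]: "(\<lambda>p. \<integral>\<^sup>+z. F z \<partial>Q (R p) (X p)) \<in> borel_measurable N"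
    if [measurable]: "R \<in> borel_measurable N" "X \<in> borel_measurable N" for R X and N :: "'b measure"
    by (rule measurable_nn_integral_Q) measurable
  have hk: "(\<lambda>(r, y). ?h r y) \<in> borel_measurable (borel \<Otimes>\<^sub>M borel)"
    "(\<lambda>(r, y). ?k r y) \<in> borel_measurable (borel \<Otimes>\<^sub>M borel)"
    by measurable
  have [measurable]: "(\<lambda>r. jump n s r (?h r) x) \<in> borel_measurable lborel"
     "(\<lambda>r. jump n s r (?k r) x) \<in> borel_measurable lborel" for n
    using hk by (auto intro!: jump_measurable)
  have P: "(\<integral>\<^sup>+r\<in>{s..t}. (\<integral>\<^sup>+y. f r y \<partial>P s x r) \<partial>lborel) = (\<Sum>n. \<integral>\<^sup>+r\<in>{s..t}. jump n s r (f r) x \<partial>lborel)"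
    if f: "\<And>r. f r \<in> borel_measurable borel" "\<And>n. (\<lambda>r. jump n s r (f r) x) \<in> borel_measurable lborel" for f
    using f by (subst nn_integral_suminf[symmetric]) (auto simp: nn_integral_P intro!: nn_integral_cong)
  have "(\<integral>\<^sup>+y. F y \<partial>P s x t) + (\<integral>\<^sup>+r\<in>{s..t}. (\<integral>\<^sup>+y. ?h r y \<partial>P s x r) \<partial>lborel) =
     (\<Sum>n. jump n s t F x + (\<integral>\<^sup>+r\<in>{s..t}. jump n s r (?h r) x \<partial>lborel))"
    by (subst P) (simp_all add: nn_integral_P suminf_add)
  also have "\<dots> = (\<Sum>n. case n of 0 \<Rightarrow> F x | Suc m \<Rightarrow> (\<integral>\<^sup>+r\<in>{s..t}. jump m s r (?k r) x \<partial>lborel))"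
    using st by (simp add: jump_forward)
  also have "\<dots> = F x + (\<Sum>m. \<integral>\<^sup>+r\<in>{s..t}. jump m s r (?k r) x \<partial>lborel)"
    unfolding suminf_ennreal_split_head[of "\<lambda>n. case n of 0 \<Rightarrow> F x | Suc m \<Rightarrow> _ m"] by (simp only: nat.case)
  also have "(\<Sum>m. \<integral>\<^sup>+r\<in>{s..t}. jump m s r (?k r) x \<partial>lborel) = (\<integral>\<^sup>+r\<in>{s..t}. (\<integral>\<^sup>+y. ?k r y \<partial>P s x r) \<partial>lborel)"
    by (subst P) simp_all
  finally show ?thesis .
qed

end

section \<open>Consequences of the drift condition\<close>

lemma nn_integral_interval_eq_set_integral:
  fixes m :: "real \<Rightarrow> real"
  assumes m[measurable]: "m \<in> borel_measurable borel" and bnd: "\<And>x. x \<in> {a..b} \<Longrightarrow> 0 \<le> m x \<and> m x \<le> M"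
  shows "(\<integral>\<^sup>+x\<in>{a..b}. ennreal (m x) \<partial>lborel) = ennreal (LINT x:{a..b}|lborel. m x)"
proof -
  have int: "set_integrable lborel {a..b} m"
    using bnd by (intro set_integrable_bounded_interval[where M = M]) fastforce+
  have "(\<integral>\<^sup>+x\<in>{a..b}. ennreal (m x) \<partial>lborel) = (\<integral>\<^sup>+x. ennreal (indicator {a..b} x * m x) \<partial>lborel)"
    by (intro nn_integral_cong) (simp add: indicator_def)
  also have "\<dots> = ennreal (LINT x:{a..b}|lborel. m x)"
    unfolding set_lebesgue_integral_def real_scaleR_def
    using int bnd by (intro nn_integral_eq_integral) (auto simp: set_integrable_def indicator_def)
  finally show ?thesis .
qed

lemma continuous_antiderivative:
  fixes g :: "real \<Rightarrow> real"
  assumes "continuous_on UNIV g"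
  obtains G where "\<And>t. (G has_real_derivative g t) (at t)"
    "\<And>s t. s \<le> t \<Longrightarrow> (LINT r:{s..t}|lborel. g r) = G t - G s"
proof -
  have cont: "isCont g t" for t using assms by (simp add: continuous_on_eq_continuous_at)
  then obtain G where G: "\<And>t. (G has_real_derivative g t) (at t)"
    using einterval_antiderivative[of "-\<infinity>" "\<infinity>" g] by (auto simp: has_real_derivative_iff_has_vector_derivative)
  have "(LINT r:{s..t}|lborel. g r) = G t - G s" if "s \<le> t" for s t
    using integral_FTC_Icc_real[OF that G cont] by (simp add: set_lebesgue_integral_def mult.commute)
  with G show thesis by (rule that)
qed

lemma weighted_norm_le:
  assumes "\<And>x. 0 \<le> V x" and "\<And>x. \<bar>F x\<bar> \<le> K * (1 + V x)"
  shows "weighted_norm V F \<le> K"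
  unfolding weighted_norm_def
proof (rule cSUP_least)
  fix x
  show "\<bar>F x\<bar> / (1 + V x) \<le> K"
    using assms(1)[of x] assms(2)[of x] by (simp add: divide_le_eq)
qed simp

lemma BM_V_I:
  assumes "\<And>x. 0 \<le> V x" and "F \<in> borel_measurable borel" and "\<And>x. \<bar>F x\<bar> \<le> K * (1 + V x)"
  shows "F \<in> BM_V V"
proof -
  have "\<bar>F x\<bar> / (1 + V x) \<le> K" for x
    using assms(1)[of x] assms(3)[of x] by (simp add: divide_le_eq)
  then show ?thesis using assms(2) unfolding BM_V_def by (auto intro!: bdd_aboveI[where M = K])
qed

lemma BM_V_measurable: "F \<in> BM_V V \<Longrightarrow> F \<in> borel_measurable borel"
  by (simp add: BM_V_def)

lemma BM_V_bound:
  assumes V: "\<And>x. 0 \<le> V x" and F: "F \<in> BM_V V"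
  shows "\<bar>F x\<bar> \<le> weighted_norm V F * (1 + V x)"
proof -
  have "\<bar>F x\<bar> / (1 + V x) \<le> weighted_norm V F"
    unfolding weighted_norm_def using F by (intro cSUP_upper) (auto simp: BM_V_def)
  then show ?thesis using V[of x] by (simp add: divide_le_eq)
qed

lemma weighted_norm_nonneg:
  assumes V: "\<And>x. 0 \<le> V x" and F: "F \<in> BM_V V"
  shows "0 \<le> weighted_norm V F"
proof -
  have "0 \<le> weighted_norm V F * (1 + V undefined)" using BM_V_bound[OF V F, of undefined] by linarith
  then show ?thesis using V[of undefined] by (simp add: zero_le_mult_iff)
qed

lemma BM_obtain_bound:
  assumes "F \<in> BM"
  obtains M where "0 \<le> M" "\<And>x. \<bar>F x\<bar> \<le> M"
proof -
  obtain M where M: "\<And>x. \<bar>F x\<bar> \<le> M" using assms unfolding BM_def bounded_iff by auto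
  moreover have "0 \<le> M" using M[of undefined] by linarith
  ultimately show thesis by (intro that[of M])
qed

lemma Cb_subset_BM: "F \<in> Cb \<Longrightarrow> F \<in> BM"
  unfolding Cb_def BM_def by (auto intro: borel_measurable_continuous_onI)

locale lyapunov_kernel = jump_kernel Q
  for Q :: "real \<Rightarrow> 'a::polish_space \<Rightarrow> 'a measure" +
  fixes V :: "'a \<Rightarrow> real" and c :: "real \<Rightarrow> real"
  assumes continuous_V: "continuous_on UNIV V" and V_nonneg[simp]: "\<And>x. 0 \<le> V x"
    and continuous_Q_op: "\<And>F. F \<in> C_V V \<Longrightarrow> continuous_on UNIV (\<lambda>(t, x). Q_op Q t F x)"
    and continuous_c: "continuous_on UNIV c" and c_nonneg[simp]: "\<And>t. 0 \<le> c t"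
    and rate_le: "\<And>T. \<exists>a>0. \<forall>t\<le>T. \<forall>x. rate Q t x \<le> a * V x"
    and drift: "\<And>t x. (\<integral>\<^sup>+y. ennreal (V y) \<partial>Q t x) \<le> ennreal (c t * V x + rate Q t x * V x)"
begin

lemma V_measurable[measurable]: "V \<in> borel_measurable borel"
  using continuous_V by (rule borel_measurable_continuous_onI)

lemma c_measurable[measurable]: "c \<in> borel_measurable borel"
  using continuous_c by (rule borel_measurable_continuous_onI)

definition growth :: "real \<Rightarrow> real \<Rightarrow> real" where
  "growth s t = exp (LINT r:{s..t}|lborel. c r)"

lemma growth_ge_1: "1 \<le> growth s t"
  by (simp add: growth_def set_lebesgue_integral_def integral_nonneg_AE)

lemma growth_pos[simp]: "0 < growth s t" and growth_nonneg[simp]: "0 \<le> growth s t"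
  by (simp_all add: growth_def)

lemma growth_antimono: "s \<le> r \<Longrightarrow> r \<le> t \<Longrightarrow> growth r t \<le> growth s t"
proof -
  assume sr: "s \<le> r" "r \<le> t"
  obtain C where C: "\<And>t. (C has_real_derivative c t) (at t)"
    "\<And>s t. s \<le> t \<Longrightarrow> (LINT r:{s..t}|lborel. c r) = C t - C s"
    using continuous_antiderivative[OF continuous_c] by blast
  have "C s \<le> C r"
    using sr(1) C(1) c_nonneg by (intro DERIV_nonneg_imp_nondecreasing[of s r C]) blast+
  then show "growth r t \<le> growth s t" using sr C(2) by (simp add: growth_def)
qed

lemma growth_mono: "s \<le> r \<Longrightarrow> r \<le> t \<Longrightarrow> growth s r \<le> growth s t"
proof -
  assume sr: "s \<le> r" "r \<le> t"
  obtain C where C: "\<And>t. (C has_real_derivative c t) (at t)"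
    "\<And>s t. s \<le> t \<Longrightarrow> (LINT r:{s..t}|lborel. c r) = C t - C s"
    using continuous_antiderivative[OF continuous_c] by blast
  have "C r \<le> C t"
    using sr(2) C(1) c_nonneg by (intro DERIV_nonneg_imp_nondecreasing[of r t C]) blast+
  then show "growth s r \<le> growth s t" using sr C(2) by (simp add: growth_def)
qed

lemma growth_empty_interval: "t < s \<Longrightarrow> growth s t = 1"
  by (simp add: growth_def set_lebesgue_integral_def)

lemma hold_empty_interval: "t < s \<Longrightarrow> hold s t x = 1"
  by (simp add: hold_def set_lebesgue_integral_def)

lemma jump_empty_interval: "t < s \<Longrightarrow> jump n s t f x = (if n = 0 then f x else 0)"
  by (cases n) (simp_all add: hold_empty_interval)

lemma nn_integral_P_trivial:
  assumes "f \<in> borel_measurable borel" "t \<le> s"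
  shows "(\<integral>\<^sup>+y. f y \<partial>P s x t) = f x"
proof -
  have "jump n s t f x = (if n = 0 then f x else 0)" for n
    using assms(2) jump_empty_interval[of t s] jump_self[of n s f x] by (cases "t = s") auto
  then show ?thesis unfolding nn_integral_P[OF assms(1)] by (subst suminf_ennreal_split_head) (simp del: jump.simps)
qed

text \<open>The function \<open>s \<mapsto> exp (\<integral>\<^sub>s\<^sup>t c) V\<close> is a supersolution of the first-jump recursion: the drift
  condition bounds the integrand by \<open>V x\<close> times the derivative of
  \<open>- e(s, r, x) exp (\<integral>\<^sub>r\<^sup>t c)\<close> in \<open>r\<close>. Partial sums over the number of jumps stay below it.\<close>

lemma jump_sum_V_le:
  assumes "s \<le> t"
  shows "(\<Sum>n<N. jump n s t V x) \<le> ennreal (growth s t * V x)"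
  using assms
proof (induction N arbitrary: s x)
  case 0
  then show ?case by simp
next
  case (Suc N)
  obtain C where C: "\<And>t. (C has_real_derivative c t) (at t)"
    "\<And>s t. s \<le> t \<Longrightarrow> (LINT r:{s..t}|lborel. c r) = C t - C s"
    using continuous_antiderivative[OF continuous_c] by blast
  have [measurable]: "C \<in> borel_measurable borel" "cum_rate x \<in> borel_measurable borel"
    using DERIV_isCont[OF C(1)] DERIV_isCont[OF DERIV_cum_rate]
    by (auto intro!: borel_measurable_continuous_onI simp: continuous_on_eq_continuous_at)
  let ?E = "\<lambda>r. exp (cum_rate x s - cum_rate x r + C t - C r)"
  have bound: "ennreal (hold s r x) * (\<integral>\<^sup>+y. (\<Sum>n<N. jump n r t V y) \<partial>Q r x)
      \<le> ennreal (?E r * (rate Q r x + c r)) * ennreal (V x)" if r: "r \<in> {s..t}" for r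
  proof -
    have "(\<integral>\<^sup>+y. (\<Sum>n<N. jump n r t V y) \<partial>Q r x) \<le> (\<integral>\<^sup>+y. ennreal (growth r t) * ennreal (V y) \<partial>Q r x)"
      using Suc.IH r by (intro nn_integral_mono) (simp add: ennreal_mult)
    also have "\<dots> = ennreal (growth r t) * (\<integral>\<^sup>+y. ennreal (V y) \<partial>Q r x)"
      by (rule nn_integral_cmult) simp
    also have "\<dots> \<le> ennreal (growth r t) * ennreal (c r * V x + rate Q r x * V x)"
      by (intro mult_left_mono drift) simp
    finally have "ennreal (hold s r x) * (\<integral>\<^sup>+y. (\<Sum>n<N. jump n r t V y) \<partial>Q r x)
      \<le> ennreal (hold s r x) * (ennreal (growth r t) * ennreal (c r * V x + rate Q r x * V x))"
      by (rule mult_left_mono) simp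
    also have "\<dots> = ennreal (hold s r x * (growth r t * ((rate Q r x + c r) * V x)))"
      by (simp add: ennreal_mult[symmetric] algebra_simps)
    also have "hold s r x * (growth r t * ((rate Q r x + c r) * V x)) = ?E r * (rate Q r x + c r) * V x"
      using r by (simp add: hold_eq_cum_rate growth_def C(2) exp_add exp_diff)
    finally show ?thesis by (simp add: ennreal_mult)
  qed
  let ?I = "\<integral>\<^sup>+r\<in>{s..t}. ennreal (hold s r x) * (\<integral>\<^sup>+y. (\<Sum>n<N. jump n r t V y) \<partial>Q r x) \<partial>lborel"
  have "?I \<le> (\<integral>\<^sup>+r. ennreal (?E r * (rate Q r x + c r)) * indicator {s..t} r * ennreal (V x) \<partial>lborel)"
    using bound by (intro nn_integral_mono) (auto simp: indicator_def)
  also have "\<dots> = (\<integral>\<^sup>+r\<in>{s..t}. ennreal (?E r * (rate Q r x + c r)) \<partial>lborel) * ennreal (V x)"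
    by (rule nn_integral_multc) measurable
  also have "(\<integral>\<^sup>+r\<in>{s..t}. ennreal (?E r * (rate Q r x + c r)) \<partial>lborel) = ennreal (- ?E t - - ?E s)"
  proof (rule nn_integral_FTC_Icc[OF _ _ _ Suc.prems])
    show "((\<lambda>r. - ?E r) has_real_derivative ?E r * (rate Q r x + c r)) (at r)" for r
      by (auto intro!: derivative_eq_intros DERIV_cum_rate[of x r] C(1)[of r] simp: algebra_simps)
    show "(\<lambda>r. ?E r * (rate Q r x + c r)) \<in> borel_measurable borel" by measurable
    show "0 \<le> ?E r * (rate Q r x + c r)" for r
      using c_nonneg[of r] rate_nonneg[of r x] by (intro mult_nonneg_nonneg add_nonneg_nonneg) auto
  qed
  also have "- ?E t - - ?E s = growth s t - hold s t x"
    using Suc.prems by (simp add: growth_def C(2) hold_eq_cum_rate)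
  finally have later: "?I \<le> ennreal (growth s t - hold s t x) * ennreal (V x)" .
  have "(\<Sum>n<Suc N. jump n s t V x) = ennreal (hold s t x) * V x + ?I"
    by (rule jump_sum_Suc) simp
  also have "\<dots> \<le> ennreal (hold s t x) * V x + ennreal (growth s t - hold s t x) * ennreal (V x)"
    using later by (rule add_left_mono)
  also have "\<dots> = ennreal (hold s t x * V x + (growth s t - hold s t x) * V x)"
  proof -
    have "0 \<le> growth s t - hold s t x" using growth_ge_1[of s t] hold_le_1[of s t x] by linarith
    then show ?thesis by (simp add: ennreal_mult)
  qed
  also have "\<dots> = ennreal (growth s t * V x)" by (simp add: algebra_simps)
  finally show ?case .
qed

lemma nn_integral_P_V_le: "(\<integral>\<^sup>+y. ennreal (V y) \<partial>P s x t) \<le> ennreal (growth s t * V x)"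
proof (cases "s \<le> t")
  case True
  then show ?thesis
    by (simp add: nn_integral_P suminf_eq_SUP jump_sum_V_le SUP_least)
next
  case False
  then show ?thesis by (simp add: nn_integral_P_trivial growth_empty_interval)
qed

text \<open>In the integrated forward equation for \<open>F = 1\<close> the same quantity \<open>\<integral> U(s, r) q(r) dr\<close> stands on both
  sides. It is finite because \<open>q \<le> a V\<close>, so it may be subtracted.\<close>

lemma emeasure_P_UNIV: "emeasure (P s x t) UNIV = 1"
proof (cases "s \<le> t")
  case True
  obtain a where a: "a > 0" "\<And>r y. r \<le> t \<Longrightarrow> rate Q r y \<le> a * V y" using rate_le[of t] by blast
  define X where "X = (\<integral>\<^sup>+r\<in>{s..t}. (\<integral>\<^sup>+y. ennreal (rate Q r y) \<partial>P s x r) \<partial>lborel)"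
  have "X \<le> (\<integral>\<^sup>+r. ennreal (a * (growth s t * V x)) * indicator {s..t} r \<partial>lborel)"
    unfolding X_def
  proof (rule nn_integral_mono)
    fix r :: real
    show "(\<integral>\<^sup>+y. ennreal (rate Q r y) \<partial>P s x r) * indicator {s..t} r \<le> ennreal (a * (growth s t * V x)) * indicator {s..t} r"
    proof (cases "r \<in> {s..t}")
      case True
      have "(\<integral>\<^sup>+y. ennreal (rate Q r y) \<partial>P s x r) \<le> (\<integral>\<^sup>+y. ennreal a * ennreal (V y) \<partial>P s x r)"
        using a True by (intro nn_integral_mono) (simp add: ennreal_mult[symmetric] ennreal_leI)
      also have "\<dots> = ennreal a * (\<integral>\<^sup>+y. ennreal (V y) \<partial>P s x r)"
        by (rule nn_integral_cmult) simp
      also have "\<dots> \<le> ennreal a * ennreal (growth s t * V x)"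
        using nn_integral_P_V_le[of s x r] growth_mono[of s r t] True
        by (intro mult_left_mono) (auto intro!: order_trans[OF nn_integral_P_V_le] ennreal_leI mult_right_mono)
      finally show ?thesis using a True by (simp add: ennreal_mult)
    qed simp
  qed
  also have "\<dots> < \<infinity>" using True by (simp add: nn_integral_cmult ennreal_mult_less_top)
  finally have fin: "X < \<infinity>" .
  have "emeasure (P s x t) UNIV + X = 1 + X"
    using P_forward_nn[of "\<lambda>_. 1" s t x] True by (simp add: X_def emeasure_Q_UNIV)
  then show ?thesis using fin by (metis ennreal_add_left_cancel add.commute less_irrefl infinity_ennreal_def)
next
  case False
  then show ?thesis using nn_integral_P_trivial[of "\<lambda>_. 1" t s x] by simp
qed

lemma prob_space_P: "prob_space (P s x t)"
  by (rule prob_spaceI) (simp add: emeasure_P_UNIV)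

lemma P_kernel: "(\<lambda>x. P s x t) \<in> borel \<rightarrow>\<^sub>M subprob_algebra borel"
proof (rule measurable_subprob_algebra)
  show "subprob_space (P s x t)" for x using prob_space_P by (rule prob_space_imp_subprob_space)
  show "(\<lambda>x. emeasure (P s x t) A) \<in> borel_measurable borel" if A: "A \<in> sets borel" for A
    using A by (simp add: emeasure_P)
qed simp

lemma integrable_P:
  assumes F: "F \<in> BM_V V" shows "integrable (P s x t) F"
proof -
  interpret prob_space "P s x t" by (rule prob_space_P)
  have "integrable (P s x t) V"
    using nn_integral_P_V_le[of s x t]
    by (intro integrableI_bounded) (auto intro: le_less_trans)
  then have "integrable (P s x t) (\<lambda>y. weighted_norm V F * (1 + V y))" by simp
  then show ?thesis
    by (rule Bochner_Integration.integrable_bound)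
       (use BM_V_measurable[OF F] BM_V_bound[OF V_nonneg F] in \<open>auto intro!: AE_I2 order_trans[OF _ abs_ge_self]\<close>)
qed

lemma integrable_Q:
  assumes F: "F \<in> BM_V V" shows "integrable (Q t x) F"
proof -
  interpret finite_measure "Q t x" by (rule finite_Q)
  have "integrable (Q t x) V"
    using drift[of t x]
    by (intro integrableI_bounded) (auto intro: le_less_trans)
  then have "integrable (Q t x) (\<lambda>y. weighted_norm V F * (1 + V y))" by simp
  then show ?thesis
    by (rule Bochner_Integration.integrable_bound)
       (use BM_V_measurable[OF F] BM_V_bound[OF V_nonneg F] in \<open>auto intro!: AE_I2 order_trans[OF _ abs_ge_self]\<close>)
qed

lemma V_BM_V: "V \<in> BM_V V"
  by (rule BM_V_I[where K = 1]) auto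

lemma BM_subset_BM_V: "F \<in> BM \<Longrightarrow> F \<in> BM_V V"
proof -
  assume F: "F \<in> BM"
  then obtain M where M: "0 \<le> M" "\<And>x. \<bar>F x\<bar> \<le> M" by (rule BM_obtain_bound) blast
  have "M * 1 \<le> M * (1 + V x)" for x using M by (intro mult_left_mono) auto
  then show ?thesis using F M by (intro BM_V_I[where K = M]) (auto simp: BM_def intro: order_trans)
qed

lemma BM_V_lincomb:
  assumes F: "F \<in> BM_V V" and G: "G \<in> BM_V V"
  shows "(\<lambda>x. a * F x + b * G x) \<in> BM_V V"
proof (rule BM_V_I[where K = "\<bar>a\<bar> * weighted_norm V F + \<bar>b\<bar> * weighted_norm V G"])
  show "(\<lambda>x. a * F x + b * G x) \<in> borel_measurable borel"
    using F[THEN BM_V_measurable] G[THEN BM_V_measurable] by measurable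
  fix x
  have "\<bar>a * F x + b * G x\<bar> \<le> \<bar>a\<bar> * \<bar>F x\<bar> + \<bar>b\<bar> * \<bar>G x\<bar>" by (metis abs_mult abs_triangle_ineq)
  also have "\<dots> \<le> \<bar>a\<bar> * (weighted_norm V F * (1 + V x)) + \<bar>b\<bar> * (weighted_norm V G * (1 + V x))"
    using F G by (intro add_mono mult_left_mono BM_V_bound) auto
  finally show "\<bar>a * F x + b * G x\<bar> \<le> (\<bar>a\<bar> * weighted_norm V F + \<bar>b\<bar> * weighted_norm V G) * (1 + V x)"
    by (simp add: algebra_simps)
qed simp

text \<open>Transfers identities for integrals of nonnegative functions, proved with values in \<^typ>\<open>ennreal\<close>,
  to functions of either sign.\<close>

lemma BM_V_nonneg_diff_induct [consumes 1, case_names nonneg diff]: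
  assumes F: "F \<in> BM_V V"
    and nonneg: "\<And>F. F \<in> BM_V V \<Longrightarrow> (\<And>x. 0 \<le> F x) \<Longrightarrow> R F"
    and diff: "\<And>F G. \<lbrakk>F \<in> BM_V V; G \<in> BM_V V; R F; R G\<rbrakk> \<Longrightarrow> R (\<lambda>x. F x - G x)"
  shows "R F"
proof -
  have [measurable]: "F \<in> borel_measurable borel" using F by (rule BM_V_measurable)
  have 1: "(\<lambda>x. max (F x) 0) \<in> BM_V V" "(\<lambda>x. max (- F x) 0) \<in> BM_V V"
    using BM_V_bound[OF V_nonneg F]
    by (auto intro!: BM_V_I[where K = "weighted_norm V F"] simp: max_def abs_le_iff
        weighted_norm_nonneg[OF V_nonneg F] add_nonneg_nonneg)
  have "R (\<lambda>x. max (F x) 0 - max (- F x) 0)" using 1 by (intro diff nonneg) auto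
  also have "(\<lambda>x. max (F x) 0 - max (- F x) 0) = F" by auto
  finally show ?thesis .
qed

abbreviation U where "U \<equiv> kernel_op P"

lemma U_diff:
  "F \<in> BM_V V \<Longrightarrow> G \<in> BM_V V \<Longrightarrow> U s t (\<lambda>x. F x - G x) x = U s t F x - U s t G x"
  unfolding kernel_op_def by (intro Bochner_Integration.integral_diff integrable_P)

lemma Q_op_diff:
  "F \<in> BM_V V \<Longrightarrow> G \<in> BM_V V \<Longrightarrow> Q_op Q t (\<lambda>x. F x - G x) x = Q_op Q t F x - Q_op Q t G x"
  unfolding Q_op_def by (intro Bochner_Integration.integral_diff integrable_Q)

lemma ennreal_U:
  assumes "F \<in> BM_V V" "\<And>x. 0 \<le> F x"
  shows "ennreal (U s t F x) = (\<integral>\<^sup>+y. ennreal (F y) \<partial>P s x t)"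
  unfolding kernel_op_def using assms by (intro nn_integral_eq_integral[symmetric] integrable_P) auto

lemma ennreal_Q_op:
  assumes "F \<in> BM_V V" "\<And>x. 0 \<le> F x"
  shows "ennreal (Q_op Q t F x) = (\<integral>\<^sup>+y. ennreal (F y) \<partial>Q t x)"
  unfolding Q_op_def using assms by (intro nn_integral_eq_integral[symmetric] integrable_Q) auto

lemma U_nonneg: "(\<And>x. 0 \<le> F x) \<Longrightarrow> 0 \<le> U s t F x"
  unfolding kernel_op_def by (simp add: integral_nonneg_AE)

lemma Q_op_nonneg: "(\<And>x. 0 \<le> F x) \<Longrightarrow> 0 \<le> Q_op Q t F x"
  unfolding Q_op_def by (simp add: integral_nonneg_AE)

lemma U_const: "U s t (\<lambda>_. b) x = b"
proof -
  interpret prob_space "P s x t" by (rule prob_space_P)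
  show ?thesis using prob_space by (simp add: kernel_op_def)
qed

lemma Q_op_const: "Q_op Q t (\<lambda>_. b) x = rate Q t x * b"
proof -
  interpret finite_measure "Q t x" by (rule finite_Q)
  show ?thesis by (simp add: Q_op_def rate_def)
qed

lemma U_V_le: "U s t V x \<le> growth s t * V x"
proof -
  have "ennreal (U s t V x) \<le> ennreal (growth s t * V x)"
    using nn_integral_P_V_le[of s x t] ennreal_U[OF V_BM_V, of s t x] by simp
  then show ?thesis by (subst (asm) ennreal_le_iff) simp_all
qed

lemma Q_op_V_le: "Q_op Q t V x \<le> c t * V x + rate Q t x * V x"
proof -
  have "ennreal (Q_op Q t V x) \<le> ennreal (c t * V x + rate Q t x * V x)"
    using drift[of t x] ennreal_Q_op[OF V_BM_V, of t x] by (simp del: ennreal_plus)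
  then show ?thesis by (subst (asm) ennreal_le_iff) simp_all
qed

lemma U_mono: "F \<in> BM_V V \<Longrightarrow> G \<in> BM_V V \<Longrightarrow> (\<And>x. F x \<le> G x) \<Longrightarrow> U s t F x \<le> U s t G x"
  unfolding kernel_op_def by (intro integral_mono integrable_P)

lemma Q_op_mono: "F \<in> BM_V V \<Longrightarrow> G \<in> BM_V V \<Longrightarrow> (\<And>x. F x \<le> G x) \<Longrightarrow> Q_op Q t F x \<le> Q_op Q t G x"
  unfolding Q_op_def by (intro integral_mono integrable_Q)

lemma one_plus_V_BM_V: "(\<lambda>x. K * (1 + V x)) \<in> BM_V V"
  by (rule BM_V_I[where K = "\<bar>K\<bar>"]) (auto simp: abs_mult)

text \<open>Uses \<open>U 1 = 1\<close>, \<open>U V \<le> exp (\<integral> c) V\<close> and \<open>exp (\<integral> c) \<ge> 1\<close>.\<close>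

lemma abs_U_le:
  assumes F: "F \<in> BM_V V" and K: "\<And>x. \<bar>F x\<bar> \<le> K * (1 + V x)"
  shows "\<bar>U s t F x\<bar> \<le> growth s t * K * (1 + V x)"
proof -
  interpret prob_space "P s x t" by (rule prob_space_P)
  have K0: "0 \<le> K" using K[of x] V_nonneg[of x]
    by (smt (verit) mult_neg_pos)
  have "\<bar>U s t F x\<bar> \<le> U s t (\<lambda>x. \<bar>F x\<bar>) x"
    unfolding kernel_op_def by (rule integral_abs_bound)
  also have "\<dots> \<le> U s t (\<lambda>x. K * (1 + V x)) x"
    unfolding kernel_op_def
    using K by (intro integral_mono integrable_P one_plus_V_BM_V integrable_abs F)
  also have "\<dots> = K * (1 + U s t V x)"
    unfolding kernel_op_def using integrable_P[OF V_BM_V, of s x t] prob_space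
    by (simp add: prob_space)
  also have "\<dots> \<le> K * (growth s t * 1 + growth s t * V x)"
    using K0 U_V_le growth_ge_1 by (intro mult_left_mono add_mono) auto
  finally show ?thesis by (simp add: algebra_simps)
qed

lemma abs_Q_op_le:
  assumes F: "F \<in> BM_V V" and K: "\<And>x. \<bar>F x\<bar> \<le> K * (1 + V x)"
  shows "\<bar>Q_op Q t F x\<bar> \<le> K * (rate Q t x * (1 + V x) + c t * V x)"
proof -
  interpret finite_measure "Q t x" by (rule finite_Q)
  have K0: "0 \<le> K" using K[of x] V_nonneg[of x]
    by (smt (verit) mult_neg_pos)
  have "\<bar>Q_op Q t F x\<bar> \<le> Q_op Q t (\<lambda>x. \<bar>F x\<bar>) x"
    unfolding Q_op_def by (rule integral_abs_bound)
  also have "\<dots> \<le> Q_op Q t (\<lambda>x. K * (1 + V x)) x"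
    unfolding Q_op_def
    using K by (intro integral_mono integrable_Q one_plus_V_BM_V integrable_abs F)
  also have "\<dots> = K * (rate Q t x + Q_op Q t V x)"
    unfolding Q_op_def using integrable_Q[OF V_BM_V, of t x]
    by (simp add: rate_def)
  also have "\<dots> \<le> K * (rate Q t x + (c t * V x + rate Q t x * V x))"
    using K0 Q_op_V_le by (intro mult_left_mono add_mono) auto
  finally show ?thesis by (simp add: algebra_simps)
qed

lemma U_measurable:
  assumes f: "(\<lambda>(p, y). f p y) \<in> borel_measurable (N \<Otimes>\<^sub>M borel)" and f_V: "\<And>p. p \<in> space N \<Longrightarrow> f p \<in> BM_V V"
    and [measurable]: "S \<in> borel_measurable N" "T \<in> borel_measurable N" "X \<in> borel_measurable N"
  shows "(\<lambda>p. U (S p) (T p) (f p) (X p)) \<in> borel_measurable N"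
proof (rule measurable_cong[THEN iffD1])
  note f[measurable]
  show "(\<lambda>p. enn2real (\<integral>\<^sup>+y. ennreal (f p y) \<partial>P (S p) (X p) (T p)) -
     enn2real (\<integral>\<^sup>+y. ennreal (- f p y) \<partial>P (S p) (X p) (T p))) \<in> borel_measurable N"
    by (intro borel_measurable_diff borel_measurable_enn2real nn_integral_P_measurable) measurable
  fix p assume "p \<in> space N"
  then show "enn2real (\<integral>\<^sup>+y. ennreal (f p y) \<partial>P (S p) (X p) (T p)) -
     enn2real (\<integral>\<^sup>+y. ennreal (- f p y) \<partial>P (S p) (X p) (T p)) = U (S p) (T p) (f p) (X p)"
    unfolding kernel_op_def by (intro real_lebesgue_integral_def[symmetric] integrable_P f_V)
qed

lemma Q_op_measurable:
  assumes f: "(\<lambda>(p, y). f p y) \<in> borel_measurable (N \<Otimes>\<^sub>M borel)" and f_V: "\<And>p. p \<in> space N \<Longrightarrow> f p \<in> BM_V V"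
    and [measurable]: "T \<in> borel_measurable N" "X \<in> borel_measurable N"
  shows "(\<lambda>p. Q_op Q (T p) (f p) (X p)) \<in> borel_measurable N"
proof (rule measurable_cong[THEN iffD1])
  note f[measurable]
  show "(\<lambda>p. enn2real (\<integral>\<^sup>+y. ennreal (f p y) \<partial>Q (T p) (X p)) -
     enn2real (\<integral>\<^sup>+y. ennreal (- f p y) \<partial>Q (T p) (X p))) \<in> borel_measurable N"
    by (intro borel_measurable_diff borel_measurable_enn2real measurable_nn_integral_Q) measurable
  fix p assume "p \<in> space N"
  then show "enn2real (\<integral>\<^sup>+y. ennreal (f p y) \<partial>Q (T p) (X p)) -
     enn2real (\<integral>\<^sup>+y. ennreal (- f p y) \<partial>Q (T p) (X p)) = Q_op Q (T p) (f p) (X p)"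
    unfolding Q_op_def by (intro real_lebesgue_integral_def[symmetric] integrable_Q f_V)
qed

lemma U_measurable_const:
  assumes F: "F \<in> BM_V V"
    and [measurable]: "S \<in> borel_measurable N" "T \<in> borel_measurable N" "X \<in> borel_measurable N"
  shows "(\<lambda>p. U (S p) (T p) F (X p)) \<in> borel_measurable N"
proof (rule U_measurable)
  note BM_V_measurable[OF F, measurable]
  show "(\<lambda>(p, y). F y) \<in> borel_measurable (N \<Otimes>\<^sub>M borel)" by measurable
qed (use F in auto)

lemma U_BM_V:
  assumes F: "F \<in> BM_V V" shows "U s t F \<in> BM_V V"
proof (rule BM_V_I[where K = "growth s t * weighted_norm V F"])
  show "U s t F \<in> borel_measurable borel" using U_measurable_const[OF F, of "\<lambda>_. s" borel "\<lambda>_. t" "\<lambda>x. x"] by simp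
  show "\<bar>U s t F x\<bar> \<le> growth s t * weighted_norm V F * (1 + V x)" for x
    by (rule abs_U_le[OF F BM_V_bound[OF V_nonneg F]])
qed simp

lemma weighted_norm_U_le:
  assumes F: "F \<in> BM_V V" shows "weighted_norm V (U s t F) \<le> growth s t * weighted_norm V F"
  by (intro weighted_norm_le abs_U_le[OF F BM_V_bound[OF V_nonneg F]]) simp

lemma U_trivial: "F \<in> BM_V V \<Longrightarrow> t \<le> s \<Longrightarrow> U s t F = F"
proof (induction F rule: BM_V_nonneg_diff_induct)
  case (nonneg F)
  show ?case
  proof
    fix x
    have "ennreal (U s t F x) = ennreal (F x)"
      using nonneg BM_V_measurable[OF nonneg(1)] by (simp add: ennreal_U nn_integral_P_trivial)
    then show "U s t F x = F x" using nonneg(2) U_nonneg[of F s t x] by simp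
  qed
next
  case (diff F G)
  then show ?case by (simp add: fun_eq_iff U_diff)
qed

lemma U_semigroup:
  assumes F: "F \<in> BM_V V" and srt: "s \<le> r" "r \<le> t"
  shows "U s r (U r t F) = U s t F"
  using F
proof (induction F rule: BM_V_nonneg_diff_induct)
  case (nonneg F)
  note BM_V_measurable[OF nonneg(1), measurable]
  show ?case
  proof
    fix x
    have "ennreal (U s r (U r t F) x) = ennreal (U s t F x)"
      using nonneg Chapman_Kolmogorov[of F s r t x] srt by (simp add: ennreal_U U_BM_V U_nonneg)
    then show "U s r (U r t F) x = U s t F x" using nonneg(2) by (simp add: U_nonneg)
  qed
next
  case (diff F G)
  have "U r t (\<lambda>x. F x - G x) = (\<lambda>x. U r t F x - U r t G x)" using diff by (simp add: fun_eq_iff U_diff)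
  then show ?case using diff by (simp add: fun_eq_iff U_diff U_BM_V)
qed

end

section \<open>The backward and forward equations almost everywhere\<close>

lemma one_minus_exp_le:
  "0 \<le> (z::real) \<Longrightarrow> 1 - exp (- z) \<le> z"
  using exp_ge_add_one_self[of "- z"] by simp

lemma continuous_bounded_on_interval:
  fixes g :: "real \<Rightarrow> real"
  assumes "continuous_on UNIV g"
  obtains b where "0 \<le> b" "\<And>r. r \<in> {s..t} \<Longrightarrow> \<bar>g r\<bar> \<le> b"
proof -
  have "compact (g ` {s..t})"
    using assms by (intro compact_continuous_image continuous_on_subset[OF assms]) auto
  then obtain b where "\<And>y. y \<in> g ` {s..t} \<Longrightarrow> norm y \<le> b"
    using compact_imp_bounded bounded_iff by metis
  then show thesis by (intro that[of "\<bar>b\<bar>"]) fastforce+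
qed

text \<open>Limits of continuous functions from below are lower semicontinuous; if \<open>u\<close> and \<open>w\<close> both are and
  their sum is continuous, then \<open>u\<close> is also upper semicontinuous.\<close>

lemma continuous_on_of_lower_approximations:
  fixes u w :: "'b::topological_space \<Rightarrow> real"
  assumes g: "\<And>n::nat. continuous_on S (g n)" "\<And>n p. p \<in> S \<Longrightarrow> g n p \<le> u p"
      "\<And>p. p \<in> S \<Longrightarrow> (\<lambda>n. g n p) \<longlonglongrightarrow> u p"
    and h: "\<And>n::nat. continuous_on S (h n)" "\<And>n p. p \<in> S \<Longrightarrow> h n p \<le> w p"
      "\<And>p. p \<in> S \<Longrightarrow> (\<lambda>n. h n p) \<longlonglongrightarrow> w p"
    and sum: "continuous_on S (\<lambda>p. u p + w p)"
  shows "continuous_on S u"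
  unfolding continuous_on_def
proof
  fix p assume p: "p \<in> S"
  have lower: "\<forall>\<^sub>F x in at p within S. a < f x"
    if k: "\<And>n::nat. continuous_on S (k n)" "\<And>n p. p \<in> S \<Longrightarrow> k n p \<le> f p"
      "(\<lambda>n. k n p) \<longlonglongrightarrow> f p" and a: "a < f p"
    for k :: "nat \<Rightarrow> 'b \<Rightarrow> real" and f :: "'b \<Rightarrow> real" and a
  proof -
    have "\<forall>\<^sub>F n in sequentially. a < k n p" using k(3) a by (rule order_tendstoD(1))
    then obtain n where n: "a < k n p" by (auto simp: eventually_sequentially)
    have "(k n \<longlongrightarrow> k n p) (at p within S)" using k(1)[of n] p by (simp add: continuous_on_def)
    then have "\<forall>\<^sub>F x in at p within S. a < k n x" using n by (rule order_tendstoD(1))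
    moreover have "\<forall>\<^sub>F x in at p within S. x \<in> S" by (simp add: eventually_at_filter)
    ultimately show ?thesis by eventually_elim (use k(2)[of _ n] in fastforce)
  qed
  show "(u \<longlongrightarrow> u p) (at p within S)"
  proof (rule order_tendstoI)
    fix a assume "a < u p"
    then show "\<forall>\<^sub>F x in at p within S. a < u x" using g p by (intro lower[of g]) auto
  next
    fix a assume a: "u p < a"
    define e where "e = (a - u p) / 2"
    have e: "e > 0" using a by (simp add: e_def)
    have "\<forall>\<^sub>F x in at p within S. w p - e < w x" using h p e by (intro lower[of h]) auto
    moreover have "((\<lambda>p. u p + w p) \<longlongrightarrow> u p + w p) (at p within S)"
      using sum p by (simp add: continuous_on_def)
    then have "\<forall>\<^sub>F x in at p within S. u x + w x < u p + w p + e"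
      using e by (intro order_tendstoD) auto
    ultimately show "\<forall>\<^sub>F x in at p within S. u x < a"
      by eventually_elim (simp add: e_def field_simps)
  qed
qed

lemma continuous_on_interval_integral:
  fixes f :: "real \<Rightarrow> 'b::metric_space \<Rightarrow> real"
  assumes cont: "\<And>u. u \<in> {r..t} \<Longrightarrow> continuous_on UNIV (f u)"
    and meas[measurable]: "\<And>x. (\<lambda>u. f u x) \<in> borel_measurable borel"
    and bnd: "\<And>u x. u \<in> {r..t} \<Longrightarrow> \<bar>f u x\<bar> \<le> B x" and B: "continuous_on UNIV B"
  shows "continuous_on UNIV (\<lambda>x. LINT u:{r..t}|lborel. f u x)"
proof (subst continuous_on_sequentially, intro allI ballI impI, elim conjE, unfold o_def)
  fix X :: "nat \<Rightarrow> 'b" and a assume X: "X \<longlonglongrightarrow> a"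
  have lim: "(\<lambda>n. h (X n)) \<longlonglongrightarrow> h a" if "continuous_on UNIV h" for h :: "'b \<Rightarrow> real"
    by (rule continuous_on_tendsto_compose[OF that X]) auto
  have "Bseq (\<lambda>n. B (X n))" using lim[OF B] by (rule convergent_imp_Bseq[OF convergentI])
  then obtain b where b: "\<And>n. \<bar>B (X n)\<bar> \<le> b" by (auto simp: Bseq_def)
  show "(\<lambda>n. LINT u:{r..t}|lborel. f u (X n)) \<longlonglongrightarrow> (LINT u:{r..t}|lborel. f u a)"
    unfolding set_lebesgue_integral_def
  proof (rule integral_dominated_convergence[where w = "\<lambda>u. indicator {r..t} u * b"])
    show "integrable lborel (\<lambda>u. indicator {r..t} u * b)"
      using set_integrable_bounded_interval[of "\<lambda>_. b" r t "\<bar>b\<bar>"] by (simp add: set_integrable_def)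
    show "AE u in lborel. (\<lambda>n. indicat_real {r..t} u *\<^sub>R f u (X n)) \<longlonglongrightarrow> indicat_real {r..t} u *\<^sub>R f u a"
      using lim cont by (intro AE_I2) (auto simp: indicator_def)
    show "AE u in lborel. norm (indicat_real {r..t} u *\<^sub>R f u (X n)) \<le> indicat_real {r..t} u * b" for n
    proof (intro AE_I2)
      fix u
      show "norm (indicat_real {r..t} u *\<^sub>R f u (X n)) \<le> indicat_real {r..t} u * b"
        using bnd[of u "X n"] b[of n] by (auto simp: indicator_def)
    qed
  qed measurable
qed

context lyapunov_kernel
begin

lemma Cb_C_V: "F \<in> Cb \<Longrightarrow> F \<in> C_V V"
  using BM_subset_BM_V[OF Cb_subset_BM] by (simp add: C_V_def Cb_def)

lemma Cb_BM_V: "F \<in> Cb \<Longrightarrow> F \<in> BM_V V"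
  using BM_subset_BM_V[OF Cb_subset_BM] by simp

lemma const_BM_V: "(\<lambda>_. b) \<in> BM_V V"
  by (rule BM_subset_BM_V) (simp add: BM_def)

lemma rate_bounded_on:
  obtains K where "0 \<le> K" "\<And>r. r \<le> t \<Longrightarrow> rate Q r x \<le> K"
proof -
  obtain a where "a > 0" "\<And>r y. r \<le> t \<Longrightarrow> rate Q r y \<le> a * V y" using rate_le[of t] by blast
  then show thesis by (intro that[of "a * V x"]) auto
qed

lemma one_minus_hold_le:
  assumes K: "\<And>r. s \<le> r \<Longrightarrow> r \<le> t \<Longrightarrow> rate Q r x \<le> K" and st: "s \<le> t"
  shows "1 - hold s t x \<le> K * (t - s)"
proof -
  have "1 - hold s t x \<le> (LINT r:{s..t}|lborel. rate Q r x)"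
    unfolding hold_def
    by (rule one_minus_exp_le) (simp add: set_lebesgue_integral_def integral_nonneg_AE)
  also have "\<dots> \<le> \<bar>LINT r:{s..t}|lborel. rate Q r x\<bar>" by simp
  also have "\<dots> \<le> K * (t - s)"
    using K st by (intro abs_set_integral_interval_le) auto
  finally show ?thesis .
qed

lemma hold_rate_integral:
  assumes "s \<le> t"
  shows "(LINT r:{s..t}|lborel. hold s r x * rate Q r x) = 1 - hold s t x"
proof -
  obtain K where K: "0 \<le> K" "\<And>r. r \<le> t \<Longrightarrow> rate Q r x \<le> K" using rate_bounded_on[of t x] by blast
  have "ennreal (LINT r:{s..t}|lborel. hold s r x * rate Q r x) =
      (\<integral>\<^sup>+r\<in>{s..t}. ennreal (hold s r x * rate Q r x) \<partial>lborel)"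
  proof (rule nn_integral_interval_eq_set_integral[symmetric, where M = K])
    fix r assume "r \<in> {s..t}"
    then show "0 \<le> hold s r x * rate Q r x \<and> hold s r x * rate Q r x \<le> K"
      using K hold_le_1[of s r x] mult_mono[of "hold s r x" 1 "rate Q r x" K] by auto
  qed measurable
  then have "ennreal (hold s t x) + ennreal (LINT r:{s..t}|lborel. hold s r x * rate Q r x) = 1"
    using hold_forward[OF assms] by simp
  moreover have "0 \<le> (LINT r:{s..t}|lborel. hold s r x * rate Q r x)"
    by (simp add: set_lebesgue_integral_def integral_nonneg_AE)
  ultimately have "ennreal (hold s t x + (LINT r:{s..t}|lborel. hold s r x * rate Q r x)) = ennreal 1"
    by simp
  then have "hold s t x + (LINT r:{s..t}|lborel. hold s r x * rate Q r x) = 1"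
    by (subst (asm) ennreal_inj)
       (auto simp: set_lebesgue_integral_def intro!: add_nonneg_nonneg integral_nonneg_AE)
  then show ?thesis by simp
qed

lemma Q_op_U_measurable:
  assumes F: "F \<in> BM_V V"
  shows "(\<lambda>r. Q_op Q r (U r t F) x) \<in> borel_measurable borel"
proof (rule Q_op_measurable)
  have "(\<lambda>p. U (fst p) t F (snd p)) \<in> borel_measurable (borel \<Otimes>\<^sub>M borel)"
    by (rule U_measurable_const[OF F]) measurable
  then show "(\<lambda>(p, y). U p t F y) \<in> borel_measurable (borel \<Otimes>\<^sub>M borel)" by (simp add: case_prod_unfold)
qed (use U_BM_V[OF F] in auto)

lemma Q_op_U_bounded:
  assumes F: "F \<in> BM_V V"
  obtains M where "0 \<le> M" "\<And>r. r \<in> {s..t} \<Longrightarrow> \<bar>Q_op Q r (U r t F) x\<bar> \<le> M"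
proof -
  obtain K where K: "0 \<le> K" "\<And>r. r \<le> t \<Longrightarrow> rate Q r x \<le> K" using rate_bounded_on[of t x] by blast
  obtain b where b: "0 \<le> b" "\<And>r. r \<in> {s..t} \<Longrightarrow> \<bar>c r\<bar> \<le> b"
    using continuous_bounded_on_interval[OF continuous_c] by blast
  let ?W = "weighted_norm V F"
  have W: "0 \<le> ?W" by (rule weighted_norm_nonneg[OF V_nonneg F])
  let ?M = "growth s t * ?W * (K * (1 + V x) + b * V x)"
  show thesis
  proof (rule that[of ?M])
    show "0 \<le> ?M" using W K b by (intro mult_nonneg_nonneg add_nonneg_nonneg) auto
    fix r assume r: "r \<in> {s..t}"
    have "\<bar>U r t F y\<bar> \<le> growth s t * ?W * (1 + V y)" for y
    proof -
      have "\<bar>U r t F y\<bar> \<le> growth r t * ?W * (1 + V y)" by (rule abs_U_le[OF F BM_V_bound[OF V_nonneg F]])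
      also have "\<dots> \<le> growth s t * ?W * (1 + V y)"
        using r W growth_antimono[of s r t] by (intro mult_right_mono) auto
      finally show ?thesis .
    qed
    then have "\<bar>Q_op Q r (U r t F) x\<bar> \<le> growth s t * ?W * (rate Q r x * (1 + V x) + c r * V x)"
      by (rule abs_Q_op_le[OF U_BM_V[OF F]])
    also have "\<dots> \<le> ?M"
      using r W K(2)[of r] b(2)[OF r] by (intro mult_left_mono add_mono mult_right_mono) auto
    finally show "\<bar>Q_op Q r (U r t F) x\<bar> \<le> ?M" .
  qed
qed

lemma hold_mult_le:
  assumes "\<bar>g\<bar> \<le> M" shows "\<bar>hold s r x * g\<bar> \<le> M"
proof -
  have "hold s r x * \<bar>g\<bar> \<le> 1 * M" using assms by (intro mult_mono) auto
  then show ?thesis by (simp add: abs_mult)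
qed

lemma U_first_jump:
  assumes F: "F \<in> BM_V V"
  shows "U s t F x = hold s t x * F x + (LINT r:{s..t}|lborel. hold s r x * Q_op Q r (U r t F) x)"
  using F
proof (induction F rule: BM_V_nonneg_diff_induct)
  case (nonneg F)
  note [measurable] = BM_V_measurable[OF nonneg(1)] Q_op_U_measurable[OF nonneg(1)]
  obtain M where M: "0 \<le> M" "\<And>r. r \<in> {s..t} \<Longrightarrow> \<bar>Q_op Q r (U r t F) x\<bar> \<le> M"
    using Q_op_U_bounded[OF nonneg(1)] by blast
  have Un: "0 \<le> U r t F y" for r y using nonneg(2) by (rule U_nonneg)
  have Qn: "0 \<le> Q_op Q r (U r t F) x" for r using Un by (rule Q_op_nonneg)
  have "ennreal (U s t F x) = ennreal (hold s t x) * ennreal (F x) +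
     (\<integral>\<^sup>+r\<in>{s..t}. ennreal (hold s r x) * (\<integral>\<^sup>+y. (\<integral>\<^sup>+z. F z \<partial>P r y t) \<partial>Q r x) \<partial>lborel)"
    using nonneg nn_integral_P_first_jump[of F s x t] by (simp add: ennreal_U)
  also have "(\<integral>\<^sup>+r\<in>{s..t}. ennreal (hold s r x) * (\<integral>\<^sup>+y. (\<integral>\<^sup>+z. F z \<partial>P r y t) \<partial>Q r x) \<partial>lborel) =
     (\<integral>\<^sup>+r\<in>{s..t}. ennreal (hold s r x * Q_op Q r (U r t F) x) \<partial>lborel)"
    using nonneg Un Qn by (simp add: ennreal_U[symmetric] ennreal_Q_op[symmetric] U_BM_V ennreal_mult)
  also have "\<dots> = ennreal (LINT r:{s..t}|lborel. hold s r x * Q_op Q r (U r t F) x)"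
  proof (rule nn_integral_interval_eq_set_integral[where M = M])
    show "0 \<le> hold s r x * Q_op Q r (U r t F) x \<and> hold s r x * Q_op Q r (U r t F) x \<le> M" if "r \<in> {s..t}" for r
      using hold_mult_le[OF M(2)[OF that], of s r x] Qn by auto
  qed measurable
  also have "ennreal (hold s t x) * ennreal (F x) + \<dots> =
      ennreal (hold s t x * F x + (LINT r:{s..t}|lborel. hold s r x * Q_op Q r (U r t F) x))"
    using nonneg(2) Qn
    by (simp add: ennreal_mult set_lebesgue_integral_def integral_nonneg_AE)
  finally show ?case
    using nonneg(2) Qn Un
    by (subst (asm) ennreal_inj)
       (auto simp: set_lebesgue_integral_def intro!: add_nonneg_nonneg integral_nonneg_AE)
next
  case (diff F G)
  have int: "set_integrable lborel {s..t} (\<lambda>r. hold s r x * Q_op Q r (U r t F) x)" if F: "F \<in> BM_V V" for F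
  proof -
    note [measurable] = Q_op_U_measurable[OF F]
    obtain M where M: "0 \<le> M" "\<And>r. r \<in> {s..t} \<Longrightarrow> \<bar>Q_op Q r (U r t F) x\<bar> \<le> M"
      using Q_op_U_bounded[OF F] by blast
    show ?thesis using M(2) by (intro set_integrable_bounded_interval[where M = M] hold_mult_le) measurable
  qed
  have "U r t (\<lambda>x. F x - G x) = (\<lambda>x. U r t F x - U r t G x)" for r
    using diff by (simp add: fun_eq_iff U_diff)
  then have eq: "hold s r x * Q_op Q r (U r t (\<lambda>x. F x - G x)) x =
      hold s r x * Q_op Q r (U r t F) x - hold s r x * Q_op Q r (U r t G) x" for r
    using diff by (simp add: Q_op_diff U_BM_V algebra_simps)
  have "(LINT r:{s..t}|lborel. hold s r x * Q_op Q r (U r t (\<lambda>x. F x - G x)) x) =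
      (LINT r:{s..t}|lborel. hold s r x * Q_op Q r (U r t F) x) -
      (LINT r:{s..t}|lborel. hold s r x * Q_op Q r (U r t G) x)"
    unfolding eq by (rule set_integral_diff(2)[OF int[OF diff(1)] int[OF diff(2)]])
  moreover have "U s t (\<lambda>x. F x - G x) x = U s t F x - U s t G x" using diff by (simp add: U_diff)
  ultimately show ?case
    using diff(3,4) by (simp add: algebra_simps)
qed

text \<open>By the semigroup property, \<open>U(u, t) F\<close> arises from \<open>U(v, t) F\<close> by the first-jump formula on the short
  interval \<open>[u, v]\<close>.\<close>

lemma U_lipschitz_backward:
  assumes F: "F \<in> BM_V V"
  obtains K where "\<And>u v. \<lbrakk>s \<le> u; u \<le> v; v \<le> t\<rbrakk> \<Longrightarrow> \<bar>U v t F x - U u t F x\<bar> \<le> K * (v - u)"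
proof -
  obtain K where K: "0 \<le> K" "\<And>r. r \<le> t \<Longrightarrow> rate Q r x \<le> K" using rate_bounded_on[of t x] by blast
  obtain M where M: "0 \<le> M" "\<And>r. r \<in> {s..t} \<Longrightarrow> \<bar>Q_op Q r (U r t F) x\<bar> \<le> M"
    using Q_op_U_bounded[OF F] by blast
  note [measurable] = Q_op_U_measurable[OF F]
  define B where "B = growth s t * weighted_norm V F * (1 + V x)"
  have W: "0 \<le> weighted_norm V F" by (rule weighted_norm_nonneg[OF V_nonneg F])
  show thesis
  proof (rule that[of "B * K + M"])
    fix u v assume uv: "s \<le> u" "u \<le> v" "v \<le> t"
    have "\<bar>U v t F x\<bar> \<le> growth v t * weighted_norm V F * (1 + V x)"
      by (rule abs_U_le[OF F BM_V_bound[OF V_nonneg F]])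
    also have "\<dots> \<le> B" unfolding B_def
      using uv W growth_antimono[of s v t] by (intro mult_right_mono) auto
    finally have B: "\<bar>U v t F x\<bar> \<le> B" .
    have "U u t F x = hold u v x * U v t F x + (LINT r:{u..v}|lborel. hold u r x * Q_op Q r (U r v (U v t F)) x)"
      using U_semigroup[OF F uv(2,3)] U_first_jump[OF U_BM_V[OF F, of v t], of u v x] by simp
    also have "(LINT r:{u..v}|lborel. hold u r x * Q_op Q r (U r v (U v t F)) x) =
        (LINT r:{u..v}|lborel. hold u r x * Q_op Q r (U r t F) x)"
      using uv by (intro set_lebesgue_integral_cong) (auto simp: U_semigroup[OF F])
    finally have eq: "U v t F x - U u t F x = (1 - hold u v x) * U v t F x -
        (LINT r:{u..v}|lborel. hold u r x * Q_op Q r (U r t F) x)" by (simp add: algebra_simps)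
    have "\<bar>(1 - hold u v x) * U v t F x\<bar> \<le> (K * (v - u)) * B"
      unfolding abs_mult using K uv B one_minus_hold_le[of u v x K] by (intro mult_mono) auto
    moreover have "\<bar>LINT r:{u..v}|lborel. hold u r x * Q_op Q r (U r t F) x\<bar> \<le> M * (v - u)"
      using uv M(2) by (intro abs_set_integral_interval_le hold_mult_le) (auto, measurable)
    ultimately show "\<bar>U v t F x - U u t F x\<bar> \<le> (B * K + M) * (v - u)"
      unfolding eq by (simp add: algebra_simps)
  qed
qed

lemma L_op_eq: "F \<in> BM_V V \<Longrightarrow> L_op Q t F x = Q_op Q t F x - rate Q t x * F x"
proof -
  assume F: "F \<in> BM_V V"
  interpret finite_measure "Q t x" by (rule finite_Q)
  have "L_op Q t F x = (\<integral>y. F y \<partial>Q t x) - (\<integral>y. F x \<partial>Q t x)"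
    unfolding L_op_def using integrable_Q[OF F] by (intro Bochner_Integration.integral_diff) auto
  then show ?thesis by (simp add: Q_op_def rate_def)
qed

text \<open>The first-jump formula in a form that can be differentiated: the starting time \<open>s\<close> occurs in the
  exponential factor and as an argument of an indefinite integral \<open>H\<close>, and nowhere else.\<close>

lemma U_integrating_factor:
  assumes F: "F \<in> BM_V V" and H: "\<And>u v. u \<le> v \<Longrightarrow> v \<le> t \<Longrightarrow> s0 \<le> u \<Longrightarrow>
     H v - H u = (LINT r:{u..v}|lborel. exp (- cum_rate x r) * Q_op Q r (U r t F) x)"
    and s: "s0 \<le> s" "s \<le> t"
  shows "U s t F x = exp (cum_rate x s) * (exp (- cum_rate x t) * F x + H t - H s)"
proof -
  have "(LINT r:{s..t}|lborel. hold s r x * Q_op Q r (U r t F) x) =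
      (LINT r:{s..t}|lborel. exp (cum_rate x s) * (exp (- cum_rate x r) * Q_op Q r (U r t F) x))"
    by (intro set_lebesgue_integral_cong) (auto simp: hold_eq_cum_rate exp_diff exp_minus field_simps)
  also have "\<dots> = exp (cum_rate x s) * (H t - H s)"
    using H[of s t] s by simp
  finally show ?thesis
    using U_first_jump[OF F, of s t x] s by (simp add: hold_eq_cum_rate exp_diff exp_minus divide_inverse algebra_simps)
qed

text \<open>With \<open>g = Q(s) u(s)\<close> the resulting derivative \<open>q(s) u(s) - Q(s) u(s)\<close> is \<open>- L(s) u(s)\<close>.\<close>

lemma has_derivative_integrating_factor:
  assumes H: "(H has_real_derivative exp (- cum_rate x s) * g) (at s within S)"
    and u: "u s = exp (cum_rate x s) * (b - H s)"
  shows "((\<lambda>s. exp (cum_rate x s) * (b - H s)) has_real_derivative rate Q s x * u s - g) (at s within S)"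
proof -
  have "((\<lambda>s. exp (cum_rate x s) * (b - H s)) has_real_derivative
      exp (cum_rate x s) * rate Q s x * (b - H s) + exp (cum_rate x s) * (- (exp (- cum_rate x s) * g))) (at s within S)"
    by (auto intro!: derivative_eq_intros H has_field_derivative_at_within[OF DERIV_cum_rate])
  also have "exp (cum_rate x s) * rate Q s x * (b - H s) + exp (cum_rate x s) * (- (exp (- cum_rate x s) * g)) =
      rate Q s x * u s - g"
    by (simp add: u exp_minus field_simps)
  finally show ?thesis .
qed

lemma cum_rate_measurable[measurable]: "cum_rate x \<in> borel_measurable borel"
  using DERIV_isCont[OF DERIV_cum_rate]
  by (auto intro!: borel_measurable_continuous_onI simp: continuous_on_eq_continuous_at)

lemma solves_backward_ae_U:
  assumes F: "F \<in> BM_V V"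
  shows "solves_backward_ae Q P F"
  unfolding solves_backward_ae_def
proof (intro allI impI conjI)
  fix t :: real and x assume t: "0 < t"
  obtain K where "\<And>u v. \<lbrakk>0 \<le> u; u \<le> v; v \<le> t\<rbrakk> \<Longrightarrow> \<bar>U v t F x - U u t F x\<bar> \<le> K * (v - u)"
    using U_lipschitz_backward[OF F] by blast
  then show "abs_continuous_on 0 t (\<lambda>s. U s t F x)" by (rule lipschitz_imp_abs_continuous_on)
  obtain M where M: "0 \<le> M" "\<And>r. r \<in> {0..t} \<Longrightarrow> \<bar>Q_op Q r (U r t F) x\<bar> \<le> M"
    using Q_op_U_bounded[OF F] by blast
  note [measurable] = Q_op_U_measurable[OF F]
  have "continuous_on UNIV (\<lambda>r. exp (- cum_rate x r))"
    using DERIV_isCont[OF DERIV_cum_rate] by (auto intro!: continuous_intros simp: continuous_on_eq_continuous_at)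
  then obtain E where E: "0 \<le> E" "\<And>r. r \<in> {0..t} \<Longrightarrow> \<bar>exp (- cum_rate x r)\<bar> \<le> E"
    using continuous_bounded_on_interval by blast
  \<comment> \<open>truncated to the interval where it is bounded\<close>
  define m where "m = (\<lambda>r. if r \<in> {0..t} then exp (- cum_rate x r) * Q_op Q r (U r t F) x else 0)"
  have m[measurable]: "m \<in> borel_measurable borel" unfolding m_def by measurable
  have mE: "\<bar>m r\<bar> \<le> E * M" for r
    using mult_mono[OF E(2)[of r] M(2)[of r] E(1)] M(1) E(1) by (auto simp: m_def abs_mult)
  obtain H where H: "\<And>u v. u \<le> v \<Longrightarrow> H v - H u = (LINT r:{u..v}|lborel. m r)"
     and dH: "AE s in lborel. (H has_real_derivative m s) (at s)"
    using bounded_measurable_AE_antiderivative[OF m mE] by blast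
  have Ueq: "U s t F x = exp (cum_rate x s) * (exp (- cum_rate x t) * F x + H t - H s)" if "s \<in> {0..t}" for s
  proof (rule U_integrating_factor[OF F, where ?s0.0 = 0])
    fix u v :: real assume uv: "u \<le> v" "v \<le> t" "0 \<le> u"
    show "H v - H u = (LINT r:{u..v}|lborel. exp (- cum_rate x r) * Q_op Q r (U r t F) x)"
      unfolding H[OF uv(1)] using uv by (intro set_lebesgue_integral_cong) (auto simp: m_def)
  qed (use that in auto)
  show "AE s in lborel. s \<in> {0..t} \<longrightarrow> integrable (Q s x) (U s t F) \<and>
     ((\<lambda>r. U r t F x) has_real_derivative - L_op Q s (U s t F) x) (at s within {0..t})"
    using dH
  proof eventually_elim
    case (elim s)
    show ?case
    proof (intro impI conjI integrable_Q U_BM_V F)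
      assume s: "s \<in> {0..t}"
      have "(H has_real_derivative exp (- cum_rate x s) * Q_op Q s (U s t F) x) (at s within {0..t})"
        using has_field_derivative_at_within[OF elim] s by (simp add: m_def)
      from has_derivative_integrating_factor[where u = "\<lambda>s. U s t F x", OF this Ueq[OF s]]
      have "((\<lambda>r. U r t F x) has_real_derivative rate Q s x * U s t F x - Q_op Q s (U s t F) x) (at s within {0..t})"
        by (rule has_field_derivative_transform_within[where d = 1]) (use s Ueq in auto)
      then show "((\<lambda>r. U r t F x) has_real_derivative - L_op Q s (U s t F) x) (at s within {0..t})"
        by (simp add: L_op_eq[OF U_BM_V[OF F]])
    qed
  qed
qed

lemma BM_V_of_rate_bound:
  assumes h: "h \<in> borel_measurable borel" and b: "\<And>y. \<bar>h y\<bar> \<le> M * rate Q r y" and M: "0 \<le> M"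
    and a: "\<And>y. rate Q r y \<le> a * V y" and a0: "0 \<le> a"
  shows "h \<in> BM_V V" "\<bar>h y\<bar> \<le> M * a * (1 + V y)"
proof -
  have "\<bar>h y\<bar> \<le> M * a * (1 + V y)" for y
  proof -
    have "\<bar>h y\<bar> \<le> M * (a * V y)" using b[of y] mult_left_mono[OF a[of y] M] by linarith
    also have "\<dots> \<le> M * (a * (1 + V y))" using M a0 by (intro mult_left_mono) auto
    finally show ?thesis by simp
  qed
  then show "h \<in> BM_V V" "\<bar>h y\<bar> \<le> M * a * (1 + V y)" using h by (auto intro: BM_V_I[where K = "M * a"])
qed

lemma Q_op_bounded_le:
  assumes F: "F \<in> BM_V V" and M: "\<And>y. \<bar>F y\<bar> \<le> M"
  shows "\<bar>Q_op Q r F x\<bar> \<le> M * rate Q r x"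
proof -
  interpret finite_measure "Q r x" by (rule finite_Q)
  have "\<bar>Q_op Q r F x\<bar> \<le> Q_op Q r (\<lambda>x. \<bar>F x\<bar>) x"
    unfolding Q_op_def by (rule integral_abs_bound)
  also have "\<dots> \<le> Q_op Q r (\<lambda>x. M) x"
    unfolding Q_op_def using M by (intro integral_mono integrable_abs integrable_Q F const_BM_V)
  finally show ?thesis by (simp add: Q_op_const mult.commute)
qed

text \<open>Neither \<open>q(r) F\<close> nor \<open>Q(r) F\<close> need be bounded, but both are dominated by the
  rate and hence by \<open>V\<close>.\<close>

lemma rate_dominated_BM_V:
  assumes F: "F \<in> BM"
  shows "(\<lambda>y. rate Q r y * F y) \<in> BM_V V" and "Q_op Q r F \<in> BM_V V"
    and "\<lbrakk>\<And>y. \<bar>F y\<bar> \<le> M; \<And>y. rate Q r y \<le> a * V y; 0 \<le> a\<rbrakk> \<Longrightarrow> \<bar>rate Q r y * F y\<bar> \<le> M * a * (1 + V y)"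
    and "\<lbrakk>\<And>y. \<bar>F y\<bar> \<le> M; \<And>y. rate Q r y \<le> a * V y; 0 \<le> a\<rbrakk> \<Longrightarrow> \<bar>Q_op Q r F y\<bar> \<le> M * a * (1 + V y)"
proof -
  have FV: "F \<in> BM_V V" using F by (rule BM_subset_BM_V)
  note [measurable] = BM_V_measurable[OF FV]
  have meas: "(\<lambda>y. rate Q r y * F y) \<in> borel_measurable borel" "Q_op Q r F \<in> borel_measurable borel"
    by (measurable, rule Q_op_measurable) (use FV in measurable)
  have bnd: "\<bar>rate Q r y * F y\<bar> \<le> M * rate Q r y" "\<bar>Q_op Q r F y\<bar> \<le> M * rate Q r y"
    if M: "\<And>y. \<bar>F y\<bar> \<le> M" for M y
    using mult_left_mono[OF M[of y] rate_nonneg[of r y]] Q_op_bounded_le[OF FV M] by (auto simp: abs_mult mult_ac)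
  obtain M' where M': "0 \<le> M'" "\<And>x. \<bar>F x\<bar> \<le> M'" using BM_obtain_bound[OF F] by blast
  obtain b where b: "b > 0" "\<And>r' y. r' \<le> r \<Longrightarrow> rate Q r' y \<le> b * V y" using rate_le[of r] by blast
  show "(\<lambda>y. rate Q r y * F y) \<in> BM_V V" "Q_op Q r F \<in> BM_V V"
    using BM_V_of_rate_bound(1)[OF meas(1) bnd(1)[OF M'(2)], of b]
      BM_V_of_rate_bound(1)[OF meas(2) bnd(2)[OF M'(2)], of b] M'(1) b by auto
  assume M: "\<And>y. \<bar>F y\<bar> \<le> M" and a: "\<And>y. rate Q r y \<le> a * V y" "0 \<le> a"
  have M0: "0 \<le> M" using M[of undefined] by linarith
  show "\<bar>rate Q r y * F y\<bar> \<le> M * a * (1 + V y)" "\<bar>Q_op Q r F y\<bar> \<le> M * a * (1 + V y)"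
    by (rule BM_V_of_rate_bound(2)[OF meas(1) bnd(1)[OF M] M0 a] BM_V_of_rate_bound(2)[OF meas(2) bnd(2)[OF M] M0 a])+
qed

text \<open>The moment bound makes all terms of the integrated forward equation finite, so that it holds between
  real numbers.\<close>

lemma U_forward_nonneg:
  assumes F: "F \<in> BM" and F0: "\<And>x. 0 \<le> F x" and st: "s \<le> t"
  shows "U s t F x + (LINT r:{s..t}|lborel. U s r (\<lambda>y. rate Q r y * F y) x) =
     F x + (LINT r:{s..t}|lborel. U s r (Q_op Q r F) x)"
    and "set_integrable lborel {s..t} (\<lambda>r. U s r (\<lambda>y. rate Q r y * F y) x)"
    and "set_integrable lborel {s..t} (\<lambda>r. U s r (Q_op Q r F) x)"
proof -
  have FV: "F \<in> BM_V V" using F by (rule BM_subset_BM_V)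
  note [measurable] = BM_V_measurable[OF FV]
  obtain M where M: "0 \<le> M" "\<And>x. \<bar>F x\<bar> \<le> M" using BM_obtain_bound[OF F] by blast
  obtain a where a: "a > 0" "\<And>r y. r \<le> t \<Longrightarrow> rate Q r y \<le> a * V y" using rate_le[of t] by blast
  have [measurable]: "(\<lambda>p. Q_op Q (R p) F (X p)) \<in> borel_measurable N"
    if [measurable]: "R \<in> borel_measurable N" "X \<in> borel_measurable N" for R X and N :: "'b measure"
    by (rule Q_op_measurable) (use FV in measurable)
  note BV = rate_dominated_BM_V(1,2)[OF F]
  have nn: "0 \<le> rate Q r y * F y" "0 \<le> Q_op Q r F y" for r y
    using F0 Q_op_nonneg by auto
  let ?K = "growth s t * (M * a) * (1 + V x)"
  have Ubnd: "\<bar>U s r (\<lambda>y. rate Q r y * F y) x\<bar> \<le> ?K" "\<bar>U s r (Q_op Q r F) x\<bar> \<le> ?K"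
    if r: "r \<in> {s..t}" for r
  proof -
    have ra: "rate Q r y \<le> a * V y" for y using r a by simp
    have gm: "growth s r * (M * a) * (1 + V x) \<le> ?K"
      using r M(1) a(1) growth_mono[of s r t] by (intro mult_right_mono) auto
    have "\<bar>U s r (\<lambda>y. rate Q r y * F y) x\<bar> \<le> growth s r * (M * a) * (1 + V x)"
      using rate_dominated_BM_V(3)[OF F M(2) ra] a(1) by (intro abs_U_le BV) auto
    then show "\<bar>U s r (\<lambda>y. rate Q r y * F y) x\<bar> \<le> ?K" using gm by linarith
    have "\<bar>U s r (Q_op Q r F) x\<bar> \<le> growth s r * (M * a) * (1 + V x)"
      using rate_dominated_BM_V(4)[OF F M(2) ra] a(1) by (intro abs_U_le BV) auto
    then show "\<bar>U s r (Q_op Q r F) x\<bar> \<le> ?K" using gm by linarith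
  qed
  have Umeas[measurable]: "(\<lambda>r. U s r (\<lambda>y. rate Q r y * F y) x) \<in> borel_measurable borel"
    "(\<lambda>r. U s r (Q_op Q r F) x) \<in> borel_measurable borel"
    using BV by (auto intro!: U_measurable simp: case_prod_unfold)
  show "set_integrable lborel {s..t} (\<lambda>r. U s r (\<lambda>y. rate Q r y * F y) x)"
     "set_integrable lborel {s..t} (\<lambda>r. U s r (Q_op Q r F) x)"
    using Ubnd
    by (auto intro!: set_integrable_bounded_interval[where M = ?K] Umeas)
  have Unn: "0 \<le> U s r (\<lambda>y. rate Q r y * F y) x" "0 \<le> U s r (Q_op Q r F) x" for r
    using nn by (auto intro: U_nonneg)
  have I: "(\<integral>\<^sup>+r\<in>{s..t}. ennreal (U s r (\<lambda>y. rate Q r y * F y) x) \<partial>lborel) =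
      ennreal (LINT r:{s..t}|lborel. U s r (\<lambda>y. rate Q r y * F y) x)"
    "(\<integral>\<^sup>+r\<in>{s..t}. ennreal (U s r (Q_op Q r F) x) \<partial>lborel) =
      ennreal (LINT r:{s..t}|lborel. U s r (Q_op Q r F) x)"
    using Ubnd Unn
    by (auto intro!: nn_integral_interval_eq_set_integral[where M = ?K] Umeas
        simp: abs_le_iff)
  have "ennreal (U s t F x) + (\<integral>\<^sup>+r\<in>{s..t}. ennreal (U s r (\<lambda>y. rate Q r y * F y) x) \<partial>lborel) =
    ennreal (F x) + (\<integral>\<^sup>+r\<in>{s..t}. ennreal (U s r (Q_op Q r F) x) \<partial>lborel)"
    using P_forward_nn[of "\<lambda>x. ennreal (F x)" s t x] st
    by (simp add: ennreal_U FV BV F0 nn ennreal_Q_op ennreal_mult)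
  then show "U s t F x + (LINT r:{s..t}|lborel. U s r (\<lambda>y. rate Q r y * F y) x) =
     F x + (LINT r:{s..t}|lborel. U s r (Q_op Q r F) x)"
    unfolding I using Unn F0 U_nonneg[of F s t x]
    by (simp add: ennreal_plus[symmetric] set_lebesgue_integral_def integral_nonneg_AE del: ennreal_plus)
qed

lemma L_op_BM_V:
  assumes F: "F \<in> BM" shows "L_op Q r F \<in> BM_V V"
    and "\<lbrakk>\<And>y. \<bar>F y\<bar> \<le> M; \<And>y. rate Q r y \<le> a * V y; 0 \<le> a\<rbrakk> \<Longrightarrow> \<bar>L_op Q r F y\<bar> \<le> 2 * M * a * (1 + V y)"
proof -
  have L: "L_op Q r F = (\<lambda>y. Q_op Q r F y - rate Q r y * F y)"
    using L_op_eq[OF BM_subset_BM_V[OF F]] by (simp add: fun_eq_iff)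
  show "L_op Q r F \<in> BM_V V"
    unfolding L using BM_V_lincomb[OF rate_dominated_BM_V(2,1)[OF F], of 1 r "-1" r] by simp
  assume A: "\<And>y. \<bar>F y\<bar> \<le> M" "\<And>y. rate Q r y \<le> a * V y" "0 \<le> a"
  have "\<bar>rate Q r y * F y\<bar> \<le> M * a * (1 + V y)" "\<bar>Q_op Q r F y\<bar> \<le> M * a * (1 + V y)"
    by (rule rate_dominated_BM_V(3)[OF F A] rate_dominated_BM_V(4)[OF F A])+
  then show "\<bar>L_op Q r F y\<bar> \<le> 2 * M * a * (1 + V y)"
    unfolding L by linarith
qed

lemma U_L_op_measurable:
  assumes F: "F \<in> BM" shows "(\<lambda>r. U s r (L_op Q r F) x) \<in> borel_measurable borel"
proof (rule U_measurable)
  have FV: "F \<in> BM_V V" using F by (rule BM_subset_BM_V)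
  note [measurable] = BM_V_measurable[OF FV]
  have [measurable]: "(\<lambda>p. Q_op Q (R p) F (X p)) \<in> borel_measurable N"
    if [measurable]: "R \<in> borel_measurable N" "X \<in> borel_measurable N" for R X and N :: "'b measure"
    by (rule Q_op_measurable) (use FV in measurable)
  show "(\<lambda>(p, y). L_op Q p F y) \<in> borel_measurable (borel \<Otimes>\<^sub>M borel)"
    unfolding L_op_eq[OF FV] by measurable
qed (use L_op_BM_V[OF F] in auto)

text \<open>Adding a constant to \<open>F\<close> changes neither \<open>L(r) F\<close> nor \<open>U(s, t) F - F\<close>, so \<open>F\<close> may be taken
  nonnegative.\<close>

lemma U_forward:
  assumes F: "F \<in> BM" and st: "s \<le> t"
  shows "U s t F x = F x + (LINT r:{s..t}|lborel. U s r (L_op Q r F) x)"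
proof -
  obtain M where M: "0 \<le> M" "\<And>x. \<bar>F x\<bar> \<le> M" using BM_obtain_bound[OF F] by blast
  define G where "G = (\<lambda>x. F x + M)"
  have FV: "F \<in> BM_V V" using F by (rule BM_subset_BM_V)
  have G: "G \<in> BM"
  proof -
    have "\<bar>G x\<bar> \<le> 2 * M" for x using M(2)[of x] M(1) by (simp add: G_def)
    then have "bounded (range G)" unfolding bounded_iff by auto
    moreover have "G \<in> borel_measurable borel"
      unfolding G_def using BM_V_measurable[OF FV] by measurable
    ultimately show ?thesis by (simp add: BM_def)
  qed
  have G0: "0 \<le> G x" for x using M(2)[of x] by (simp add: G_def)
  have GV: "G \<in> BM_V V" using G by (rule BM_subset_BM_V)
  have UG: "U s t G x = U s t F x + M"
  proof -
    interpret prob_space "P s x t" by (rule prob_space_P)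
    show ?thesis using integrable_P[OF FV, of s x t] prob_space by (simp add: kernel_op_def G_def)
  qed
  have LG: "L_op Q r F = (\<lambda>y. Q_op Q r G y - rate Q r y * G y)" for r
  proof -
    have "L_op Q r F = L_op Q r G" by (simp add: L_op_def G_def fun_eq_iff)
    then show ?thesis using L_op_eq[OF GV] by (simp add: fun_eq_iff)
  qed
  note BV = rate_dominated_BM_V(1,2)[OF G]
  have "U s r (L_op Q r F) x = U s r (Q_op Q r G) x - U s r (\<lambda>y. rate Q r y * G y) x" for r
    unfolding LG using BV by (intro U_diff) auto
  then have "(LINT r:{s..t}|lborel. U s r (L_op Q r F) x) =
      (LINT r:{s..t}|lborel. U s r (Q_op Q r G) x) - (LINT r:{s..t}|lborel. U s r (\<lambda>y. rate Q r y * G y) x)"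
    using U_forward_nonneg(2,3)[OF G G0 st] by (simp add: set_integral_diff)
  then show ?thesis using U_forward_nonneg(1)[OF G G0 st, of x] UG by (simp add: G_def)
qed

lemma solves_forward_U:
  assumes F: "F \<in> BM"
  shows "solves_forward Q P F"
  unfolding solves_forward_def
proof (intro allI impI)
  fix s :: real and x
  define f where "f = (\<lambda>r. U s r (L_op Q r F) x)"
  have f[measurable]: "f \<in> borel_measurable borel" unfolding f_def by (rule U_L_op_measurable[OF F])
  obtain M where M: "0 \<le> M" "\<And>x. \<bar>F x\<bar> \<le> M" using BM_obtain_bound[OF F] by blast
  have f_bnd: "\<exists>K. \<forall>r\<in>{s..T}. \<bar>f r\<bar> \<le> K" for T
  proof -
    obtain a where a: "a > 0" "\<And>r y. r \<le> T \<Longrightarrow> rate Q r y \<le> a * V y" using rate_le[of T] by blast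
    have "\<bar>f r\<bar> \<le> growth s T * (2 * M * a) * (1 + V x)" if r: "r \<in> {s..T}" for r
    proof -
      have "\<bar>f r\<bar> \<le> growth s r * (2 * M * a) * (1 + V x)"
        unfolding f_def using r a M by (intro abs_U_le L_op_BM_V F) auto
      also have "\<dots> \<le> growth s T * (2 * M * a) * (1 + V x)"
        using r M(1) a(1) growth_mono[of s r T] by (intro mult_right_mono) auto
      finally show ?thesis .
    qed
    then show ?thesis by blast
  qed
  have U_eq: "U s t F x = F x + (LINT r:{s..t}|lborel. f r)" if "s \<le> t" for t
    unfolding f_def by (rule U_forward[OF F that])
  show "(\<forall>T>s. abs_continuous_on s T (\<lambda>t. U s t F x)) \<and>
      (AE t in lborel. s \<le> t \<longrightarrow> integrable (P s x t) (L_op Q t F) \<and>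
        ((\<lambda>r. U s r F x) has_real_derivative U s t (L_op Q t F) x) (at t within {s..}))"
  proof (intro conjI allI impI)
    fix T assume T: "s < T"
    obtain K where K: "\<And>r. r \<in> {s..T} \<Longrightarrow> \<bar>f r\<bar> \<le> K" using f_bnd by blast
    show "abs_continuous_on s T (\<lambda>t. U s t F x)"
    proof (rule lipschitz_imp_abs_continuous_on[where K = K])
      fix u v assume uv: "s \<le> u" "u \<le> v" "v \<le> T"
      have "U s v F x - U s u F x = (LINT r:{u..v}|lborel. f r)"
        using uv K U_eq[of u] U_eq[of v]
          set_integral_interval_split[OF set_integrable_bounded_interval[OF f], of s v K u] by auto
      then show "\<bar>U s v F x - U s u F x\<bar> \<le> K * (v - u)"
        using uv K abs_set_integral_interval_le[OF f, of u v K] by auto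
    qed
  next
    have "AE t in lborel. t \<in> {s..<s + real n} \<longrightarrow> ((\<lambda>r. U s r F x) has_real_derivative f t) (at t within {s..})" for n
    proof -
      obtain K where K: "\<And>r. r \<in> {s..s + real n} \<Longrightarrow> \<bar>f r\<bar> \<le> K" using f_bnd by blast
      define m where "m = (\<lambda>r. if r \<in> {s..s + real n} then f r else 0)"
      have m[measurable]: "m \<in> borel_measurable borel" unfolding m_def by measurable
      have mK: "\<bar>m r\<bar> \<le> K" for r using K[of r] K[of s] by (auto simp: m_def)
      obtain H where H: "\<And>u v. u \<le> v \<Longrightarrow> H v - H u = (LINT r:{u..v}|lborel. m r)"
        and dH: "AE s in lborel. (H has_real_derivative m s) (at s)"
        using bounded_measurable_AE_antiderivative[OF m mK] by blast
      show ?thesis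
        using dH
      proof eventually_elim
        case (elim t)
        show ?case
        proof
          assume t: "t \<in> {s..<s + real n}"
          have "((\<lambda>r. F x + (H r - H s)) has_real_derivative f t) (at t within {s..})"
            using has_field_derivative_at_within[OF elim] t
            by (auto intro!: derivative_eq_intros simp: m_def)
          then show "((\<lambda>r. U s r F x) has_real_derivative f t) (at t within {s..})"
          proof (rule has_field_derivative_transform_within[where d = "s + real n - t"])
            fix r assume r: "r \<in> {s..}" "dist r t < s + real n - t"
            have "H r - H s = (LINT r:{s..r}|lborel. f r)"
              unfolding H[of s r, OF r(1)[unfolded atLeast_iff]]
              using r by (intro set_lebesgue_integral_cong) (auto simp: m_def dist_real_def)
            then show "F x + (H r - H s) = U s r F x" using U_eq[of r] r by simp
          qed (use t in auto)
        qed
      qed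
    qed
    then have "AE t in lborel. \<forall>n. t \<in> {s..<s + real n} \<longrightarrow> ((\<lambda>r. U s r F x) has_real_derivative f t) (at t within {s..})"
      by (subst AE_all_countable) blast
    then show "AE t in lborel. s \<le> t \<longrightarrow> integrable (P s x t) (L_op Q t F) \<and>
        ((\<lambda>r. U s r F x) has_real_derivative U s t (L_op Q t F) x) (at t within {s..})"
    proof eventually_elim
      case (elim t)
      obtain n :: nat where "t - s < real n" using reals_Archimedean2 by blast
      then show ?case
        using elim[rule_format, of n] integrable_P[OF L_op_BM_V(1)[OF F]] by (auto simp: f_def)
    qed
  qed
qed

end

section \<open>Monotone approximation and the Feller property\<close>

lemma continuous_on_slices:
  assumes "continuous_on UNIV (\<lambda>(u, x). f u x)"
  shows "continuous_on UNIV (\<lambda>u. f u x)" "continuous_on UNIV (f u)"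
proof -
  show "continuous_on UNIV (\<lambda>u. f u x)"
    using continuous_on_compose2[OF assms, of UNIV "\<lambda>u. (u, x)"] by (simp add: continuous_intros)
  show "continuous_on UNIV (f u)"
    using continuous_on_compose2[OF assms, of UNIV "\<lambda>x. (u, x)"] by (simp add: continuous_intros)
qed

context lyapunov_kernel
begin

lemma continuous_hold: "continuous_on UNIV (hold r t)"
proof -
  obtain a where a: "a > 0" "\<And>r y. r \<le> t \<Longrightarrow> rate Q r y \<le> a * V y" using rate_le[of t] by blast
  have "continuous_on UNIV (\<lambda>x. LINT u:{r..t}|lborel. rate Q u x)"
    by (rule continuous_on_interval_integral[where B = "\<lambda>x. a * V x"])
       (use a continuous_V in \<open>auto intro!: continuous_intros continuous_on_slices(2)[OF continuous_rate]\<close>)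
  then show ?thesis unfolding hold_def by (intro continuous_intros)
qed

text \<open>The hypothesis on \<open>Q\<close> concerns a fixed function. A function that moves Lipschitz continuously in the
  supremum norm changes the integral by at most \<open>L\<close> times the elapsed time and the rate.\<close>

lemma continuous_Q_op_moving:
  assumes H: "\<And>u. H u \<in> Cb" and lip: "\<And>u u' y. \<bar>H u y - H u' y\<bar> \<le> L * \<bar>u - u'\<bar>"
  shows "continuous_on UNIV (\<lambda>(u, x). Q_op Q u (H u) x)"
  unfolding continuous_on_def
proof (intro ballI, clarify)
  fix u0 :: real and x0 :: 'a
  let ?d = "\<lambda>p. Q_op Q (fst p) (\<lambda>y. H (fst p) y - H u0 y) (snd p)"
  have "(?d \<longlongrightarrow> 0) (at (u0, x0))"
  proof (rule Lim_null_comparison)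
    show "\<forall>\<^sub>F p in at (u0, x0). norm (?d p) \<le> L * \<bar>fst p - u0\<bar> * rate Q (fst p) (snd p)"
      using Q_op_bounded_le[OF BM_V_lincomb[OF Cb_BM_V[OF H] Cb_BM_V[OF H], of 1 _ "-1"]] lip
      by (intro always_eventually) auto
    have "isCont (\<lambda>p. rate Q (fst p) (snd p)) (u0, x0)"
      using continuous_rate by (simp add: continuous_on_eq_continuous_at case_prod_unfold)
    then have "((\<lambda>p. L * \<bar>fst p - u0\<bar> * rate Q (fst p) (snd p)) \<longlongrightarrow> L * \<bar>u0 - u0\<bar> * rate Q u0 x0) (at (u0, x0))"
      by (intro tendsto_intros) (auto simp: isCont_def intro!: tendsto_eq_intros)
    then show "((\<lambda>p. L * \<bar>fst p - u0\<bar> * rate Q (fst p) (snd p)) \<longlongrightarrow> 0) (at (u0, x0))" by simp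
  qed
  moreover have "((\<lambda>p. Q_op Q (fst p) (H u0) (snd p)) \<longlongrightarrow> Q_op Q u0 (H u0) x0) (at (u0, x0))"
    using continuous_Q_op[OF Cb_C_V[OF H, of u0]]
    by (simp add: continuous_on_def case_prod_unfold)
  ultimately have "((\<lambda>p. ?d p + Q_op Q (fst p) (H u0) (snd p)) \<longlongrightarrow> 0 + Q_op Q u0 (H u0) x0) (at (u0, x0))"
    by (rule tendsto_add)
  then show "((\<lambda>(u, x). Q_op Q u (H u) x) \<longlongrightarrow> Q_op Q u0 (H u0) x0) (at (u0, x0))"
    by (simp add: Q_op_diff Cb_BM_V[OF H] case_prod_unfold)
qed

text \<open>Vanishes exactly where \<open>V \<ge> n + 1\<close>, and is \<open>1\<close> where \<open>V \<le> n\<close>.\<close>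

definition cutoff :: "nat \<Rightarrow> 'a \<Rightarrow> real" where
  "cutoff n x = max 0 (min 1 (real n + 1 - V x))"

lemma cutoff_nonneg[simp]: "0 \<le> cutoff n x" and cutoff_le_1[simp]: "cutoff n x \<le> 1"
  and cutoff_mono: "n \<le> m \<Longrightarrow> cutoff n x \<le> cutoff m x"
  and cutoff_eq_0: "real n + 1 \<le> V x \<Longrightarrow> cutoff n x = 0"
  and cutoff_eq_1: "V x \<le> real n \<Longrightarrow> cutoff n x = 1"
  by (auto simp: cutoff_def)

lemma continuous_cutoff: "continuous_on UNIV (cutoff n)"
  unfolding cutoff_def using continuous_V by (intro continuous_intros)

text \<open>The Picard iteration of the first-jump recursion from \<open>0\<close>, cut off more and more mildly. The cut-off
  grows with the iteration, so a single index gives an increasing sequence with limit \<open>U(r, t) F\<close>.\<close>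

primrec approx :: "('a \<Rightarrow> real) \<Rightarrow> nat \<Rightarrow> real \<Rightarrow> real \<Rightarrow> 'a \<Rightarrow> real" where
  "approx F 0 = (\<lambda>r t x. 0)"
| "approx F (Suc n) = (\<lambda>r t x. cutoff n x *
     (hold r t x * F x + (LINT u:{r..t}|lborel. hold r u x * Q_op Q u (approx F n u t) x)))"

declare approx.simps(2)[simp del]

context
  fixes F :: "'a \<Rightarrow> real" and M :: real
  assumes F_cont: "continuous_on UNIV F" and F_nonneg: "\<And>x. 0 \<le> F x" and F_le: "\<And>x. F x \<le> M"
begin

lemma test_bound_nonneg: "0 \<le> M"
  using F_nonneg[of undefined] F_le[of undefined] by simp

lemma test_function_Cb: "F \<in> Cb"
  using F_cont F_nonneg F_le by (auto simp: Cb_def bounded_iff intro!: exI[of _ M])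

text \<open>The invariant of the iteration. The Lipschitz bound in both times, uniform in space, is what the
  continuity of \<open>Q(u)\<close> applied to a moving function requires in the next step.\<close>

definition regular :: "nat \<Rightarrow> bool" where
  "regular n \<longleftrightarrow> (\<forall>r t. continuous_on UNIV (approx F n r t)) \<and>
     (\<forall>r t x. 0 \<le> approx F n r t x \<and> approx F n r t x \<le> M) \<and>
     (\<forall>r t x. real n \<le> V x \<longrightarrow> approx F n r t x = 0) \<and>
     (\<forall>T. \<exists>L\<ge>0. \<forall>r r' t t' x. t \<le> T \<longrightarrow> t' \<le> T \<longrightarrow>
        \<bar>approx F n r t x - approx F n r' t' x\<bar> \<le> L * (\<bar>r - r'\<bar> + \<bar>t - t'\<bar>))"

lemma regularD:
  assumes "regular n"
  shows "continuous_on UNIV (approx F n r t)" "0 \<le> approx F n r t x" "approx F n r t x \<le> M"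
    "real n \<le> V x \<Longrightarrow> approx F n r t x = 0"
  using assms by (auto simp: regular_def)

lemma regular_lipschitz:
  assumes "regular n"
  obtains L where "0 \<le> L" "\<And>r r' t t' x. \<lbrakk>t \<le> T; t' \<le> T\<rbrakk> \<Longrightarrow>
        \<bar>approx F n r t x - approx F n r' t' x\<bar> \<le> L * (\<bar>r - r'\<bar> + \<bar>t - t'\<bar>)"
  using assms unfolding regular_def by meson

lemma regular_Cb: "regular n \<Longrightarrow> approx F n r t \<in> Cb"
  by (auto simp: Cb_def regularD bounded_iff intro!: exI[of _ M])

lemma regular_Q_op:
  assumes n: "regular n"
  shows "continuous_on UNIV (\<lambda>(u, x). Q_op Q u (approx F n u t) x)"
    and "0 \<le> Q_op Q u (approx F n u t) x" and "Q_op Q u (approx F n u t) x \<le> M * rate Q u x"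
proof -
  obtain L where "0 \<le> L" "\<And>r r' t' t'' x. \<lbrakk>t' \<le> t; t'' \<le> t\<rbrakk> \<Longrightarrow>
        \<bar>approx F n r t' x - approx F n r' t'' x\<bar> \<le> L * (\<bar>r - r'\<bar> + \<bar>t' - t''\<bar>)"
    using regular_lipschitz[OF n, of t] by metis
  from this(2)[of t t] show "continuous_on UNIV (\<lambda>(u, x). Q_op Q u (approx F n u t) x)"
    by (intro continuous_Q_op_moving[where L = L] regular_Cb n) auto
  show "0 \<le> Q_op Q u (approx F n u t) x" by (intro Q_op_nonneg regularD(2) n)
  show "Q_op Q u (approx F n u t) x \<le> M * rate Q u x"
    using Q_op_bounded_le[OF Cb_BM_V[OF regular_Cb[OF n]], of u t M u x] regularD(2,3)[OF n] by auto
qed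

definition uncut :: "nat \<Rightarrow> real \<Rightarrow> real \<Rightarrow> 'a \<Rightarrow> real" where
  "uncut n r t x = hold r t x * F x + (LINT u:{r..t}|lborel. hold r u x * Q_op Q u (approx F n u t) x)"

lemma approx_Suc_eq: "approx F (Suc n) r t x = cutoff n x * uncut n r t x"
  by (simp add: uncut_def approx.simps(2))

lemma uncut_trivial: "t \<le> r \<Longrightarrow> uncut n r t x = F x"
proof (cases "r = t")
  case True
  have "(LINT u:{t..t}|lborel. g u) = 0" for g :: "real \<Rightarrow> real"
  proof -
    have "AE u in lborel. indicator {t..t} u *\<^sub>R g u = 0"
      using AE_lborel_singleton[of t] by eventually_elim (simp add: indicator_def)
    then show ?thesis unfolding set_lebesgue_integral_def by (intro integral_eq_zero_AE)
  qed
  then show ?thesis using True by (simp add: uncut_def)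
qed (simp add: uncut_def hold_empty_interval set_lebesgue_integral_def)

lemma integrand_measurable[measurable]:
  assumes "regular n"
  shows "(\<lambda>u. Q_op Q u (approx F n u t) x) \<in> borel_measurable borel"
  using continuous_on_slices(1)[OF regular_Q_op(1)[OF assms]] by (rule borel_measurable_continuous_onI)

lemma integrand_nonneg: "regular n \<Longrightarrow> 0 \<le> hold r u x * Q_op Q u (approx F n u t) x"
  using regular_Q_op(2) by simp

lemma integrand_bounds:
  assumes n: "regular n" and K: "rate Q u x \<le> K"
  shows "hold r u x * Q_op Q u (approx F n u t) x \<le> M * K"
    "\<bar>hold r u x * Q_op Q u (approx F n u t) x\<bar> \<le> M * K"
proof -
  have "Q_op Q u (approx F n u t) x \<le> M * K"
    using regular_Q_op(3)[OF n, of u t x] mult_left_mono[OF K test_bound_nonneg] by linarith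
  then show "\<bar>hold r u x * Q_op Q u (approx F n u t) x\<bar> \<le> M * K"
    using regular_Q_op(2)[OF n, of u t x] by (intro hold_mult_le) simp
  then show "hold r u x * Q_op Q u (approx F n u t) x \<le> M * K" by simp
qed

lemma integrand_integrable:
  assumes n: "regular n"
  shows "set_integrable lborel {r..t'} (\<lambda>u. hold s u x * Q_op Q u (approx F n u t) x)"
proof -
  note integrand_measurable[OF n, measurable]
  obtain K where "0 \<le> K" "\<And>r. r \<le> t' \<Longrightarrow> rate Q r x \<le> K" using rate_bounded_on[of t' x] by blast
  then show ?thesis
    by (intro set_integrable_bounded_interval[where M = "M * K"] integrand_bounds n) auto
qed

lemma uncut_bounds:
  assumes n: "regular n" shows "0 \<le> uncut n r t x" "uncut n r t x \<le> M"
proof -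
  show "0 \<le> uncut n r t x"
    using F_nonneg integrand_nonneg[OF n]
    by (auto simp: uncut_def set_lebesgue_integral_def intro!: add_nonneg_nonneg integral_nonneg_AE)
  show "uncut n r t x \<le> M"
  proof (cases "r \<le> t")
    case True
    obtain K where K: "0 \<le> K" "\<And>r. r \<le> t \<Longrightarrow> rate Q r x \<le> K" using rate_bounded_on[of t x] by blast
    have "(LINT u:{r..t}|lborel. hold r u x * Q_op Q u (approx F n u t) x) \<le>
        (LINT u:{r..t}|lborel. M * (hold r u x * rate Q u x))"
    proof (intro set_integral_mono integrand_integrable n set_integrable_mult_right set_integrable_bounded_interval[where M = K])
      fix u
      show "hold r u x * Q_op Q u (approx F n u t) x \<le> M * (hold r u x * rate Q u x)"
        using mult_left_mono[OF regular_Q_op(3)[OF n, of u t x], of "hold r u x"] by (simp add: mult_ac)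
      show "\<bar>hold r u x * rate Q u x\<bar> \<le> K" if "u \<in> {r..t}"
        using K that by (intro hold_mult_le) auto
    qed measurable
    also have "\<dots> = M * (1 - hold r t x)" using True by (simp add: hold_rate_integral)
    finally have "uncut n r t x \<le> hold r t x * M + M * (1 - hold r t x)"
      unfolding uncut_def by (intro add_mono mult_left_mono F_le) auto
    then show ?thesis by (simp add: algebra_simps)
  next
    case False
    then show ?thesis using F_le by (simp add: uncut_trivial)
  qed
qed

lemma continuous_uncut:
  assumes n: "regular n" shows "continuous_on UNIV (uncut n r t)"
proof -
  note integrand_measurable[OF n, measurable]
  obtain a where a: "a > 0" "\<And>r y. r \<le> t \<Longrightarrow> rate Q r y \<le> a * V y" using rate_le[of t] by blast
  have "continuous_on UNIV (\<lambda>x. LINT u:{r..t}|lborel. hold r u x * Q_op Q u (approx F n u t) x)"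
  proof (rule continuous_on_interval_integral[where B = "\<lambda>x. M * (a * V x)"])
    show "continuous_on UNIV (\<lambda>x. hold r u x * Q_op Q u (approx F n u t) x)" for u
      by (intro continuous_intros continuous_hold continuous_on_slices(2)[OF regular_Q_op(1)[OF n]])
  qed (use a continuous_V in \<open>auto intro!: continuous_intros integrand_bounds n\<close>)
  then show ?thesis
    unfolding uncut_def by (intro continuous_intros continuous_hold F_cont)
qed

lemma uncut_split:
  assumes n: "regular n" and rt: "r \<le> r'" "r' \<le> t"
  shows "uncut n r t x = hold r r' x * uncut n r' t x +
     (LINT u:{r..r'}|lborel. hold r u x * Q_op Q u (approx F n u t) x)"
proof -
  have "(LINT u:{r'..t}|lborel. hold r u x * Q_op Q u (approx F n u t) x) =
     (LINT u:{r'..t}|lborel. hold r r' x * (hold r' u x * Q_op Q u (approx F n u t) x))"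
  proof (intro set_lebesgue_integral_cong allI impI)
    fix u assume "u \<in> {r'..t}"
    then show "hold r u x * Q_op Q u (approx F n u t) x = hold r r' x * (hold r' u x * Q_op Q u (approx F n u t) x)"
      using hold_trans[OF rt(1), of u x] by simp
  qed simp
  then show ?thesis
    using hold_trans[OF rt, of x] set_integral_interval_split[OF integrand_integrable[OF n] rt, of r x t]
    by (simp add: uncut_def algebra_simps)
qed

text \<open>The two values differ only through a first jump during \<open>[r, r']\<close>, whose probability is at most
  \<open>K (r' - r)\<close>.\<close>

lemma uncut_lipschitz_start:
  assumes n: "regular n" and K: "\<And>u. u \<le> t \<Longrightarrow> rate Q u x \<le> K" and rt: "r \<le> r'" "r' \<le> t"
  shows "\<bar>uncut n r t x - uncut n r' t x\<bar> \<le> 2 * K * M * (r' - r)"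
proof -
  note integrand_measurable[OF n, measurable]
  have K0: "0 \<le> K" using K[of t] rate_nonneg[of t x] by linarith
  have "\<bar>(hold r r' x - 1) * uncut n r' t x\<bar> \<le> (K * (r' - r)) * M"
    unfolding abs_mult using uncut_bounds[OF n] one_minus_hold_le[of r r' x K] K K0 rt
    by (intro mult_mono) auto
  moreover have "\<bar>LINT u:{r..r'}|lborel. hold r u x * Q_op Q u (approx F n u t) x\<bar> \<le> M * K * (r' - r)"
    using K rt by (intro abs_set_integral_interval_le integrand_bounds n) auto
  ultimately show ?thesis
    unfolding uncut_split[OF n rt] by (simp add: algebra_simps)
qed

text \<open>The constant \<open>L\<close> of the previous iterate is inherited with factor at most \<open>1\<close>, since
  \<open>\<integral> e(r, u, x) q(u, x) du = 1 - e(r, t, x) \<le> 1\<close>; hence the constants do not depend on the length of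
  \<open>[r, t]\<close>.\<close>

lemma uncut_lipschitz_end:
  assumes n: "regular n" and K: "\<And>u. u \<le> t' \<Longrightarrow> rate Q u x \<le> K" and rt: "r \<le> t" "t \<le> t'"
    and L: "0 \<le> L" "\<And>u y. \<bar>approx F n u t' y - approx F n u t y\<bar> \<le> L * (t' - t)"
  shows "\<bar>uncut n r t' x - uncut n r t x\<bar> \<le> (2 * K * M + L) * (t' - t)"
proof -
  note integrand_measurable[OF n, measurable]
  let ?g = "\<lambda>t u. Q_op Q u (approx F n u t) x"
  let ?D = "LINT u:{r..t}|lborel. hold r u x * ?g t' u - hold r u x * ?g t u"
  have K0: "0 \<le> K" using K[of t'] rate_nonneg[of t' x] by linarith
  have D: "(LINT u:{r..t}|lborel. hold r u x * ?g t' u) - (LINT u:{r..t}|lborel. hold r u x * ?g t u) = ?D"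
    by (intro set_integral_diff(2)[symmetric] integrand_integrable n)
  have eq: "uncut n r t' x - uncut n r t x =
     (hold r t' x - hold r t x) * F x + (LINT u:{t..t'}|lborel. hold r u x * ?g t' u) + ?D"
    unfolding D[symmetric] uncut_def
    using set_integral_interval_split[OF integrand_integrable[OF n] rt, of r x t'] by (simp add: algebra_simps)
  have "\<bar>(hold r t' x - hold r t x) * F x\<bar> \<le> (K * (t' - t)) * M"
  proof -
    have "\<bar>hold r t' x - hold r t x\<bar> = hold r t x * (1 - hold t t' x)"
    proof -
      have "hold r t' x - hold r t x = - (hold r t x * (1 - hold t t' x))"
        using hold_trans[OF rt, of x] by (simp add: right_diff_distrib)
      moreover have "0 \<le> hold r t x * (1 - hold t t' x)" by simp
      ultimately show ?thesis by linarith
    qed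
    also have "\<dots> \<le> 1 * (K * (t' - t))"
      using one_minus_hold_le[of t t' x K] K rt by (intro mult_mono) auto
    finally show ?thesis unfolding abs_mult using F_nonneg F_le K0 rt
      by (intro mult_mono) auto
  qed
  moreover have "\<bar>LINT u:{t..t'}|lborel. hold r u x * ?g t' u\<bar> \<le> M * K * (t' - t)"
    using K rt by (intro abs_set_integral_interval_le integrand_bounds n) auto
  moreover have "\<bar>?D\<bar> \<le> L * (t' - t)"
  proof -
    have gg: "\<bar>?g t' u - ?g t u\<bar> \<le> L * (t' - t) * rate Q u x" for u
      using Q_op_bounded_le[OF BM_V_lincomb[OF Cb_BM_V[OF regular_Cb[OF n, of u t']] Cb_BM_V[OF regular_Cb[OF n, of u t]], of 1 "-1"],
          of "L * (t' - t)" u x] L(2)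
      by (simp add: Q_op_diff Cb_BM_V regular_Cb n)
    have int: "set_integrable lborel {r..t} (\<lambda>u. hold r u x * ?g t' u - hold r u x * ?g t u)"
      by (intro set_integral_diff(1) integrand_integrable n)
    have "\<bar>?D\<bar> \<le> (LINT u:{r..t}|lborel. \<bar>hold r u x * ?g t' u - hold r u x * ?g t u\<bar>)"
      using set_integral_norm_bound[OF int] by simp
    also have "\<dots> \<le> (LINT u:{r..t}|lborel. L * (t' - t) * (hold r u x * rate Q u x))"
    proof (intro set_integral_mono set_integrable_abs[OF int] set_integrable_mult_right set_integrable_bounded_interval[where M = K])
      fix u
      have "\<bar>hold r u x * ?g t' u - hold r u x * ?g t u\<bar> = hold r u x * \<bar>?g t' u - ?g t u\<bar>"
        by (simp add: right_diff_distrib[symmetric] abs_mult)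
      also have "\<dots> \<le> hold r u x * (L * (t' - t) * rate Q u x)" by (intro mult_left_mono gg) simp
      finally show "\<bar>hold r u x * ?g t' u - hold r u x * ?g t u\<bar> \<le> L * (t' - t) * (hold r u x * rate Q u x)"
        by (simp add: mult_ac)
      show "\<bar>hold r u x * rate Q u x\<bar> \<le> K" if "u \<in> {r..t}"
        using K that rt by (intro hold_mult_le) auto
    qed measurable
    also have "\<dots> = L * (t' - t) * (1 - hold r t x)" using rt by (simp add: hold_rate_integral)
    also have "\<dots> \<le> L * (t' - t) * 1" using L rt by (intro mult_left_mono) auto
    finally show ?thesis by simp
  qed
  ultimately show ?thesis unfolding eq by (simp add: algebra_simps)
qed

text \<open>Where the cut-off does not vanish, \<open>V < n + 1\<close> and the rate is at most \<open>K = a (n + 1)\<close>.\<close>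

lemma regular_Suc:
  assumes n: "regular n" shows "regular (Suc n)"
  unfolding regular_def
proof (intro conjI allI impI)
  show "continuous_on UNIV (approx F (Suc n) r t)" for r t
    unfolding approx_Suc_eq[abs_def] by (intro continuous_intros continuous_cutoff continuous_uncut n)
  show "0 \<le> approx F (Suc n) r t x" for r t x
    unfolding approx_Suc_eq using uncut_bounds[OF n] by simp
  show "approx F (Suc n) r t x \<le> M" for r t x
    unfolding approx_Suc_eq using uncut_bounds[OF n, of r t x] mult_mono[of "cutoff n x" 1 "uncut n r t x" M] by simp
  show "approx F (Suc n) r t x = 0" if "real (Suc n) \<le> V x" for r t x
    unfolding approx_Suc_eq using that by (simp add: cutoff_eq_0)
  fix T
  obtain L where L: "0 \<le> L" "\<And>r r' t t' x. \<lbrakk>t \<le> T; t' \<le> T\<rbrakk> \<Longrightarrow>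
        \<bar>approx F n r t x - approx F n r' t' x\<bar> \<le> L * (\<bar>r - r'\<bar> + \<bar>t - t'\<bar>)"
    using regular_lipschitz[OF n, of T] by metis
  obtain a where a: "a > 0" "\<And>r y. r \<le> T \<Longrightarrow> rate Q r y \<le> a * V y" using rate_le[of T] by blast
  define K where "K = a * (real n + 1)"
  have K0: "0 \<le> K" using a by (simp add: K_def)
  define C where "C = 4 * K * M + L"
  have C0: "0 \<le> C" using K0 test_bound_nonneg L by (simp add: C_def)
  have lip: "\<bar>uncut n r t x - uncut n r' t' x\<bar> \<le> C * (\<bar>r - r'\<bar> + \<bar>t - t'\<bar>)"
    if x: "V x < real n + 1" and t: "t \<le> t'" "t' \<le> T" for r r' t t' x
  proof -
    have K: "rate Q u x \<le> K" if "u \<le> T" for u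
    proof -
      have "rate Q u x \<le> a * V x" by (rule a(2)[OF that])
      also have "\<dots> \<le> K" unfolding K_def using a x by (intro mult_left_mono) auto
      finally show ?thesis .
    qed
    \<comment> \<open>for \<open>r > t\<close> the value is the one at \<open>r = t\<close>, so both pairs of times may be moved into the
      region of ordered times; the path between them passes through \<open>(\<rho>, t')\<close>\<close>
    define \<rho> where "\<rho> = min r t"
    define \<rho>' where "\<rho>' = min r' t'"
    have br: "uncut n r t x = uncut n \<rho> t x" "uncut n r' t' x = uncut n \<rho>' t' x"
      using uncut_trivial[of t r n x] uncut_trivial[of t t n x] uncut_trivial[of t' r' n x] uncut_trivial[of t' t' n x]
      by (auto simp: \<rho>_def \<rho>'_def min_def)
    have "\<bar>uncut n \<rho> t' x - uncut n \<rho> t x\<bar> \<le> (2 * K * M + L) * (t' - t)"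
    proof (rule uncut_lipschitz_end[OF n])
      show "\<bar>approx F n u t' y - approx F n u t y\<bar> \<le> L * (t' - t)" for u y
        using L(2)[of t' t u y u] t by simp
    qed (use K t L in \<open>auto simp: \<rho>_def\<close>)
    moreover have "\<bar>uncut n \<rho> t' x - uncut n \<rho>' t' x\<bar> \<le> 2 * K * M * \<bar>\<rho> - \<rho>'\<bar>"
    proof (cases "\<rho> \<le> \<rho>'")
      case True
      then show ?thesis using uncut_lipschitz_start[OF n, of t' x K \<rho> \<rho>'] K t by (auto simp: \<rho>'_def)
    next
      case False
      moreover have "\<rho> \<le> t'" using t by (simp add: \<rho>_def)
      ultimately show ?thesis using uncut_lipschitz_start[OF n, of t' x K \<rho>' \<rho>] K t
        by (simp add: abs_minus_commute)
    qed
    moreover have "2 * K * M * \<bar>\<rho> - \<rho>'\<bar> \<le> 2 * K * M * (\<bar>r - r'\<bar> + \<bar>t - t'\<bar>)"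
      using K0 test_bound_nonneg by (intro mult_left_mono) (auto simp: \<rho>_def \<rho>'_def min_def)
    moreover have "(2 * K * M + L) * (t' - t) \<le> (2 * K * M + L) * (\<bar>r - r'\<bar> + \<bar>t - t'\<bar>)"
      using K0 test_bound_nonneg L t by (intro mult_left_mono) auto
    moreover have "C * (\<bar>r - r'\<bar> + \<bar>t - t'\<bar>) =
        2 * K * M * (\<bar>r - r'\<bar> + \<bar>t - t'\<bar>) + (2 * K * M + L) * (\<bar>r - r'\<bar> + \<bar>t - t'\<bar>)"
      by (simp add: C_def algebra_simps)
    ultimately show ?thesis unfolding br by linarith
  qed
  show "\<exists>L\<ge>0. \<forall>r r' t t' x. t \<le> T \<longrightarrow> t' \<le> T \<longrightarrow>
      \<bar>approx F (Suc n) r t x - approx F (Suc n) r' t' x\<bar> \<le> L * (\<bar>r - r'\<bar> + \<bar>t - t'\<bar>)"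
    unfolding approx_Suc_eq
  proof (intro exI[of _ C] conjI allI impI C0)
    fix r r' t t' x assume t: "t \<le> T" "t' \<le> T"
    show "\<bar>cutoff n x * uncut n r t x - cutoff n x * uncut n r' t' x\<bar> \<le> C * (\<bar>r - r'\<bar> + \<bar>t - t'\<bar>)"
    proof (cases "V x < real n + 1")
      case True
      have b: "\<bar>uncut n r t x - uncut n r' t' x\<bar> \<le> C * (\<bar>r - r'\<bar> + \<bar>t - t'\<bar>)"
      proof (cases "t \<le> t'")
        case le: True
        show ?thesis using lip[OF True le t(2)] .
      next
        case False
        show ?thesis using lip[OF True _ t(1), of t' r' r] False
          by (simp add: abs_minus_commute)
      qed
      have "\<bar>cutoff n x * uncut n r t x - cutoff n x * uncut n r' t' x\<bar> =
          cutoff n x * \<bar>uncut n r t x - uncut n r' t' x\<bar>"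
        by (simp add: right_diff_distrib[symmetric] abs_mult)
      also have "\<dots> \<le> 1 * (C * (\<bar>r - r'\<bar> + \<bar>t - t'\<bar>))" using b by (intro mult_mono) auto
      finally show ?thesis by simp
    next
      case False
      then show ?thesis using C0 by (simp add: cutoff_eq_0)
    qed
  qed
qed

lemma regular: "regular n"
proof (induction n)
  case 0
  show ?case using test_bound_nonneg by (auto simp: regular_def intro!: exI[of _ 0])
qed (rule regular_Suc)

lemmas approx_nonneg = regularD(2)[OF regular]
lemmas approx_le = regularD(3)[OF regular]
lemmas approx_Cb = regular_Cb[OF regular]
lemmas approx_BM_V = Cb_BM_V[OF approx_Cb]

lemma continuous_approx: "continuous_on UNIV (\<lambda>(r, t, x). approx F n r t x)"
  unfolding continuous_on_def
proof (intro ballI, clarify)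
  fix r0 t0 :: real and x0 :: 'a
  obtain L where L: "0 \<le> L" "\<And>r r' t t' x. \<lbrakk>t \<le> t0 + 1; t' \<le> t0 + 1\<rbrakk> \<Longrightarrow>
        \<bar>approx F n r t x - approx F n r' t' x\<bar> \<le> L * (\<bar>r - r'\<bar> + \<bar>t - t'\<bar>)"
    using regular_lipschitz[OF regular[of n], where T = "t0 + 1"] by metis
  let ?A = "\<lambda>p. approx F n (fst p) (fst (snd p)) (snd (snd p))"
  let ?p = "(r0, t0, x0)"
  have "((\<lambda>p. ?A p - approx F n r0 t0 (snd (snd p))) \<longlongrightarrow> 0) (at ?p)"
  proof (rule Lim_null_comparison)
    have "((\<lambda>p. fst (snd p)) \<longlongrightarrow> t0) (at ?p)" by (auto intro!: tendsto_eq_intros)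
    then have "\<forall>\<^sub>F p in at ?p. fst (snd p) < t0 + 1" by (rule order_tendstoD) simp
    then show "\<forall>\<^sub>F p in at ?p. norm (?A p - approx F n r0 t0 (snd (snd p))) \<le> L * (\<bar>fst p - r0\<bar> + \<bar>fst (snd p) - t0\<bar>)"
      by eventually_elim (simp add: L(2))
    have "((\<lambda>p. L * (\<bar>fst p - r0\<bar> + \<bar>fst (snd p) - t0\<bar>)) \<longlongrightarrow> L * (\<bar>r0 - r0\<bar> + \<bar>t0 - t0\<bar>)) (at ?p)"
      by (auto intro!: tendsto_eq_intros)
    then show "((\<lambda>p. L * (\<bar>fst p - r0\<bar> + \<bar>fst (snd p) - t0\<bar>)) \<longlongrightarrow> 0) (at ?p)" by simp
  qed
  moreover have "((\<lambda>p. approx F n r0 t0 (snd (snd p))) \<longlongrightarrow> approx F n r0 t0 x0) (at ?p)"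
    using regularD(1)[OF regular, of n r0 t0]
    by (intro isCont_tendsto_compose[of _ "approx F n r0 t0"])
       (auto simp: continuous_on_eq_continuous_at intro!: tendsto_eq_intros)
  ultimately have "((\<lambda>p. ?A p - approx F n r0 t0 (snd (snd p)) + approx F n r0 t0 (snd (snd p))) \<longlongrightarrow> 0 + approx F n r0 t0 x0) (at ?p)"
    by (rule tendsto_add)
  then show "((\<lambda>(r, t, x). approx F n r t x) \<longlongrightarrow> approx F n r0 t0 x0) (at ?p)"
    by (simp add: case_prod_unfold)
qed

lemma ennreal_approx_Suc:
  "ennreal (approx F (Suc n) r t x) = ennreal (cutoff n x) * (ennreal (hold r t x) * ennreal (F x) +
     (\<integral>\<^sup>+u\<in>{r..t}. ennreal (hold r u x) * (\<integral>\<^sup>+y. ennreal (approx F n u t y) \<partial>Q u x) \<partial>lborel))"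
proof -
  note integrand_measurable[OF regular, measurable]
  obtain K where K: "0 \<le> K" "\<And>r. r \<le> t \<Longrightarrow> rate Q r x \<le> K" using rate_bounded_on[of t x] by blast
  have "(\<integral>\<^sup>+u\<in>{r..t}. ennreal (hold r u x) * (\<integral>\<^sup>+y. ennreal (approx F n u t y) \<partial>Q u x) \<partial>lborel) =
      (\<integral>\<^sup>+u\<in>{r..t}. ennreal (hold r u x * Q_op Q u (approx F n u t) x) \<partial>lborel)"
    by (simp add: ennreal_Q_op[symmetric] approx_BM_V approx_nonneg ennreal_mult regular_Q_op(2)[OF regular])
  also have "\<dots> = ennreal (LINT u:{r..t}|lborel. hold r u x * Q_op Q u (approx F n u t) x)"
    using K integrand_bounds[OF regular] integrand_nonneg[OF regular]
    by (intro nn_integral_interval_eq_set_integral[where M = "M * K"]) auto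
  finally show ?thesis
    using F_nonneg integrand_nonneg[OF regular]
    by (simp add: approx_Suc_eq uncut_def ennreal_mult ennreal_plus set_lebesgue_integral_def integral_nonneg_AE)
qed

lemma approx_mono: "approx F n r t x \<le> approx F (Suc n) r t x"
proof (induction n arbitrary: r x)
  case 0
  show ?case using approx_nonneg[of "Suc 0" r t x] by simp
next
  case (Suc n)
  have "ennreal (approx F (Suc n) r t x) \<le> ennreal (approx F (Suc (Suc n)) r t x)"
    unfolding ennreal_approx_Suc[of n r t x] ennreal_approx_Suc[of "Suc n" r t x]
    by (intro mult_mono add_left_mono nn_integral_mono mult_right_mono mult_left_mono ennreal_leI Suc.IH cutoff_mono) auto
  then show ?case using approx_nonneg by (subst (asm) ennreal_le_iff) auto
qed

lemma approx_le_U: "approx F n r t x \<le> U r t F x"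
proof (induction n arbitrary: r x)
  case 0
  show ?case using F_nonneg by (simp add: U_nonneg)
next
  case (Suc n)
  have [measurable]: "F \<in> borel_measurable borel" using F_cont by (rule borel_measurable_continuous_onI)
  have U0: "0 \<le> U r t F x" for r x using F_nonneg by (rule U_nonneg)
  have "ennreal (approx F (Suc n) r t x) \<le> 1 * (ennreal (hold r t x) * ennreal (F x) +
     (\<integral>\<^sup>+u\<in>{r..t}. ennreal (hold r u x) * (\<integral>\<^sup>+y. ennreal (U u t F y) \<partial>Q u x) \<partial>lborel))"
    unfolding ennreal_approx_Suc
    by (intro mult_mono add_left_mono nn_integral_mono mult_right_mono mult_left_mono ennreal_leI Suc.IH) auto
  also have "\<dots> = ennreal (U r t F x)"
    using nn_integral_P_first_jump[of F r x t] F_nonneg by (simp add: ennreal_U Cb_BM_V test_function_Cb)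
  finally show ?case using U0 by (subst (asm) ennreal_le_iff) auto
qed

text \<open>The limit \<open>S\<close> dominates the first-jump recursion applied to \<open>S\<close>: at a given \<open>x\<close> the cut-off equals
  \<open>1\<close> from some index on, and the rest passes to the limit by monotone convergence. By induction \<open>S\<close>
  dominates all partial sums over the number of jumps.\<close>

lemma approx_tendsto_U: "(\<lambda>n. approx F n r t x) \<longlonglongrightarrow> U r t F x"
proof -
  have [measurable]: "F \<in> borel_measurable borel" using F_cont by (rule borel_measurable_continuous_onI)
  have [measurable]: "approx F n r t \<in> borel_measurable borel" for n r t
    by (rule BM_V_measurable[OF approx_BM_V])
  have inc: "incseq (\<lambda>n. ennreal (approx F n r t x))" for r x
    using approx_mono by (intro incseq_SucI ennreal_leI)
  define S where "S = (\<lambda>r x. SUP n. ennreal (approx F n r t x))"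
  have S_ge: "ennreal (hold r t x) * ennreal (F x) +
      (\<integral>\<^sup>+u\<in>{r..t}. ennreal (hold r u x) * (\<integral>\<^sup>+y. S u y \<partial>Q u x) \<partial>lborel) \<le> S r x" for r x
  proof -
    have Sn: "(\<integral>\<^sup>+y. S u y \<partial>Q u x) = (SUP n. \<integral>\<^sup>+y. ennreal (approx F n u t y) \<partial>Q u x)" for u
      unfolding S_def using inc by (intro nn_integral_monotone_convergence_SUP) (auto simp: incseq_def le_fun_def)
    have "(\<integral>\<^sup>+u\<in>{r..t}. ennreal (hold r u x) * (\<integral>\<^sup>+y. S u y \<partial>Q u x) \<partial>lborel) =
      (\<integral>\<^sup>+u. (SUP n. ennreal (hold r u x) * (\<integral>\<^sup>+y. ennreal (approx F n u t y) \<partial>Q u x) * indicator {r..t} u) \<partial>lborel)"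
      by (simp add: Sn SUP_mult_left_ennreal SUP_mult_right_ennreal)
    also have "\<dots> = (SUP n. \<integral>\<^sup>+u\<in>{r..t}. ennreal (hold r u x) * (\<integral>\<^sup>+y. ennreal (approx F n u t y) \<partial>Q u x) \<partial>lborel)"
    proof (rule nn_integral_monotone_convergence_SUP)
      show "incseq (\<lambda>n u. ennreal (hold r u x) * (\<integral>\<^sup>+y. ennreal (approx F n u t y) \<partial>Q u x) * indicator {r..t} u)"
        using inc by (auto simp: incseq_def le_fun_def intro!: mult_right_mono mult_left_mono nn_integral_mono)
      show "(\<lambda>u. ennreal (hold r u x) * (\<integral>\<^sup>+y. ennreal (approx F n u t y) \<partial>Q u x) * indicator {r..t} u) \<in> borel_measurable lborel" for n
      proof -
        note integrand_measurable[OF regular, measurable]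
        have "(\<lambda>u. ennreal (hold r u x) * ennreal (Q_op Q u (approx F n u t) x) * indicator {r..t} u) \<in> borel_measurable lborel"
          by measurable
        then show ?thesis by (simp add: ennreal_Q_op approx_BM_V approx_nonneg)
      qed
    qed
    finally have eq: "ennreal (hold r t x) * ennreal (F x) +
        (\<integral>\<^sup>+u\<in>{r..t}. ennreal (hold r u x) * (\<integral>\<^sup>+y. S u y \<partial>Q u x) \<partial>lborel) =
        (SUP n. ennreal (hold r t x) * ennreal (F x) +
           (\<integral>\<^sup>+u\<in>{r..t}. ennreal (hold r u x) * (\<integral>\<^sup>+y. ennreal (approx F n u t y) \<partial>Q u x) \<partial>lborel))"
      by (simp add: ennreal_SUP_add_right)
    show ?thesis
      unfolding eq
    proof (rule SUP_least)
      fix n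
      obtain m0 :: nat where "V x \<le> real m0" using real_arch_simple by blast
      then obtain m where m: "n \<le> m" "V x \<le> real m"
        by (meson le_max_iff_disj max.cobounded1 max.cobounded2 of_nat_mono order_trans of_nat_le_iff)
      have "approx F n u t y \<le> approx F m u t y" for u y
        using lift_Suc_mono_le[of "\<lambda>n. approx F n u t y" n m] approx_mono m by blast
      then have "ennreal (hold r t x) * ennreal (F x) +
           (\<integral>\<^sup>+u\<in>{r..t}. ennreal (hold r u x) * (\<integral>\<^sup>+y. ennreal (approx F n u t y) \<partial>Q u x) \<partial>lborel)
         \<le> ennreal (approx F (Suc m) r t x)"
        unfolding ennreal_approx_Suc cutoff_eq_1[OF m(2)]
        by (auto intro!: add_left_mono nn_integral_mono mult_right_mono mult_left_mono ennreal_leI)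
      also have "\<dots> \<le> S r x" unfolding S_def by (rule SUP_upper) simp
      finally show "ennreal (hold r t x) * ennreal (F x) +
           (\<integral>\<^sup>+u\<in>{r..t}. ennreal (hold r u x) * (\<integral>\<^sup>+y. ennreal (approx F n u t y) \<partial>Q u x) \<partial>lborel) \<le> S r x" .
    qed
  qed
  have "(\<Sum>k<N. jump k r t F x) \<le> S r x" for N r x
  proof (induction N arbitrary: r x)
    case (Suc N)
    have e: "(\<Sum>k<Suc N. jump k r t F x) = ennreal (hold r t x) * ennreal (F x) +
       (\<integral>\<^sup>+u\<in>{r..t}. ennreal (hold r u x) * (\<integral>\<^sup>+y. (\<Sum>k<N. jump k u t F y) \<partial>Q u x) \<partial>lborel)"
      by (rule jump_sum_Suc) simp
    have "\<dots> \<le> ennreal (hold r t x) * ennreal (F x) +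
      (\<integral>\<^sup>+u\<in>{r..t}. ennreal (hold r u x) * (\<integral>\<^sup>+y. S u y \<partial>Q u x) \<partial>lborel)"
      by (intro add_left_mono nn_integral_mono mult_right_mono mult_left_mono Suc.IH) auto
    also note S_ge
    finally show ?case unfolding e .
  qed simp
  then have "ennreal (U r t F x) \<le> S r x"
    by (simp add: ennreal_U Cb_BM_V test_function_Cb F_nonneg nn_integral_P suminf_eq_SUP SUP_least)
  moreover have "S r x \<le> ennreal (U r t F x)"
    unfolding S_def by (intro SUP_least ennreal_leI approx_le_U)
  ultimately have "S r x = ennreal (U r t F x)" by simp
  moreover have "(\<lambda>n. ennreal (approx F n r t x)) \<longlonglongrightarrow> S r x"
    unfolding S_def by (rule LIMSEQ_SUP[OF inc])
  ultimately show ?thesis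
    using approx_nonneg U_nonneg[OF F_nonneg] by (simp add: tendsto_ennreal_iff)
qed

lemma Q_op_approx_tendsto: "(\<lambda>n. Q_op Q u (approx F n r t) x) \<longlonglongrightarrow> Q_op Q u (U r t F) x"
proof -
  interpret finite_measure "Q u x" by (rule finite_Q)
  show ?thesis
    unfolding Q_op_def
  proof (rule integral_dominated_convergence[where w = "\<lambda>_. M"])
    show "U r t F \<in> borel_measurable (Q u x)" "approx F n r t \<in> borel_measurable (Q u x)" for n
      using BM_V_measurable[OF U_BM_V[OF Cb_BM_V[OF test_function_Cb]]] BM_V_measurable[OF approx_BM_V] by simp_all
  qed (use approx_tendsto_U approx_nonneg approx_le in auto)
qed

lemma Q_op_approx_le: "Q_op Q u (approx F n r t) x \<le> Q_op Q u (U r t F) x"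
  by (intro Q_op_mono approx_BM_V U_BM_V Cb_BM_V test_function_Cb approx_le_U)

text \<open>The differential equation of the approximations in integrated form. It has the cut-off in front of
  \<open>Q(u)\<close> and the previous iterate inside, both of which only make the gain by jumps smaller.\<close>

lemma approx_increment:
  assumes rt: "r \<le> r'" "r' \<le> t"
  shows "approx F (Suc n) r' t x - approx F (Suc n) r t x =
    (LINT u:{r..r'}|lborel. rate Q u x * approx F (Suc n) u t x - cutoff n x * Q_op Q u (approx F n u t) x)"
proof -
  let ?g = "\<lambda>u. Q_op Q u (approx F n u t) x"
  have g: "continuous_on UNIV ?g" by (rule continuous_on_slices(1)[OF regular_Q_op(1)[OF regular]])
  have contL: "continuous_on UNIV (cum_rate x)"
    using DERIV_isCont[OF DERIV_cum_rate] by (simp add: continuous_on_eq_continuous_at)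
  have "continuous_on UNIV (\<lambda>u. exp (- cum_rate x u) * ?g u)"
    using contL by (intro continuous_intros g)
  then obtain H where H: "\<And>u. (H has_real_derivative exp (- cum_rate x u) * ?g u) (at u)"
    "\<And>u v. u \<le> v \<Longrightarrow> (LINT u:{u..v}|lborel. exp (- cum_rate x u) * ?g u) = H v - H u"
    using continuous_antiderivative by blast
  define E where "E = (\<lambda>u. exp (cum_rate x u) * (exp (- cum_rate x t) * F x + H t - H u))"
  have bE: "uncut n u t x = E u" if "u \<le> t" for u
  proof -
    have "(LINT v:{u..t}|lborel. hold u v x * ?g v) =
        (LINT v:{u..t}|lborel. exp (cum_rate x u) * (exp (- cum_rate x v) * ?g v))"
      by (intro set_lebesgue_integral_cong) (auto simp: hold_eq_cum_rate exp_diff exp_minus field_simps)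
    also have "\<dots> = exp (cum_rate x u) * (H t - H u)" using H(2)[OF that] by simp
    finally show ?thesis
      using that by (simp add: uncut_def E_def hold_eq_cum_rate exp_diff exp_minus divide_inverse algebra_simps)
  qed
  have dE: "(E has_real_derivative rate Q u x * E u - ?g u) (at u)" for u
    unfolding E_def by (rule has_derivative_integrating_factor[OF H(1) refl])
  have contE: "continuous_on UNIV E" using DERIV_isCont[OF dE] by (simp add: continuous_on_eq_continuous_at)
  have "(LINT u:{r..r'}|lborel. cutoff n x * (rate Q u x * E u - ?g u)) = cutoff n x * E r' - cutoff n x * E r"
  proof -
    have "(\<integral>u. (cutoff n x * (rate Q u x * E u - ?g u)) * indicator {r..r'} u \<partial>lborel) = cutoff n x * E r' - cutoff n x * E r"
    proof (rule integral_FTC_Icc_real[OF rt(1)])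
      show "((\<lambda>u. cutoff n x * E u) has_real_derivative cutoff n x * (rate Q u x * E u - ?g u)) (at u)" for u
        by (rule DERIV_cmult[OF dE])
      show "isCont (\<lambda>u. cutoff n x * (rate Q u x * E u - ?g u)) u" for u
        using contE g continuous_on_slices(1)[OF continuous_rate]
        by (auto simp: continuous_on_eq_continuous_at intro!: continuous_intros)
    qed
    then show ?thesis
      unfolding set_lebesgue_integral_def real_scaleR_def by (simp only: mult.commute[of "indicat_real _ _"])
  qed
  moreover have "(LINT u:{r..r'}|lborel. rate Q u x * approx F (Suc n) u t x - cutoff n x * ?g u) =
     (LINT u:{r..r'}|lborel. cutoff n x * (rate Q u x * E u - ?g u))"
    using rt by (intro set_lebesgue_integral_cong) (auto simp: approx_Suc_eq bE algebra_simps)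
  ultimately show ?thesis using rt by (simp add: approx_Suc_eq bE)
qed

end

lemma U_add_const: "F \<in> BM_V V \<Longrightarrow> U s t (\<lambda>y. F y + b) x = U s t F x + b"
proof -
  assume F: "F \<in> BM_V V"
  have "U s t (\<lambda>y. F y - (- b)) x = U s t F x - U s t (\<lambda>_. - b) x" by (rule U_diff[OF F const_BM_V])
  then show ?thesis by (simp add: U_const)
qed

lemma Q_op_add_const: "F \<in> BM_V V \<Longrightarrow> Q_op Q t (\<lambda>y. F y + b) x = Q_op Q t F x + rate Q t x * b"
proof -
  assume F: "F \<in> BM_V V"
  have "Q_op Q t (\<lambda>y. F y - (- b)) x = Q_op Q t F x - Q_op Q t (\<lambda>_. - b) x" by (rule Q_op_diff[OF F const_BM_V])
  then show ?thesis by (simp add: Q_op_const)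
qed

lemma Cb_bounds:
  assumes "F \<in> Cb" obtains M where "0 \<le> M" "\<And>x. \<bar>F x\<bar> \<le> M"
  using BM_obtain_bound[OF Cb_subset_BM[OF assms]] by blast

text \<open>Lower semicontinuity of \<open>U (F + M)\<close> and of \<open>U (M - F)\<close>, whose sum is the constant \<open>2 M\<close>.\<close>

lemma continuous_U:
  assumes F: "F \<in> Cb"
  shows "continuous_on UNIV (\<lambda>(s, t, x). U s t F x)"
proof -
  obtain M where M: "0 \<le> M" "\<And>x. \<bar>F x\<bar> \<le> M" using Cb_bounds[OF F] by blast
  have Fc: "continuous_on UNIV F" using F by (simp add: Cb_def)
  have c: "continuous_on UNIV (\<lambda>x. F x + M)" "continuous_on UNIV (\<lambda>x. M - F x)"
    using Fc by (auto intro!: continuous_intros)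
  have b: "0 \<le> F x + M" "F x + M \<le> 2 * M" "0 \<le> M - F x" "M - F x \<le> 2 * M" for x
    using M(2)[of x] by auto
  have "continuous_on UNIV (\<lambda>p. U (fst p) (fst (snd p)) (\<lambda>x. F x + M) (snd (snd p)))"
  proof (rule continuous_on_of_lower_approximations)
    show "continuous_on UNIV (\<lambda>p. approx (\<lambda>x. F x + M) n (fst p) (fst (snd p)) (snd (snd p)))" for n
      using continuous_approx[OF c(1) b(1,2)] by (simp add: case_prod_unfold)
    show "continuous_on UNIV (\<lambda>p. approx (\<lambda>x. M - F x) n (fst p) (fst (snd p)) (snd (snd p)))" for n
      using continuous_approx[OF c(2) b(3,4)] by (simp add: case_prod_unfold)
    have "U s t (\<lambda>x. M - F x) x = M - U s t F x" for s t x
      using U_diff[OF const_BM_V Cb_BM_V[OF F], of s t M x] by (simp add: U_const)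
    then show "continuous_on UNIV (\<lambda>p. U (fst p) (fst (snd p)) (\<lambda>x. F x + M) (snd (snd p)) +
        U (fst p) (fst (snd p)) (\<lambda>x. M - F x) (snd (snd p)))"
      using U_add_const[OF Cb_BM_V[OF F]] by simp
  qed (use approx_le_U[OF c(1) b(1,2)] approx_le_U[OF c(2) b(3,4)]
        approx_tendsto_U[OF c(1) b(1,2)] approx_tendsto_U[OF c(2) b(3,4)] in auto)
  then have "continuous_on UNIV (\<lambda>p. U (fst p) (fst (snd p)) (\<lambda>x. F x + M) (snd (snd p)) - M)"
    by (intro continuous_intros)
  then show ?thesis using U_add_const[OF Cb_BM_V[OF F]] by (simp add: case_prod_unfold)
qed

lemma continuous_Q_op_U:
  assumes F: "F \<in> Cb"
  shows "continuous_on UNIV (\<lambda>r. Q_op Q r (U r t F) x)"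
proof -
  obtain M where M: "0 \<le> M" "\<And>x. \<bar>F x\<bar> \<le> M" using Cb_bounds[OF F] by blast
  have Fc: "continuous_on UNIV F" using F by (simp add: Cb_def)
  have c: "continuous_on UNIV (\<lambda>x. F x + M)" "continuous_on UNIV (\<lambda>x. M - F x)"
    using Fc by (auto intro!: continuous_intros)
  have b: "0 \<le> F x + M" "F x + M \<le> 2 * M" "0 \<le> M - F x" "M - F x \<le> 2 * M" for x
    using M(2)[of x] by auto
  have FV: "F \<in> BM_V V" using F by (rule Cb_BM_V)
  have 1: "Q_op Q r (U r t (\<lambda>x. F x + M)) x = Q_op Q r (U r t F) x + M * rate Q r x" for r
  proof -
    have "U r t (\<lambda>x. F x + M) = (\<lambda>x. U r t F x + M)" by (rule ext) (rule U_add_const[OF FV])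
    then show ?thesis using Q_op_add_const[OF U_BM_V[OF FV], of r r t M x] by (simp add: mult.commute)
  qed
  have 2: "Q_op Q r (U r t (\<lambda>x. M - F x)) x = M * rate Q r x - Q_op Q r (U r t F) x" for r
  proof -
    have "U r t (\<lambda>x. M - F x) = (\<lambda>x. M - U r t F x)"
      using U_diff[OF const_BM_V FV, of r t M] by (simp add: U_const fun_eq_iff)
    then show ?thesis using Q_op_diff[OF const_BM_V U_BM_V[OF FV], of r M r t x] by (simp add: Q_op_const mult.commute)
  qed
  have rate: "continuous_on UNIV (\<lambda>r. rate Q r x)" by (rule continuous_on_slices(1)[OF continuous_rate])
  have "continuous_on UNIV (\<lambda>r. Q_op Q r (U r t (\<lambda>x. F x + M)) x)"
  proof (rule continuous_on_of_lower_approximations)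
    show "continuous_on UNIV (\<lambda>r. Q_op Q r (approx (\<lambda>x. F x + M) n r t) x)" for n
      by (rule continuous_on_slices(1)[OF regular_Q_op(1)[OF c(1) b(1,2) regular[OF c(1) b(1,2)]]])
    show "continuous_on UNIV (\<lambda>r. Q_op Q r (approx (\<lambda>x. M - F x) n r t) x)" for n
      by (rule continuous_on_slices(1)[OF regular_Q_op(1)[OF c(2) b(3,4) regular[OF c(2) b(3,4)]]])
    show "continuous_on UNIV (\<lambda>r. Q_op Q r (U r t (\<lambda>x. F x + M)) x + Q_op Q r (U r t (\<lambda>x. M - F x)) x)"
      unfolding 1 2 using rate by (auto intro!: continuous_intros)
  qed (use Q_op_approx_le[OF c(1) b(1,2)] Q_op_approx_le[OF c(2) b(3,4)]
       Q_op_approx_tendsto[OF c(1) b(1,2)] Q_op_approx_tendsto[OF c(2) b(3,4)] in auto)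
  then have "continuous_on UNIV (\<lambda>r. Q_op Q r (U r t (\<lambda>x. F x + M)) x - M * rate Q r x)"
    using rate by (intro continuous_intros)
  then show ?thesis unfolding 1 by simp
qed

lemma solves_backward_U:
  assumes F: "F \<in> Cb" shows "solves_backward Q P F"
  unfolding solves_backward_def
proof (intro allI impI conjI ballI)
  fix t :: real and x
  have FV: "F \<in> BM_V V" using F by (rule Cb_BM_V)
  have contL: "continuous_on UNIV (cum_rate x)"
    using DERIV_isCont[OF DERIV_cum_rate] by (simp add: continuous_on_eq_continuous_at)
  have "continuous_on UNIV (\<lambda>u. exp (- cum_rate x u) * Q_op Q u (U u t F) x)"
    using contL by (intro continuous_intros continuous_Q_op_U F)
  then obtain H where H: "\<And>u. (H has_real_derivative exp (- cum_rate x u) * Q_op Q u (U u t F) x) (at u)"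
    "\<And>u v. u \<le> v \<Longrightarrow> (LINT u:{u..v}|lborel. exp (- cum_rate x u) * Q_op Q u (U u t F) x) = H v - H u"
    using continuous_antiderivative by blast
  have Ueq: "U s t F x = exp (cum_rate x s) * (exp (- cum_rate x t) * F x + H t - H s)" if "s \<in> {0..t}" for s
    by (rule U_integrating_factor[OF FV, where ?s0.0 = 0]) (use that H(2) in auto)
  have L: "L_op Q s (U s t F) x = Q_op Q s (U s t F) x - rate Q s x * U s t F x" for s
    by (rule L_op_eq[OF U_BM_V[OF FV]])
  show "((\<lambda>r. U r t F x) has_real_derivative - L_op Q s (U s t F) x) (at s within {0..t})" if s: "s \<in> {0..t}" for s
  proof -
    from has_derivative_integrating_factor[where u = "\<lambda>s. U s t F x", OF has_field_derivative_at_within[OF H(1)] Ueq[OF s]]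
    have "((\<lambda>r. U r t F x) has_real_derivative rate Q s x * U s t F x - Q_op Q s (U s t F) x) (at s within {0..t})"
      by (rule has_field_derivative_transform_within[where d = 1]) (use s Ueq in auto)
    then show ?thesis by (simp add: L)
  qed
  have "continuous_on UNIV (\<lambda>s. case (s, t, x) of (s, t, x) \<Rightarrow> U s t F x)"
    by (rule continuous_on_compose2[OF continuous_U[OF F]]) (auto intro!: continuous_intros)
  then have "continuous_on UNIV (\<lambda>s. - L_op Q s (U s t F) x)"
    unfolding L using continuous_on_slices(1)[OF continuous_rate]
    by (intro continuous_intros continuous_Q_op_U F) auto
  then show "continuous_on {0..t} (\<lambda>s. - L_op Q s (U s t F) x)" by (rule continuous_on_subset) simp
qed

end

section \<open>Uniqueness\<close>

lemma nn_integral_interval_continuous: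
  fixes m :: "real \<Rightarrow> real"
  assumes m: "continuous_on {a..b} m" and nonneg: "\<And>x. x \<in> {a..b} \<Longrightarrow> 0 \<le> m x"
  shows "(\<integral>\<^sup>+x\<in>{a..b}. ennreal (m x) \<partial>lborel) = ennreal (LINT x:{a..b}|lborel. m x)"
proof -
  have int: "set_integrable lborel {a..b} m" using m by (rule borel_integrable_atLeastAtMost')
  have "(\<integral>\<^sup>+x\<in>{a..b}. ennreal (m x) \<partial>lborel) = (\<integral>\<^sup>+x. ennreal (indicator {a..b} x * m x) \<partial>lborel)"
    by (intro nn_integral_cong) (simp add: indicator_def)
  also have "\<dots> = ennreal (LINT x:{a..b}|lborel. m x)"
    unfolding set_lebesgue_integral_def real_scaleR_def
    using int nonneg by (intro nn_integral_eq_integral) (auto simp: set_integrable_def indicator_def)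
  finally show ?thesis .
qed

lemma abs_continuous_on_cong:
  assumes "\<And>x. x \<in> {a..b} \<Longrightarrow> f x = g x"
  shows "abs_continuous_on a b f \<longleftrightarrow> abs_continuous_on a b g"
proof -
  have *: "(\<Sum>(u, v)\<in>I. \<bar>f v - f u\<bar>) = (\<Sum>(u, v)\<in>I. \<bar>g v - g u\<bar>)"
    if "\<forall>(u, v)\<in>I. a \<le> u \<and> u < v \<and> v \<le> b" for I :: "(real \<times> real) set"
    using that assms by (intro sum.cong) fastforce+
  show ?thesis unfolding abs_continuous_on_def by (intro all_cong ex_cong conj_cong refl imp_cong) (auto simp: *)
qed

context lyapunov_kernel
begin

lemma U_Cb:
  assumes F: "F \<in> Cb" shows "U s t F \<in> Cb" and "(\<And>x. \<bar>F x\<bar> \<le> M) \<Longrightarrow> \<bar>U s t F x\<bar> \<le> M"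
proof -
  have b: "\<bar>U s t F x\<bar> \<le> M" if M: "\<And>x. \<bar>F x\<bar> \<le> M" for M x
  proof -
    have "- M \<le> F y" "F y \<le> M" for y using M[of y] by auto
    then have "U s t (\<lambda>_. - M) x \<le> U s t F x" "U s t F x \<le> U s t (\<lambda>_. M) x"
      by (intro U_mono const_BM_V Cb_BM_V F; simp)+
    then show ?thesis by (simp add: U_const)
  qed
  then show "(\<And>x. \<bar>F x\<bar> \<le> M) \<Longrightarrow> \<bar>U s t F x\<bar> \<le> M" .
  obtain M where M: "\<And>x. \<bar>F x\<bar> \<le> M" using Cb_bounds[OF F] by blast
  have "continuous_on UNIV (\<lambda>x. case (s, t, x) of (s, t, x) \<Rightarrow> U s t F x)"
    by (rule continuous_on_compose2[OF continuous_U[OF F]]) (auto intro!: continuous_intros)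
  then show "U s t F \<in> Cb" using b[OF M] by (auto simp: Cb_def bounded_iff)
qed

lemma L_op_diff:
  assumes F: "F \<in> BM_V V" and G: "G \<in> BM_V V"
  shows "L_op Q t (\<lambda>x. F x - G x) x = L_op Q t F x - L_op Q t G x"
proof -
  have "(\<lambda>x. F x - G x) \<in> BM_V V" using BM_V_lincomb[OF F G, of 1 "-1"] by simp
  from L_op_eq[OF this, of t x] show ?thesis
    unfolding L_op_eq[OF F] L_op_eq[OF G] Q_op_diff[OF F G] by (simp add: algebra_simps)
qed

lemma U_lincomb:
  assumes "F \<in> BM_V V" "G \<in> BM_V V"
  shows "U s t (\<lambda>x. a * F x + b * G x) = (\<lambda>x. a * U s t F x + b * U s t G x)"
  unfolding kernel_op_def using integrable_P[OF assms(1)] integrable_P[OF assms(2)] by simp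

lemma evolution_system_Cb: "evolution_system Cb sup_norm U"
  unfolding evolution_system_def
proof (intro conjI allI impI ballI)
  fix s t :: real
  show "positive_bounded_linear_on Cb sup_norm (U s t)"
    unfolding positive_bounded_linear_on_def
  proof (intro conjI ballI allI impI)
    show "U s t (\<lambda>x. a * F x + b * G x) = (\<lambda>x. a * U s t F x + b * U s t G x)"
      if "F \<in> Cb" "G \<in> Cb" for F G a b
      using that by (intro U_lincomb Cb_BM_V)
    show "\<exists>K. \<forall>F\<in>Cb. sup_norm (U s t F) \<le> K * sup_norm F"
    proof (intro exI[of _ 1] ballI)
      fix F :: "'a \<Rightarrow> real" assume F: "F \<in> Cb"
      obtain M where M: "\<And>x. \<bar>F x\<bar> \<le> M" using Cb_bounds[OF F] by blast
      have "\<bar>F x\<bar> \<le> sup_norm F" for x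
        unfolding sup_norm_def using M by (intro cSUP_upper bdd_aboveI[where M = M]) auto
      then have "\<bar>U s t F x\<bar> \<le> sup_norm F" for x by (rule U_Cb(2)[OF F])
      then show "sup_norm (U s t F) \<le> 1 * sup_norm F"
        unfolding sup_norm_def[of "U s t F"] by (auto intro: cSUP_least)
    qed
  qed (auto intro: U_Cb U_nonneg)
qed (auto intro: U_trivial U_semigroup Cb_BM_V)

lemma evolution_system_BM_V: "evolution_system (BM_V V) (weighted_norm V) U"
  unfolding evolution_system_def
proof (intro conjI allI impI ballI)
  fix s t :: real
  show "positive_bounded_linear_on (BM_V V) (weighted_norm V) (U s t)"
    unfolding positive_bounded_linear_on_def
    by (intro conjI ballI allI impI exI[of _ "growth s t"] U_BM_V U_lincomb weighted_norm_U_le)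
       (auto intro: U_nonneg)
qed (auto intro: U_trivial U_semigroup)

lemma feller_evolution_system_P: "feller_evolution_system P"
  unfolding feller_evolution_system_def
  using P_kernel evolution_system_Cb continuous_on_subset[OF continuous_U] by blast

lemma conservative_P: "conservative P"
  by (simp add: conservative_def U_const fun_eq_iff)

context
  fixes W :: "real \<Rightarrow> 'a \<Rightarrow> real \<Rightarrow> 'a measure"
  assumes W: "feller_evolution_system W"
begin

lemma W_kernel: "0 \<le> s \<Longrightarrow> s \<le> t \<Longrightarrow> (\<lambda>x. W s x t) \<in> borel \<rightarrow>\<^sub>M subprob_algebra borel"
  using W by (simp add: feller_evolution_system_def)

lemma W_subprob: "0 \<le> s \<Longrightarrow> s \<le> t \<Longrightarrow> subprob_space (W s x t)"
  and W_sets: "0 \<le> s \<Longrightarrow> s \<le> t \<Longrightarrow> sets (W s x t) = sets borel"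
  using measurable_space[OF W_kernel, of s t x] by (auto simp: space_subprob_algebra)

lemma W_measurable: "0 \<le> s \<Longrightarrow> s \<le> t \<Longrightarrow> measurable (W s x t) N = measurable borel N"
  by (rule measurable_cong_sets[OF W_sets]) auto

lemma W_evolution: "evolution_system Cb sup_norm (kernel_op W)"
  using W by (simp add: feller_evolution_system_def)

lemma W_Cb: "0 \<le> s \<Longrightarrow> s \<le> t \<Longrightarrow> F \<in> Cb \<Longrightarrow> kernel_op W s t F \<in> Cb"
  using W_evolution by (simp add: evolution_system_def positive_bounded_linear_on_def)

lemma W_refl: "0 \<le> s \<Longrightarrow> F \<in> Cb \<Longrightarrow> kernel_op W s s F = F"
  using W_evolution by (simp add: evolution_system_def)

lemma W_nonneg: "(\<And>x. 0 \<le> F x) \<Longrightarrow> 0 \<le> kernel_op W s t F x"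
  by (simp add: kernel_op_def integral_nonneg_AE)

lemma W_integrable:
  assumes "0 \<le> s" "s \<le> t" and F: "F \<in> Cb" shows "integrable (W s x t) F"
proof -
  interpret subprob_space "W s x t" using assms by (intro W_subprob)
  obtain M where M: "\<And>x. \<bar>F x\<bar> \<le> M" using Cb_bounds[OF F] by blast
  have "F \<in> borel_measurable borel" using F by (auto simp: Cb_def intro: borel_measurable_continuous_onI)
  then show ?thesis
    using M by (intro integrable_const_bound[where B = M]) (auto simp: W_measurable assms)
qed

lemma W_abs_le:
  assumes st: "0 \<le> s" "s \<le> t" and b: "\<And>y. \<bar>h y\<bar> \<le> B"
  shows "\<bar>kernel_op W s t h x\<bar> \<le> B"
proof (cases "integrable (W s x t) h")
  case True
  interpret subprob_space "W s x t" using st by (rule W_subprob)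
  have B0: "0 \<le> B" using b[of undefined] by linarith
  have "\<bar>kernel_op W s t h x\<bar> \<le> (\<integral>y. \<bar>h y\<bar> \<partial>W s x t)" unfolding kernel_op_def by (rule integral_abs_bound)
  also have "\<dots> \<le> (\<integral>y. B \<partial>W s x t)" using b True by (intro integral_mono) auto
  also have "\<dots> \<le> B" using mult_right_mono[OF subprob_measure_le_1 B0] by (simp add: mult.commute)
  finally show ?thesis .
next
  case False
  then have "kernel_op W s t h x = 0" by (simp add: kernel_op_def not_integrable_integral_eq)
  then show ?thesis using b[of undefined] by simp
qed

lemma W_diff: "0 \<le> s \<Longrightarrow> s \<le> t \<Longrightarrow> F \<in> Cb \<Longrightarrow> G \<in> Cb \<Longrightarrow>
    kernel_op W s t (\<lambda>x. F x - G x) x = kernel_op W s t F x - kernel_op W s t G x"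
  unfolding kernel_op_def by (intro Bochner_Integration.integral_diff W_integrable)

lemma Cb_diff: "F \<in> Cb \<Longrightarrow> G \<in> Cb \<Longrightarrow> (\<lambda>x. F x - G x :: real) \<in> Cb"
  unfolding Cb_def by (auto intro!: continuous_intros bounded_minus_comp)

lemma W_continuous_end:
  assumes s: "0 \<le> s" and F: "F \<in> Cb"
  shows "continuous_on {s..} (\<lambda>t. kernel_op W s t F x)"
proof -
  have c: "continuous_on {(s, t, x). 0 \<le> s \<and> s \<le> t} (\<lambda>(s, t, x). kernel_op W s t F x)"
    using W F by (simp add: feller_evolution_system_def)
  have "continuous_on {s..} (\<lambda>t. (\<lambda>(s, t, x). kernel_op W s t F x) (s, t, x))"
  proof (rule continuous_on_compose2[OF c])
    show "continuous_on {s..} (\<lambda>t. (s, t, x))" by (intro continuous_intros)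
  qed (use s in auto)
  then show ?thesis by simp
qed

text \<open>With the integrating factor the backward equation becomes the first-jump recursion for
  \<open>w(s) = W(s, t) F\<close>. As \<open>w \<ge> 0\<close> and the recursion is monotone, \<open>w\<close> dominates all partial sums over
  the number of jumps.\<close>

lemma W_backward_ge_U:
  assumes F: "F \<in> Cb" and F0: "\<And>x. 0 \<le> F x" and bwd: "solves_backward Q W F"
    and st: "0 \<le> s" "s \<le> t"
  shows "U s t F x \<le> kernel_op W s t F x"
proof (cases "t = 0")
  case True
  then show ?thesis using st F by (simp add: W_refl U_trivial Cb_BM_V)
next
  case False
  then have t: "0 < t" using st by simp
  have [measurable]: "F \<in> borel_measurable borel" using BM_V_measurable[OF Cb_BM_V[OF F]] .
  define w where "w = (\<lambda>s. kernel_op W s t F)"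
  have w0: "0 \<le> w s x" for s x unfolding w_def using F0 by (rule W_nonneg)
  have wCb: "w s \<in> Cb" if "s \<in> {0..t}" for s
    unfolding w_def using that F by (intro W_Cb) auto
  have eq: "ennreal (w s x) = ennreal (hold s t x) * ennreal (F x) +
    (\<integral>\<^sup>+r\<in>{s..t}. ennreal (hold s r x) * (\<integral>\<^sup>+y. ennreal (w r y) \<partial>Q r x) \<partial>lborel)"
    if s: "s \<in> {0..t}" for s x
  proof -
    have dw: "((\<lambda>r. w r x) has_real_derivative - L_op Q s (w s) x) (at s within {0..t})" if "s \<in> {0..t}" for s
      using bwd t that unfolding solves_backward_def w_def by blast
    have cL: "continuous_on {0..t} (\<lambda>s. - L_op Q s (w s) x)"
      using bwd t unfolding solves_backward_def w_def by blast
    have cw: "continuous_on {0..t} (\<lambda>r. w r x)"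
      using dw by (rule DERIV_continuous_on)
    have rate: "continuous_on {0..t} (\<lambda>r. rate Q r x)"
      using continuous_on_slices(1)[OF continuous_rate] by (rule continuous_on_subset) simp
    have cLam: "continuous_on {0..t} (cum_rate x)"
      using DERIV_isCont[OF DERIV_cum_rate] by (simp add: continuous_at_imp_continuous_on)
    have Leq: "Q_op Q r (w r) x = L_op Q r (w r) x + rate Q r x * w r x" if "r \<in> {0..t}" for r
      using L_op_eq[OF Cb_BM_V[OF wCb[OF that]], of r x] by simp
    have cQ: "continuous_on {0..t} (\<lambda>r. Q_op Q r (w r) x)"
    proof (rule continuous_on_eq)
      show "continuous_on {0..t} (\<lambda>r. - (- L_op Q r (w r) x) + rate Q r x * w r x)"
        by (intro continuous_intros cL rate cw)
    qed (simp add: Leq)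
    have sub: "{s..t} \<subseteq> {0..t}" using s by auto
    let ?e = "\<lambda>r. exp (- cum_rate x r)"
    have dE: "((\<lambda>r. - (?e r * w r x)) has_real_derivative ?e r * Q_op Q r (w r) x) (at r within {s..t})"
      if "r \<in> {s..t}" for r
    proof -
      have r: "r \<in> {0..t}" using that sub by auto
      have "((\<lambda>r. - (?e r * w r x)) has_real_derivative
         - (- (?e r * rate Q r x) * w r x + - L_op Q r (w r) x * ?e r)) (at r within {s..t})"
        by (auto intro!: derivative_eq_intros has_field_derivative_at_within[OF DERIV_cum_rate]
           DERIV_subset[OF dw[OF r] sub])
      then show ?thesis by (simp add: Leq[OF r] algebra_simps)
    qed
    have "(\<integral>r. indicator {s..t} r *\<^sub>R (?e r * Q_op Q r (w r) x) \<partial>lborel) = - (?e t * w t x) - - (?e s * w s x)"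
    proof (rule integral_FTC_Icc)
      show "continuous_on {s..t} (\<lambda>r. ?e r * Q_op Q r (w r) x)"
        by (intro continuous_intros continuous_on_subset[OF cLam sub] continuous_on_subset[OF cQ sub])
    qed (use s dE in \<open>auto simp flip: has_real_derivative_iff_has_vector_derivative\<close>)
    then have I: "(LINT r:{s..t}|lborel. ?e r * Q_op Q r (w r) x) = ?e s * w s x - ?e t * w t x"
      by (simp add: set_lebesgue_integral_def)
    have "(LINT r:{s..t}|lborel. hold s r x * Q_op Q r (w r) x) =
        (LINT r:{s..t}|lborel. exp (cum_rate x s) * (?e r * Q_op Q r (w r) x))"
      by (intro set_lebesgue_integral_cong) (auto simp: hold_eq_cum_rate exp_diff exp_minus field_simps)
    also have "\<dots> = exp (cum_rate x s) * (?e s * w s x - ?e t * w t x)"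
      unfolding I[symmetric] by (rule set_integral_mult_right)
    also have "\<dots> = w s x - hold s t x * F x"
      using s F by (simp add: hold_eq_cum_rate exp_diff exp_minus w_def W_refl divide_inverse algebra_simps)
    finally have f1: "w s x = hold s t x * F x + (LINT r:{s..t}|lborel. hold s r x * Q_op Q r (w r) x)" by simp
    have Qn: "0 \<le> Q_op Q r (w r) x" for r using w0 by (intro Q_op_nonneg)
    have f2: "ennreal (LINT r:{s..t}|lborel. hold s r x * Q_op Q r (w r) x) =
        (\<integral>\<^sup>+r\<in>{s..t}. ennreal (hold s r x * Q_op Q r (w r) x) \<partial>lborel)"
    proof (rule nn_integral_interval_continuous[symmetric])
      have "continuous_on {s..t} (\<lambda>r. exp (cum_rate x s - cum_rate x r) * Q_op Q r (w r) x)"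
        by (intro continuous_intros continuous_on_subset[OF cLam sub] continuous_on_subset[OF cQ sub])
      then show "continuous_on {s..t} (\<lambda>r. hold s r x * Q_op Q r (w r) x)"
        by (rule continuous_on_eq) (simp add: hold_eq_cum_rate)
    qed (use Qn in simp)
    have f3: "(\<integral>\<^sup>+r\<in>{s..t}. ennreal (hold s r x * Q_op Q r (w r) x) \<partial>lborel) =
        (\<integral>\<^sup>+r\<in>{s..t}. ennreal (hold s r x) * (\<integral>\<^sup>+y. ennreal (w r y) \<partial>Q r x) \<partial>lborel)"
      using sub by (intro nn_integral_cong)
        (auto simp: indicator_def ennreal_mult Qn ennreal_Q_op Cb_BM_V[OF wCb] w0)
    have "ennreal (w s x) = ennreal (hold s t x * F x) + ennreal (LINT r:{s..t}|lborel. hold s r x * Q_op Q r (w r) x)"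
      unfolding f1 using F0 Qn
      by (intro ennreal_plus) (auto simp: set_lebesgue_integral_def intro!: integral_nonneg_AE)
    then show ?thesis unfolding f2 f3 using F0 by (simp add: ennreal_mult)
  qed
  have "(\<Sum>k<N. jump k s t F x) \<le> ennreal (w s x)" if "s \<in> {0..t}" for N s x
    using that
  proof (induction N arbitrary: s x)
    case (Suc N)
    have "(\<integral>\<^sup>+r\<in>{s..t}. ennreal (hold s r x) * (\<integral>\<^sup>+y. (\<Sum>k<N. jump k r t F y) \<partial>Q r x) \<partial>lborel)
      \<le> (\<integral>\<^sup>+r\<in>{s..t}. ennreal (hold s r x) * (\<integral>\<^sup>+y. ennreal (w r y) \<partial>Q r x) \<partial>lborel)"
      using Suc.IH Suc.prems
      by (intro nn_integral_mono) (auto simp: indicator_def intro!: mult_left_mono nn_integral_mono)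
    then show ?case
      unfolding jump_sum_Suc[OF measurable_compose[OF \<open>F \<in> borel_measurable borel\<close> measurable_ennreal]]
        eq[OF Suc.prems] by (rule add_left_mono)
  qed simp
  then have "ennreal (U s t F x) \<le> ennreal (w s x)"
    using st by (simp add: ennreal_U Cb_BM_V F F0 nn_integral_P suminf_eq_SUP SUP_least)
  then show ?thesis using w0 by (simp add: w_def)
qed

lemma solves_backward_diff:
  assumes F: "F \<in> Cb" "G \<in> Cb" and b: "solves_backward Q W F" "solves_backward Q W G"
  shows "solves_backward Q W (\<lambda>x. F x - G x)"
  unfolding solves_backward_def
proof (intro allI impI conjI ballI)
  fix t :: real and x assume t: "0 < t"
  have WD: "kernel_op W s t (\<lambda>x. F x - G x) = (\<lambda>y. kernel_op W s t F y - kernel_op W s t G y)" if "s \<in> {0..t}" for s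
    using that F by (auto simp: W_diff)
  have LD: "- L_op Q s (kernel_op W s t (\<lambda>x. F x - G x)) x =
      - L_op Q s (kernel_op W s t F) x - - L_op Q s (kernel_op W s t G) x" if s: "s \<in> {0..t}" for s
  proof -
    have C: "kernel_op W s t F \<in> BM_V V" "kernel_op W s t G \<in> BM_V V"
      using s F by (auto intro!: Cb_BM_V W_Cb)
    show ?thesis
      unfolding WD[OF s] L_op_diff[OF C] by simp
  qed
  show "((\<lambda>r. kernel_op W r t (\<lambda>x. F x - G x) x) has_real_derivative
      - L_op Q s (kernel_op W s t (\<lambda>x. F x - G x)) x) (at s within {0..t})" if s: "s \<in> {0..t}" for s
    unfolding LD[OF s]
  proof (rule has_field_derivative_transform_within[where d = 1, OF DERIV_diff])
    show "((\<lambda>r. kernel_op W r t F x) has_real_derivative - L_op Q s (kernel_op W s t F) x) (at s within {0..t})"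
      "((\<lambda>r. kernel_op W r t G x) has_real_derivative - L_op Q s (kernel_op W s t G) x) (at s within {0..t})"
      using b t s unfolding solves_backward_def by blast+
  qed (use s in \<open>auto simp: WD\<close>)
  show "continuous_on {0..t} (\<lambda>s. - L_op Q s (kernel_op W s t (\<lambda>x. F x - G x)) x)"
  proof (rule continuous_on_eq)
    show "continuous_on {0..t} (\<lambda>s. - L_op Q s (kernel_op W s t F) x - - L_op Q s (kernel_op W s t G) x)"
      using b t unfolding solves_backward_def by (intro continuous_on_diff) blast+
  qed (simp add: LD)
qed

lemma solves_forward_diff:
  assumes F: "F \<in> Cb" "G \<in> Cb" and b: "solves_forward Q W F" "solves_forward Q W G"
  shows "solves_forward Q W (\<lambda>x. F x - G x)"
  unfolding solves_forward_def
proof (intro allI impI)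
  fix s :: real and x assume s: "0 \<le> s"
  have WD: "kernel_op W s t (\<lambda>x. F x - G x) x = kernel_op W s t F x - kernel_op W s t G x" if "s \<le> t" for t
    using that s F by (simp add: W_diff)
  have LD: "L_op Q t (\<lambda>x. F x - G x) = (\<lambda>y. L_op Q t F y - L_op Q t G y)" for t
  proof
    fix y
    note C = Cb_BM_V[OF F(1)] Cb_BM_V[OF F(2)]
    show "L_op Q t (\<lambda>x. F x - G x) y = L_op Q t F y - L_op Q t G y"
      by (rule L_op_diff[OF C])
  qed
  have A: "abs_continuous_on s T (\<lambda>t. kernel_op W s t F x)" "abs_continuous_on s T (\<lambda>t. kernel_op W s t G x)"
    if "s < T" for T
    using b s that unfolding solves_forward_def by blast+
  have D: "AE t in lborel. s \<le> t \<longrightarrow> integrable (W s x t) (L_op Q t F) \<and>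
        ((\<lambda>r. kernel_op W s r F x) has_real_derivative kernel_op W s t (L_op Q t F) x) (at t within {s..})"
     "AE t in lborel. s \<le> t \<longrightarrow> integrable (W s x t) (L_op Q t G) \<and>
        ((\<lambda>r. kernel_op W s r G x) has_real_derivative kernel_op W s t (L_op Q t G) x) (at t within {s..})"
    using b s unfolding solves_forward_def by blast+
  show "(\<forall>T>s. abs_continuous_on s T (\<lambda>t. kernel_op W s t (\<lambda>x. F x - G x) x)) \<and>
      (AE t in lborel. s \<le> t \<longrightarrow> integrable (W s x t) (L_op Q t (\<lambda>x. F x - G x)) \<and>
        ((\<lambda>r. kernel_op W s r (\<lambda>x. F x - G x) x) has_real_derivative
          kernel_op W s t (L_op Q t (\<lambda>x. F x - G x)) x) (at t within {s..}))"
  proof (intro conjI allI impI)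
    fix T assume T: "s < T"
    show "abs_continuous_on s T (\<lambda>t. kernel_op W s t (\<lambda>x. F x - G x) x)"
      using abs_continuous_on_diff[OF A[OF T]]
      by (rule abs_continuous_on_cong[THEN iffD1, rotated]) (simp add: WD)
  next
    show "AE t in lborel. s \<le> t \<longrightarrow> integrable (W s x t) (L_op Q t (\<lambda>x. F x - G x)) \<and>
        ((\<lambda>r. kernel_op W s r (\<lambda>x. F x - G x) x) has_real_derivative
          kernel_op W s t (L_op Q t (\<lambda>x. F x - G x)) x) (at t within {s..})"
      using D
    proof eventually_elim
      case (elim t)
      show ?case
      proof (intro impI conjI)
        assume t: "s \<le> t"
        note e1 = elim(1)[rule_format, OF t] and e2 = elim(2)[rule_format, OF t]
        show "integrable (W s x t) (L_op Q t (\<lambda>x. F x - G x))"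
          unfolding LD using e1 e2 by (intro Bochner_Integration.integrable_diff) auto
        have "kernel_op W s t (L_op Q t (\<lambda>x. F x - G x)) x = kernel_op W s t (L_op Q t F) x - kernel_op W s t (L_op Q t G) x"
          unfolding LD unfolding kernel_op_def using e1 e2 by (intro Bochner_Integration.integral_diff) auto
        then show "((\<lambda>r. kernel_op W s r (\<lambda>x. F x - G x) x) has_real_derivative
          kernel_op W s t (L_op Q t (\<lambda>x. F x - G x)) x) (at t within {s..})"
          using DERIV_diff[OF e1[THEN conjunct2] e2[THEN conjunct2]] t
          by (auto intro: has_field_derivative_transform_within[where d = 1] simp: WD)
      qed
    qed
  qed
qed

lemma W_kernel_op_measurable:
  assumes st: "0 \<le> s" "s \<le> r" and k: "(\<lambda>(u, y). k u y) \<in> borel_measurable (borel \<Otimes>\<^sub>M borel)"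
  shows "(\<lambda>u. kernel_op W s r (k u) x) \<in> borel_measurable borel"
proof -
  interpret subprob_space "W s x r" using st by (rule W_subprob)
  have "sets (borel \<Otimes>\<^sub>M W s x r) = sets (borel \<Otimes>\<^sub>M borel)"
    using W_sets[OF st] by (intro sets_pair_measure_cong) auto
  then have "(\<lambda>(u, y). k u y) \<in> borel_measurable (borel \<Otimes>\<^sub>M W s x r)"
    using k measurable_cong_sets by blast
  then show ?thesis unfolding kernel_op_def by (rule borel_measurable_lebesgue_integral)
qed

text \<open>Exchanges the time integral of \<open>approx_increment\<close> with the integral against the kernel \<open>W\<close>.\<close>

lemma W_Fubini_interval:
  fixes k :: "real \<Rightarrow> 'a \<Rightarrow> real"
  assumes st: "0 \<le> s" "s \<le> r" and k: "(\<lambda>(u, y). k u y) \<in> borel_measurable (borel \<Otimes>\<^sub>M borel)"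
    and b: "\<And>u y. u \<in> {a..b} \<Longrightarrow> \<bar>k u y\<bar> \<le> B"
  shows "kernel_op W s r (\<lambda>y. LINT u:{a..b}|lborel. k u y) x = (LINT u:{a..b}|lborel. kernel_op W s r (k u) x)"
proof -
  interpret S: subprob_space "W s x r" using st by (rule W_subprob)
  interpret pair_sigma_finite lborel "W s x r" ..
  have sets_eq: "sets ((lborel :: real measure) \<Otimes>\<^sub>M W s x r) = sets (borel \<Otimes>\<^sub>M borel)"
    using W_sets[OF st] by (intro sets_pair_measure_cong) auto
  have "(\<lambda>(u, y). indicator {a..b} u * k u y) \<in> borel_measurable (borel \<Otimes>\<^sub>M borel)"
  proof -
    have "(\<lambda>p. k (fst p) (snd p)) \<in> borel_measurable (borel \<Otimes>\<^sub>M borel)"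
      using k by (simp add: case_prod_unfold)
    moreover have "(\<lambda>p :: real \<times> 'a. indicat_real {a..b} (fst p)) \<in> borel_measurable (borel \<Otimes>\<^sub>M borel)"
      by (rule measurable_compose[OF measurable_fst]) simp
    ultimately show ?thesis unfolding case_prod_unfold by (rule borel_measurable_times[rotated])
  qed
  then have meas: "(\<lambda>(u, y). indicator {a..b} u * k u y) \<in> borel_measurable (lborel \<Otimes>\<^sub>M W s x r)"
    by (subst measurable_cong_sets[OF sets_eq refl])
  have int: "integrable (lborel \<Otimes>\<^sub>M W s x r) (\<lambda>(u, y). indicator {a..b} u * k u y)"
  proof (rule integrableI_bounded_set[where A = "{a..b} \<times> UNIV" and B = B])
    have sp: "space (W s x r) = UNIV" using sets_eq_imp_space_eq[OF W_sets[OF st]] by simp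
    show "{a..b} \<times> UNIV \<in> sets (lborel \<Otimes>\<^sub>M W s x r)"
      using W_sets[OF st] by (intro pair_measureI) auto
    have "emeasure (lborel \<Otimes>\<^sub>M W s x r) ({a..b} \<times> UNIV) = emeasure lborel {a..b} * emeasure (W s x r) UNIV"
      using W_sets[OF st] by (intro S.emeasure_pair_measure_Times) auto
    moreover have "emeasure (W s x r) UNIV < \<top>"
      using S.emeasure_finite[of UNIV] by (simp only: less_top)
    moreover have "emeasure lborel {a..b} < \<top>"
      by (simp add: emeasure_lborel_Icc_eq)
    ultimately show "emeasure (lborel \<Otimes>\<^sub>M W s x r) ({a..b} \<times> UNIV) < \<infinity>"
      by (simp only: ennreal_mult_less_top infinity_ennreal_def simp_thms)
    show "AE p in lborel \<Otimes>\<^sub>M W s x r. p \<in> {a..b} \<times> UNIV \<longrightarrow>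
        norm (case p of (u, y) \<Rightarrow> indicat_real {a..b} u * k u y) \<le> B"
      using b by (intro AE_I2) (auto simp: indicator_def)
    show "AE p in lborel \<Otimes>\<^sub>M W s x r. p \<notin> {a..b} \<times> UNIV \<longrightarrow>
        (case p of (u, y) \<Rightarrow> indicat_real {a..b} u * k u y) = 0"
      by (intro AE_I2) (auto simp: indicator_def)
  qed (rule meas)
  have "kernel_op W s r (\<lambda>y. LINT u:{a..b}|lborel. k u y) x = (\<integral>y. (\<integral>u. indicator {a..b} u * k u y \<partial>lborel) \<partial>W s x r)"
    by (simp add: kernel_op_def set_lebesgue_integral_def)
  also have "\<dots> = (\<integral>u. (\<integral>y. indicator {a..b} u * k u y \<partial>W s x r) \<partial>lborel)"
    by (rule Fubini_integral[OF int])
  also have "\<dots> = (LINT u:{a..b}|lborel. kernel_op W s r (k u) x)"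
    by (simp add: kernel_op_def set_lebesgue_integral_def)
  finally show ?thesis .
qed

context
  fixes F :: "'a \<Rightarrow> real" and M :: real and n :: nat and s t :: real and x :: 'a
  assumes F_cont: "continuous_on UNIV F" and F_nonneg: "\<And>x. 0 \<le> F x" and F_le: "\<And>x. F x \<le> M"
    and fwd: "\<And>F. F \<in> Cb \<Longrightarrow> solves_forward Q W F"
    and s: "0 \<le> s" and st: "s < t"
begin

text \<open>For an approximation \<open>G(r) = approx F (Suc n) r t\<close> the product \<open>W(s, r) G(r)\<close> is shown to be
  nondecreasing in \<open>r\<close>. Formally its derivative is \<open>W(s, r) (L(r) G(r) + \<partial>\<^sub>r G(r))\<close>, and
  \<open>L(r) G(r) \<ge> - \<partial>\<^sub>r G(r)\<close> by the form of the iteration. Since the forward equation holds only outside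
  a null set that depends on the test function, it is applied on the intervals of a fine partition, to
  the value of \<open>G\<close> at the right end point.

  \<open>approx_decay\<close> is \<open>- \<partial>\<^sub>u G(u)\<close>. Unlike \<open>L(u) G(r)\<close> it is a bounded continuous function, because
  the factor \<open>cutoff n\<close> and the support of \<open>G\<close> confine it to a set where the rate is bounded.\<close>

definition approx_decay :: "real \<Rightarrow> 'a \<Rightarrow> real" where
  "approx_decay u y = cutoff n y * Q_op Q u (approx F n u t) y - rate Q u y * approx F (Suc n) u t y"

definition pairing :: "real \<Rightarrow> real" where
  "pairing r = kernel_op W s r (approx F (Suc n) r t) x"

lemmas approx_regular = regular[OF F_cont F_nonneg F_le]
lemmas approx_in_Cb = approx_Cb[OF F_cont F_nonneg F_le]

lemma approx_support: "real n + 1 \<le> V y \<Longrightarrow> approx F (Suc n) u t y = 0"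
  using regularD(4)[OF F_cont F_nonneg F_le approx_regular, of "Suc n" y u t] by simp

lemma approx_decay_continuous: "continuous_on UNIV (\<lambda>(u, y). approx_decay u y)"
proof -
  have a: "continuous_on UNIV (\<lambda>p. case p of (r, t, x) \<Rightarrow> approx F (Suc n) r t x)"
    by (rule continuous_approx[OF F_cont F_nonneg F_le])
  have "continuous_on UNIV (\<lambda>p::real \<times> 'a. (\<lambda>(r, t, x). approx F (Suc n) r t x) (fst p, t, snd p))"
    by (rule continuous_on_compose2[OF a]) (auto intro!: continuous_intros)
  moreover have "continuous_on UNIV (\<lambda>p::real \<times> 'a. cutoff n (snd p))"
    by (rule continuous_on_compose2[OF continuous_cutoff]) (auto intro!: continuous_intros)
  moreover have "continuous_on UNIV (\<lambda>p. Q_op Q (fst p) (approx F n (fst p) t) (snd p))"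
    using regular_Q_op(1)[OF F_cont F_nonneg F_le approx_regular, of n t] by (simp add: case_prod_unfold)
  moreover have "continuous_on UNIV (\<lambda>p. rate Q (fst p) (snd p))"
    using continuous_rate by (simp add: case_prod_unfold)
  ultimately show ?thesis
    unfolding approx_decay_def case_prod_unfold by (auto intro!: continuous_intros)
qed

lemma approx_decay_measurable: "(\<lambda>(u, y). approx_decay u y) \<in> borel_measurable (borel \<Otimes>\<^sub>M borel)"
  unfolding borel_prod by (rule borel_measurable_continuous_onI[OF approx_decay_continuous])

lemma forward_rate_bound:
  obtains A where "0 \<le> A" "\<And>u y. u \<le> t \<Longrightarrow> V y < real n + 1 \<Longrightarrow> rate Q u y \<le> A"
proof -
  obtain a where a: "a > 0" "\<And>r y. r \<le> t \<Longrightarrow> rate Q r y \<le> a * V y" using rate_le[of t] by blast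
  show thesis
  proof (rule that[of "a * (real n + 1)"])
    fix u y assume "u \<le> t" "V y < real n + 1"
    then show "rate Q u y \<le> a * (real n + 1)"
      using a(2)[of u y] mult_left_mono[of "V y" "real n + 1" a] a(1) by linarith
  qed (use a in auto)
qed

lemma approx_decay_bound:
  obtains B where "0 \<le> B" "\<And>u y. u \<le> t \<Longrightarrow> \<bar>approx_decay u y\<bar> \<le> B"
proof -
  obtain A where A: "0 \<le> A" "\<And>u y. u \<le> t \<Longrightarrow> V y < real n + 1 \<Longrightarrow> rate Q u y \<le> A" using forward_rate_bound by blast
  have M0: "0 \<le> M" by (rule test_bound_nonneg[OF F_cont F_nonneg F_le])
  have "\<bar>approx_decay u y\<bar> \<le> A * M" if u: "u \<le> t" for u y
  proof (cases "V y < real n + 1")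
    case True
    note r = A(2)[OF u True]
    have q: "0 \<le> Q_op Q u (approx F n u t) y" "Q_op Q u (approx F n u t) y \<le> M * rate Q u y"
      by (rule regular_Q_op(2,3)[OF F_cont F_nonneg F_le approx_regular])+
    have q2: "Q_op Q u (approx F n u t) y \<le> A * M" using q(2) mult_left_mono[OF r M0] by (simp add: mult.commute)
    have 1: "0 \<le> cutoff n y * Q_op Q u (approx F n u t) y" "cutoff n y * Q_op Q u (approx F n u t) y \<le> 1 * (A * M)"
    proof -
      show "0 \<le> cutoff n y * Q_op Q u (approx F n u t) y" using q by simp
      show "cutoff n y * Q_op Q u (approx F n u t) y \<le> 1 * (A * M)"
        by (rule mult_mono[OF cutoff_le_1 q2]) (use q in auto)
    qed
    have 2: "0 \<le> rate Q u y * approx F (Suc n) u t y" "rate Q u y * approx F (Suc n) u t y \<le> A * M"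
      using r A(1) approx_nonneg[OF F_cont F_nonneg F_le] approx_le[OF F_cont F_nonneg F_le] by (auto intro!: mult_mono)
    show ?thesis unfolding approx_decay_def using 1 2 by linarith
  next
    case False
    then show ?thesis using A M0 by (simp add: approx_decay_def cutoff_eq_0 approx_support)
  qed
  then show thesis using A M0 by (intro that[of "A * M"]) auto
qed

lemma approx_decay_Cb: "u \<le> t \<Longrightarrow> approx_decay u \<in> Cb"
  using approx_decay_bound continuous_on_slices(2)[OF approx_decay_continuous, of u]
  by (auto simp: Cb_def bounded_iff) (metis)

text \<open>For \<open>r = u\<close> the difference is the gain by jumps that the cut-off and the previous iterate suppress; for
  \<open>r \<noteq> u\<close> the Lipschitz bounds of two consecutive iterates enter, again only where the rate is bounded.
  There is no upper bound of this kind: \<open>Q(u) G(r)\<close> may be unbounded.\<close>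

lemma L_op_approx_ge:
  obtains C where "0 \<le> C" "\<And>u r y. \<lbrakk>u \<le> t; r \<le> t\<rbrakk> \<Longrightarrow> approx_decay u y - C * \<bar>r - u\<bar> \<le> L_op Q u (approx F (Suc n) r t) y"
proof -
  note ctx = F_cont F_nonneg F_le
  obtain A where A: "0 \<le> A" "\<And>u y. u \<le> t \<Longrightarrow> V y < real n + 1 \<Longrightarrow> rate Q u y \<le> A" using forward_rate_bound by blast
  obtain L1 where L1: "0 \<le> L1" "\<And>r r' t' t'' y. \<lbrakk>t' \<le> t; t'' \<le> t\<rbrakk> \<Longrightarrow>
        \<bar>approx F n r t' y - approx F n r' t'' y\<bar> \<le> L1 * (\<bar>r - r'\<bar> + \<bar>t' - t''\<bar>)"
    using regular_lipschitz[OF ctx approx_regular[of n], where T = t] by metis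
  obtain L2 where L2: "0 \<le> L2" "\<And>r r' t' t'' y. \<lbrakk>t' \<le> t; t'' \<le> t\<rbrakk> \<Longrightarrow>
        \<bar>approx F (Suc n) r t' y - approx F (Suc n) r' t'' y\<bar> \<le> L2 * (\<bar>r - r'\<bar> + \<bar>t' - t''\<bar>)"
    using regular_lipschitz[OF ctx approx_regular[of "Suc n"], where T = t] by metis
  have "approx_decay u y - A * (L1 + L2) * \<bar>r - u\<bar> \<le> L_op Q u (approx F (Suc n) r t) y" if ur: "u \<le> t" "r \<le> t" for u r y
  proof -
    have L: "L_op Q u (approx F (Suc n) r t) y =
        Q_op Q u (approx F (Suc n) r t) y - rate Q u y * approx F (Suc n) r t y"
      by (rule L_op_eq[OF Cb_BM_V[OF approx_in_Cb]])
    have Qm: "Q_op Q u (approx F n r t) y \<le> Q_op Q u (approx F (Suc n) r t) y"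
      by (intro Q_op_mono Cb_BM_V approx_in_Cb approx_mono[OF ctx])
    have Q0: "0 \<le> Q_op Q u (approx F n r t) y"
      by (intro Q_op_nonneg approx_nonneg[OF ctx])
    show ?thesis
    proof (cases "V y < real n + 1")
      case True
      note rA = A(2)[OF ur(1) True]
      have "\<bar>Q_op Q u (\<lambda>z. approx F n u t z - approx F n r t z) y\<bar> \<le> L1 * \<bar>r - u\<bar> * rate Q u y"
        using BM_V_lincomb[OF Cb_BM_V[OF approx_in_Cb[of n u t]] Cb_BM_V[OF approx_in_Cb[of n r t]], of 1 "-1"] L1(2)[of t t u _ r]
        by (intro Q_op_bounded_le) (auto simp: abs_minus_commute)
      also have "\<dots> \<le> L1 * \<bar>r - u\<bar> * A" using rA L1(1) by (intro mult_left_mono) auto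
      finally have d1: "Q_op Q u (approx F n u t) y - Q_op Q u (approx F n r t) y \<le> L1 * \<bar>r - u\<bar> * A"
        by (simp add: Q_op_diff Cb_BM_V approx_in_Cb)
      have "cutoff n y * Q_op Q u (approx F n u t) y \<le> cutoff n y * (Q_op Q u (approx F n r t) y + L1 * \<bar>r - u\<bar> * A)"
        using d1 by (intro mult_left_mono) auto
      also have "\<dots> \<le> 1 * (Q_op Q u (approx F n r t) y + L1 * \<bar>r - u\<bar> * A)"
        using Q0 L1(1) A(1) by (intro mult_right_mono) auto
      finally have 1: "cutoff n y * Q_op Q u (approx F n u t) y \<le> Q_op Q u (approx F (Suc n) r t) y + L1 * \<bar>r - u\<bar> * A"
        using Qm unfolding mult_1_left by linarith
      have "approx F (Suc n) r t y - approx F (Suc n) u t y \<le> L2 * \<bar>r - u\<bar>"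
        using L2(2)[of t t r y u] by simp
      then have "rate Q u y * (approx F (Suc n) r t y - approx F (Suc n) u t y) \<le> rate Q u y * (L2 * \<bar>r - u\<bar>)"
        by (intro mult_left_mono) auto
      also have "\<dots> \<le> A * (L2 * \<bar>r - u\<bar>)" using rA L2(1) by (intro mult_right_mono) auto
      finally have 2: "rate Q u y * approx F (Suc n) r t y - rate Q u y * approx F (Suc n) u t y \<le> A * (L2 * \<bar>r - u\<bar>)"
        by (simp add: right_diff_distrib)
      have 3: "A * (L1 + L2) * \<bar>r - u\<bar> = L1 * \<bar>r - u\<bar> * A + A * (L2 * \<bar>r - u\<bar>)" by (simp add: algebra_simps)
      show ?thesis unfolding L approx_decay_def 3 using 1 2 by linarith
    next
      case False
      then have "0 \<le> L_op Q u (approx F (Suc n) r t) y" "approx_decay u y = 0"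
        using Qm Q0 by (auto simp: L approx_decay_def cutoff_eq_0 approx_support)
      then show ?thesis using A L1 L2 by (simp add: order_trans[OF _ \<open>0 \<le> L_op _ _ _ _\<close>])
    qed
  qed
  then show thesis using A L1 L2 by (intro that[of "A * (L1 + L2)"]) auto
qed

text \<open>Outside \<open>[s, t]\<close> the kernels and bounds are not controlled, so times are projected onto it.\<close>

definition clamp_time :: "real \<Rightarrow> real" where "clamp_time u = max s (min t u)"

text \<open>The decay at time \<open>u\<close> averaged against the kernel at time \<open>r\<close>. On a partition interval the kernel
  stays at the left end point \<open>r\<close> while \<open>u\<close> runs through the interval.\<close>

definition decay_mean :: "real \<Rightarrow> real \<Rightarrow> real" where "decay_mean r u = kernel_op W s r (approx_decay (clamp_time u)) x"

lemma clamp_time_range: "s \<le> clamp_time u" "clamp_time u \<le> t" "0 \<le> clamp_time u"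
  using st s by (auto simp: clamp_time_def)

lemma clamp_time_id: "s \<le> u \<Longrightarrow> u \<le> t \<Longrightarrow> clamp_time u = u"
  by (simp add: clamp_time_def)

lemma decay_mean_measurable: "s \<le> r \<Longrightarrow> decay_mean r \<in> borel_measurable borel"
proof -
  assume r: "s \<le> r"
  have [measurable]: "clamp_time \<in> borel_measurable borel" unfolding clamp_time_def by measurable
  note approx_decay_measurable[measurable]
  have "(\<lambda>p. (\<lambda>(u, y). approx_decay u y) (clamp_time (fst p), snd p)) \<in> borel_measurable (borel \<Otimes>\<^sub>M borel)"
    by measurable
  then have "(\<lambda>(u, y). approx_decay (clamp_time u) y) \<in> borel_measurable (borel \<Otimes>\<^sub>M borel)"
    by (simp add: case_prod_unfold)
  then show "decay_mean r \<in> borel_measurable borel"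
    unfolding decay_mean_def by (rule W_kernel_op_measurable[OF s r])
qed

lemma decay_mean_continuous: "continuous_on {s..} (\<lambda>r. decay_mean r u)"
  unfolding decay_mean_def by (intro W_continuous_end s approx_decay_Cb clamp_time_range)

text \<open>The left end point of the partition interval of length \<open>(t - s) / N\<close> that contains \<open>u\<close>,
  for \<open>u\<close> in \<open>[s, t)\<close>.\<close>

definition grid_point :: "nat \<Rightarrow> real \<Rightarrow> real" where
  "grid_point N u = clamp_time (s + (t - s) / real N * of_int \<lfloor>(u - s) / ((t - s) / real N)\<rfloor>)"

lemma decay_mean_grid_point_measurable: "(\<lambda>u. decay_mean (grid_point N u) u) \<in> borel_measurable borel"
proof -
  have "(\<lambda>u. (\<lambda>i u. decay_mean (clamp_time (s + (t - s) / real N * of_int i)) u) \<lfloor>(u - s) / ((t - s) / real N)\<rfloor> u)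
      \<in> borel_measurable borel"
  proof (rule measurable_compose_countable)
    show "(\<lambda>u. decay_mean (clamp_time (s + (t - s) / real N * of_int i)) u) \<in> borel_measurable borel" for i
      by (rule decay_mean_measurable[OF clamp_time_range(1)])
  qed measurable
  then show ?thesis by (simp add: grid_point_def)
qed

lemma grid_point_tendsto: "(\<lambda>N. grid_point (Suc N) u) \<longlonglongrightarrow> clamp_time u"
proof -
  have "(\<lambda>N. s + (t - s) / real (Suc N) * of_int \<lfloor>(u - s) / ((t - s) / real (Suc N))\<rfloor>) \<longlonglongrightarrow> u"
  proof (rule LIM_zero_cancel, rule Lim_null_comparison)
    show "\<forall>\<^sub>F N in sequentially. norm (s + (t - s) / real (Suc N) * of_int \<lfloor>(u - s) / ((t - s) / real (Suc N))\<rfloor> - u)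
        \<le> (t - s) * inverse (real (Suc N))"
    proof (rule always_eventually, rule allI)
      fix N
      define d where "d = (t - s) / real (Suc N)"
      have d: "d > 0" using st by (simp add: d_def)
      define z where "z = (u - s) / d"
      have z: "u = s + d * z" using d by (simp add: z_def)
      have "\<bar>of_int \<lfloor>z\<rfloor> - z\<bar> \<le> 1" by linarith
      then have "d * \<bar>of_int \<lfloor>z\<rfloor> - z\<bar> \<le> d * 1" using d by (intro mult_left_mono) auto
      then have "norm (s + d * of_int \<lfloor>z\<rfloor> - u) \<le> d"
        using d unfolding z by (simp add: right_diff_distrib[symmetric] abs_mult)
      then show "norm (s + (t - s) / real (Suc N) * of_int \<lfloor>(u - s) / ((t - s) / real (Suc N))\<rfloor> - u)
        \<le> (t - s) * inverse (real (Suc N))"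
        by (simp add: d_def z_def divide_inverse)
    qed
    show "(\<lambda>N. (t - s) * inverse (real (Suc N))) \<longlonglongrightarrow> 0"
      using tendsto_mult_right_zero[OF LIMSEQ_inverse_real_of_nat] by blast
  qed
  then show ?thesis unfolding grid_point_def clamp_time_def by (intro tendsto_intros)
qed

lemma decay_mean_grid_point_tendsto: "(\<lambda>N. decay_mean (grid_point (Suc N) u) u) \<longlonglongrightarrow> decay_mean (clamp_time u) u"
  by (rule continuous_on_tendsto_compose[OF decay_mean_continuous grid_point_tendsto])
     (auto simp: grid_point_def clamp_time_range)

lemma decay_mean_diag_measurable: "(\<lambda>u. decay_mean (clamp_time u) u) \<in> borel_measurable borel"
  by (rule borel_measurable_LIMSEQ_real[OF decay_mean_grid_point_tendsto decay_mean_grid_point_measurable])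

text \<open>The increment is split into the change of the kernel with \<open>G(r')\<close> fixed, bounded below by the forward
  equation and \<open>L_op_approx_ge\<close>, and the change of \<open>G\<close> under the fixed kernel \<open>W(s, r)\<close>, given exactly by
  \<open>approx_increment\<close>. What remains is the decay averaged against the kernel at time \<open>u\<close> minus the one at
  time \<open>r\<close>, and an error of second order in the length.\<close>

lemma pairing_increment_ge:
  obtains C where "0 \<le> C" "\<And>r r'. \<lbrakk>s \<le> r; r \<le> r'; r' \<le> t\<rbrakk> \<Longrightarrow>
    (LINT u:{r..r'}|lborel. decay_mean (clamp_time u) u - decay_mean r u) - C * (r' - r) * (r' - r) \<le> pairing r' - pairing r"
proof -
  note ctx = F_cont F_nonneg F_le
  obtain C where C: "0 \<le> C" "\<And>u r y. \<lbrakk>u \<le> t; r \<le> t\<rbrakk> \<Longrightarrow>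
      approx_decay u y - C * \<bar>r - u\<bar> \<le> L_op Q u (approx F (Suc n) r t) y" using L_op_approx_ge by blast
  obtain B where B: "0 \<le> B" "\<And>u y. u \<le> t \<Longrightarrow> \<bar>approx_decay u y\<bar> \<le> B" using approx_decay_bound by blast
  have decay_mean_B: "\<bar>decay_mean r u\<bar> \<le> B" if "s \<le> r" for r u
    unfolding decay_mean_def using that s B(2)[OF clamp_time_range(2)] by (intro W_abs_le) auto
  have main: "(LINT u:{r..r'}|lborel. decay_mean (clamp_time u) u - decay_mean r u) - C * (r' - r) * (r' - r) \<le> pairing r' - pairing r"
    if r: "s \<le> r" "r \<le> r'" "r' \<le> t" for r r'
  proof -
    let ?g = "approx F (Suc n) r' t"
    let ?v = "\<lambda>u. kernel_op W s u ?g x"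
    define m where "m = (\<lambda>u. decay_mean (clamp_time u) u - C * (r' - r))"
    have m: "m \<in> borel_measurable borel" unfolding m_def using decay_mean_diag_measurable by measurable
    have mb: "\<bar>m u\<bar> \<le> B + C * (r' - r)" for u
      using decay_mean_B[OF clamp_time_range(1), of u u] C(1) r by (auto simp: m_def intro!: abs_triangle_ineq4[THEN order_trans])
    have sf: "solves_forward Q W ?g" by (intro fwd approx_in_Cb)
    have i1: "(LINT u:{r..r'}|lborel. m u) \<le> ?v r' - ?v r"
    proof (rule abs_continuous_on_increment_ge[OF r(2) _ m mb])
      have "abs_continuous_on s (t + 1) ?v" using sf s st unfolding solves_forward_def by auto
      then show "abs_continuous_on r r' ?v" by (rule abs_continuous_on_subset) (use r in auto)
      have "AE u in lborel. s \<le> u \<longrightarrow> integrable (W s x u) (L_op Q u ?g) \<and>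
        ((\<lambda>u. ?v u) has_real_derivative kernel_op W s u (L_op Q u ?g) x) (at u within {s..})"
        using sf s unfolding solves_forward_def by blast
      then show "AE u in lborel. u \<in> {r..r'} \<longrightarrow> (\<exists>D\<ge>m u. (?v has_real_derivative D) (at u within {r..r'}))"
      proof eventually_elim
        case (elim u)
        show ?case
        proof
          assume u: "u \<in> {r..r'}"
          then have su: "s \<le> u" "u \<le> t" using r by auto
          note e = elim[rule_format, OF su(1)]
          interpret subprob_space "W s x u" using s su(1) by (rule W_subprob)
          have int: "integrable (W s x u) (approx_decay u)"
            by (rule W_integrable[OF s su(1) approx_decay_Cb[OF su(2)]])
          have c: "C * (r' - r) * measure (W s x u) UNIV \<le> C * (r' - r)"
            using C(1) r subprob_measure_le_1[of UNIV] by (intro mult_left_le) auto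
          have "m u = kernel_op W s u (approx_decay u) x - C * (r' - r)"
            using su by (simp add: m_def decay_mean_def clamp_time_id)
          also have "\<dots> \<le> kernel_op W s u (approx_decay u) x - C * (r' - r) * measure (W s x u) UNIV"
            using c by simp
          also have "\<dots> = (\<integral>y. approx_decay u y - C * (r' - r) \<partial>W s x u)"
            using int sets_eq_imp_space_eq[OF W_sets[OF s su(1), of x]]
            by (simp add: kernel_op_def)
          also have "\<dots> \<le> (\<integral>y. L_op Q u ?g y \<partial>W s x u)"
          proof (rule integral_mono)
            fix y
            have "C * \<bar>r' - u\<bar> \<le> C * (r' - r)" using u C(1) by (intro mult_left_mono) auto
            then show "approx_decay u y - C * (r' - r) \<le> L_op Q u ?g y"
              using C(2)[of u r' y] su r by linarith
          qed (use int e in auto)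
          finally have "m u \<le> kernel_op W s u (L_op Q u ?g) x" by (simp add: kernel_op_def)
          moreover have "(?v has_real_derivative kernel_op W s u (L_op Q u ?g) x) (at u within {r..r'})"
            using e r by (intro DERIV_subset[OF conjunct2[OF e]]) auto
          ultimately show "\<exists>D\<ge>m u. (?v has_real_derivative D) (at u within {r..r'})" by blast
        qed
      qed
    qed
    have intc: "set_integrable lborel {r..r'} (\<lambda>u. decay_mean (clamp_time u) u)"
      using decay_mean_B[OF clamp_time_range(1)] by (intro set_integrable_bounded_interval[where M = B] decay_mean_diag_measurable)
    have intr: "set_integrable lborel {r..r'} (decay_mean r)"
      using decay_mean_B[OF r(1)] by (intro set_integrable_bounded_interval[where M = B] decay_mean_measurable r)
    have "(LINT u:{r..r'}|lborel. m u) = (LINT u:{r..r'}|lborel. decay_mean (clamp_time u) u) - (LINT u:{r..r'}|lborel. C * (r' - r))"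
      unfolding m_def by (intro set_integral_diff(2) intc set_integrable_bounded_interval[where M = "\<bar>C * (r' - r)\<bar>"]) auto
    also have "(LINT u:{r..r'}|lborel. C * (r' - r)) = C * (r' - r) * (r' - r)"
      using r by (simp add: set_lebesgue_integral_def)
    finally have i2: "(LINT u:{r..r'}|lborel. m u) = (LINT u:{r..r'}|lborel. decay_mean (clamp_time u) u) - C * (r' - r) * (r' - r)" .
    have i3: "?v r - pairing r = - (LINT u:{r..r'}|lborel. decay_mean r u)"
    proof -
      have "?v r - pairing r = kernel_op W s r (\<lambda>y. approx F (Suc n) r' t y - approx F (Suc n) r t y) x"
        unfolding pairing_def using s r by (simp add: W_diff approx_in_Cb)
      also have "(\<lambda>y. approx F (Suc n) r' t y - approx F (Suc n) r t y) = (\<lambda>y. LINT u:{r..r'}|lborel. - approx_decay u y)"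
        unfolding approx_increment[OF ctx r(2,3)] approx_decay_def by simp
      also have "kernel_op W s r \<dots> x = (LINT u:{r..r'}|lborel. kernel_op W s r (\<lambda>y. - approx_decay u y) x)"
      proof (rule W_Fubini_interval[OF s r(1), where B = B])
        show "(\<lambda>(u, y). - approx_decay u y) \<in> borel_measurable (borel \<Otimes>\<^sub>M borel)"
          using approx_decay_measurable by (simp add: case_prod_unfold)
      qed (use B(2) r in auto)
      also have "\<dots> = (LINT u:{r..r'}|lborel. - decay_mean r u)"
        using r by (intro set_lebesgue_integral_cong) (auto simp: decay_mean_def kernel_op_def clamp_time_id)
      finally show ?thesis by (simp add: set_lebesgue_integral_def)
    qed
    have "(LINT u:{r..r'}|lborel. decay_mean (clamp_time u) u - decay_mean r u) =
        (LINT u:{r..r'}|lborel. decay_mean (clamp_time u) u) - (LINT u:{r..r'}|lborel. decay_mean r u)"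
      by (rule set_integral_diff(2)[OF intc intr])
    moreover have "?v r' = pairing r'" by (simp add: pairing_def)
    ultimately show ?thesis using i1 i2 i3 by linarith
  qed
  show thesis by (rule that[OF C(1) main])
qed

text \<open>Summation over the partition into \<open>N\<close> intervals. The second-order errors add up to a multiple of
  \<open>1 / N\<close>, and the averages against the kernel at the left end point converge to those at time \<open>u\<close> by the
  Feller property and dominated convergence.\<close>

lemma pairing_mono: "pairing s \<le> pairing t"
proof -
  obtain C where C: "0 \<le> C" "\<And>r r'. \<lbrakk>s \<le> r; r \<le> r'; r' \<le> t\<rbrakk> \<Longrightarrow>
    (LINT u:{r..r'}|lborel. decay_mean (clamp_time u) u - decay_mean r u) - C * (r' - r) * (r' - r) \<le> pairing r' - pairing r"
    using pairing_increment_ge by blast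
  obtain B where B: "0 \<le> B" "\<And>u y. u \<le> t \<Longrightarrow> \<bar>approx_decay u y\<bar> \<le> B" using approx_decay_bound by blast
  have decay_mean_B: "\<bar>decay_mean r u\<bar> \<le> B" if "s \<le> r" for r u
    unfolding decay_mean_def using that s B(2)[OF clamp_time_range(2)] by (intro W_abs_le) auto
  define e where "e = (\<lambda>N u. decay_mean (clamp_time u) u - decay_mean (grid_point N u) u)"
  have e_meas[measurable]: "e N \<in> borel_measurable borel" for N
    unfolding e_def using decay_mean_diag_measurable decay_mean_grid_point_measurable by measurable
  have e_B: "\<bar>e N u\<bar> \<le> 2 * B" for N u
    using decay_mean_B[OF clamp_time_range(1), of u u] decay_mean_B[of "grid_point N u" u] clamp_time_range(1)
    by (auto simp: e_def grid_point_def)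
  have sum: "(LINT u:{s..t}|lborel. e (Suc N) u) - C * ((t - s) / real (Suc N)) * (t - s) \<le> pairing t - pairing s" for N
  proof -
    define d where "d = (t - s) / real (Suc N)"
    have d: "d > 0" using st by (simp add: d_def)
    have dN: "d * real (Suc N) = t - s" by (simp add: d_def)
    have int: "set_integrable lborel {a..b} (e (Suc N))" for a b
      using e_B by (intro set_integrable_bounded_interval[where M = "2 * B"]) auto
    have "(LINT u:{s..s + d * real i}|lborel. e (Suc N) u) - C * d * (d * real i) \<le> pairing (s + d * real i) - pairing s"
      if "i \<le> Suc N" for i
      using that
    proof (induction i)
      case 0
      have "(LINT u:{s..s}|lborel. e (Suc N) u) = 0"
        using abs_set_integral_interval_le[OF e_meas e_B, of s s "Suc N"] by simp
      then show ?case by simp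
    next
      case (Suc i)
      define r where "r = s + d * real i"
      define r' where "r' = s + d * real (Suc i)"
      have rr: "r' = r + d" by (simp add: r_def r'_def algebra_simps)
      have "d * real (Suc i) \<le> d * real (Suc N)" using Suc.prems d by (intro mult_left_mono) auto
      then have "r' \<le> t" using dN unfolding r'_def by linarith
      then have r: "s \<le> r" "r \<le> r'" "r' \<le> t" using d rr by (auto simp: r_def)
      have "(LINT u:{r..r'}|lborel. e (Suc N) u) = (LINT u:{r..r'}|lborel. decay_mean (clamp_time u) u - decay_mean r u)"
      proof (rule set_lebesgue_integral_cong_AE)
        have "AE u in lborel. u \<noteq> r'" by (rule AE_lborel_singleton)
        then show "AE u\<in>{r..r'} in lborel. e (Suc N) u = decay_mean (clamp_time u) u - decay_mean r u"
        proof eventually_elim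
          case (elim u)
          show ?case
          proof
            assume u: "u \<in> {r..r'}"
            have "\<lfloor>(u - s) / d\<rfloor> = int i"
            proof (rule floor_unique)
              show "of_int (int i) \<le> (u - s) / d" using u d by (simp add: r_def le_divide_eq mult.commute)
              show "(u - s) / d < of_int (int i) + 1"
                using u elim d by (simp add: r'_def divide_less_eq algebra_simps)
            qed
            then have "grid_point (Suc N) u = r"
              using r unfolding grid_point_def d_def[symmetric] by (simp add: r_def[symmetric] clamp_time_id)
            then show "e (Suc N) u = decay_mean (clamp_time u) u - decay_mean r u" by (simp add: e_def)
          qed
        qed
        show "(\<lambda>u. decay_mean (clamp_time u) u - decay_mean r u) \<in> borel_measurable lborel"
          using decay_mean_diag_measurable decay_mean_measurable[OF r(1)] by measurable
      qed auto
      then have "(LINT u:{r..r'}|lborel. e (Suc N) u) - C * d * d \<le> pairing r' - pairing r"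
        using C(2)[OF r] rr by simp
      moreover have "(LINT u:{s..r'}|lborel. e (Suc N) u) = (LINT u:{s..r}|lborel. e (Suc N) u) + (LINT u:{r..r'}|lborel. e (Suc N) u)"
        by (rule set_integral_interval_split[OF int r(1,2)])
      moreover have "(LINT u:{s..r}|lborel. e (Suc N) u) - C * d * (d * real i) \<le> pairing r - pairing s"
        using Suc by (simp add: r_def)
      moreover have "C * d * (d * real (Suc i)) = C * d * (d * real i) + C * d * d" by (simp add: algebra_simps)
      ultimately show ?case unfolding r'_def[symmetric] by linarith
    qed
    from this[of "Suc N"] show ?thesis unfolding d_def[symmetric] dN by simp
  qed
  have l1: "(\<lambda>N. LINT u:{s..t}|lborel. e (Suc N) u) \<longlonglongrightarrow> (LINT u:{s..t}|lborel. (0::real))"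
    unfolding set_lebesgue_integral_def
  proof (rule integral_dominated_convergence[where w = "\<lambda>u. indicator {s..t} u * (2 * B)"])
    show "integrable lborel (\<lambda>u. indicator {s..t} u * (2 * B))"
      using set_integrable_bounded_interval[of "\<lambda>_. 2 * B" s t "2 * B"] B(1) by (simp add: set_integrable_def)
    show "AE u in lborel. (\<lambda>N. indicat_real {s..t} u *\<^sub>R e (Suc N) u) \<longlonglongrightarrow> indicat_real {s..t} u *\<^sub>R 0"
    proof (intro AE_I2)
      fix u
      have "(\<lambda>N. e (Suc N) u) \<longlonglongrightarrow> 0"
        unfolding e_def using tendsto_diff[OF tendsto_const decay_mean_grid_point_tendsto, of "decay_mean (clamp_time u) u" u] by simp
      then show "(\<lambda>N. indicat_real {s..t} u *\<^sub>R e (Suc N) u) \<longlonglongrightarrow> indicat_real {s..t} u *\<^sub>R 0"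
        by (intro tendsto_intros)
    qed
    show "AE u in lborel. norm (indicat_real {s..t} u *\<^sub>R e (Suc N) u) \<le> indicat_real {s..t} u * (2 * B)" for N
      using e_B by (intro AE_I2) (auto simp: indicator_def)
  qed measurable
  have l2: "(\<lambda>N. C * ((t - s) / real (Suc N)) * (t - s)) \<longlonglongrightarrow> C * 0 * (t - s)"
    using LIMSEQ_inverse_real_of_nat
    by (intro tendsto_intros) (auto simp: divide_inverse intro!: tendsto_mult_right_zero)
  have "(LINT u:{s..t}|lborel. (0::real)) - C * 0 * (t - s) \<le> pairing t - pairing s"
    by (rule tendsto_upperbound[OF tendsto_diff[OF l1 l2]]) (use sum in auto)
  then show ?thesis by simp
qed

text \<open>The product starts with the value of the approximation, because \<open>W(s, s)\<close> is the identity, and ends at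
  most at \<open>W(s, t) F\<close>, because the approximation is at most \<open>F\<close> at time \<open>t\<close>.\<close>

lemma approx_le_W: "approx F (Suc n) s t x \<le> kernel_op W s t F x"
proof -
  note ctx = F_cont F_nonneg F_le
  have F: "F \<in> Cb" by (rule test_function_Cb[OF ctx])
  have "approx F (Suc n) s t x = pairing s"
    using W_refl[OF s approx_in_Cb[of "Suc n" s t]] by (simp add: pairing_def)
  also have "\<dots> \<le> pairing t" by (rule pairing_mono)
  also have "\<dots> \<le> kernel_op W s t F x"
    unfolding pairing_def kernel_op_def
  proof (intro integral_mono W_integrable s approx_in_Cb F)
    fix y
    show "approx F (Suc n) t t y \<le> F y"
      using approx_le_U[OF ctx, of "Suc n" t t y] U_trivial[OF Cb_BM_V[OF F], of t t] by simp
  qed (use st in auto)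
  finally show ?thesis .
qed

end

lemma W_forward_ge_U:
  assumes F: "F \<in> Cb" and F0: "\<And>x. 0 \<le> F x" and fwd: "\<And>F. F \<in> Cb \<Longrightarrow> solves_forward Q W F"
    and st: "0 \<le> s" "s \<le> t"
  shows "U s t F x \<le> kernel_op W s t F x"
proof (cases "s = t")
  case True
  then show ?thesis using st F by (simp add: W_refl U_trivial Cb_BM_V)
next
  case False
  obtain M where M: "\<And>x. \<bar>F x\<bar> \<le> M" using Cb_bounds[OF F] by blast
  have F': "continuous_on UNIV F" "\<And>x. F x \<le> M" using F M by (auto simp: Cb_def abs_le_iff)
  have "(\<lambda>n. approx F (Suc n) s t x) \<longlonglongrightarrow> U s t F x"
    using approx_tendsto_U[OF F'(1) F0 F'(2)] by (rule LIMSEQ_Suc)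
  then show ?thesis
    by (rule LIMSEQ_le_const2) (use approx_le_W[OF F'(1) F0 F'(2) fwd st(1)] False st in auto)
qed

text \<open>If \<open>W F\<close> violated the backward equation for one \<open>F\<close> and \<open>W G\<close> the forward equation for some \<open>G\<close>, then
  \<open>W (F + G)\<close> would satisfy one of the two, and by linearity so would \<open>W F\<close> or \<open>W G\<close>: a contradiction.
  Domination of \<open>U\<close> for nonnegative functions is then used twice.\<close>

theorem W_eq_U:
  assumes sol: "\<And>F. F \<in> Cb \<Longrightarrow> solves_backward Q W F \<or> solves_forward Q W F"
    and F: "F \<in> Cb" and st: "0 \<le> s" "s \<le> t"
  shows "kernel_op W s t F = U s t F"
proof -
  have sum: "(\<lambda>x. F x + G x) \<in> Cb" if "F \<in> Cb" "G \<in> Cb" for F G :: "'a \<Rightarrow> real"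
    using that unfolding Cb_def by (auto intro!: continuous_intros bounded_plus_comp)
  have "(\<forall>F\<in>Cb. solves_backward Q W F) \<or> (\<forall>F\<in>Cb. solves_forward Q W F)"
  proof (rule ccontr)
    assume "\<not> ?thesis"
    then obtain F G where FG: "F \<in> Cb" "\<not> solves_backward Q W F" "G \<in> Cb" "\<not> solves_forward Q W G" by blast
    then have FG': "solves_forward Q W F" "solves_backward Q W G" using sol by blast+
    have H: "(\<lambda>x. F x + G x) \<in> Cb" using FG sum by blast
    from sol[OF H] show False
    proof
      assume "solves_backward Q W (\<lambda>x. F x + G x)"
      from solves_backward_diff[OF H FG(3) this FG'(2)] show False using FG by simp
    next
      assume "solves_forward Q W (\<lambda>x. F x + G x)"
      from solves_forward_diff[OF H FG(1) this FG'(1)] show False using FG by simp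
    qed
  qed
  then have ge: "U s t G x \<le> kernel_op W s t G x" if "G \<in> Cb" "\<And>x. 0 \<le> G x" for G x
    using W_backward_ge_U[OF that _ st] W_forward_ge_U[OF that _ st] that(1) by blast
  obtain M where M: "0 \<le> M" "\<And>x. \<bar>F x\<bar> \<le> M" using Cb_bounds[OF F] by blast
  have const: "(\<lambda>x. M) \<in> Cb" by (simp add: Cb_def)
  have WM: "kernel_op W s t (\<lambda>_. M) x \<le> M" for x using W_abs_le[OF st, of "\<lambda>_. M" M x] M(1) by simp
  show ?thesis
  proof
    fix x
    have 1: "U s t (\<lambda>x. M - F x) x \<le> kernel_op W s t (\<lambda>x. M - F x) x"
    proof (rule ge[OF Cb_diff[OF const F]])
      show "0 \<le> M - F y" for y using M(2)[of y] by auto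
    qed
    then have "M - U s t F x \<le> M - kernel_op W s t F x"
      using U_diff[OF const_BM_V Cb_BM_V[OF F], of s t M x] W_diff[OF st const F, of x] WM[of x] by (simp add: U_const)
    moreover have "U s t (\<lambda>x. F x + M) x \<le> kernel_op W s t (\<lambda>x. F x + M) x"
    proof (rule ge[OF sum[OF F const]])
      show "0 \<le> F y + M" for y using M(2)[of y] by auto
    qed
    moreover have "kernel_op W s t (\<lambda>x. F x + M) x = kernel_op W s t F x + kernel_op W s t (\<lambda>_. M) x"
      unfolding kernel_op_def by (intro Bochner_Integration.integral_add W_integrable st F const)
    ultimately show "kernel_op W s t F x = U s t F x"
      using WM[of x] U_add_const[OF Cb_BM_V[OF F], of s t M x] by simp
  qed
qed

end

end

section \<open>Restriction to nonnegative times\<close>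

lemma kernel_op_cong: "P s = P' s \<Longrightarrow> kernel_op P s t F = kernel_op P' s t F"
  by (simp add: kernel_op_def fun_eq_iff)

lemma evolution_system_cong:
  assumes "\<And>s t. 0 \<le> s \<Longrightarrow> U s t = U' s t" and "evolution_system X N U"
  shows "evolution_system X N U'"
proof -
  have "U s r (U r t F) = U' s r (U' r t F)" if "0 \<le> s" "s \<le> r" for s r t F
    using assms(1) that by simp
  then show ?thesis using assms unfolding evolution_system_def by simp
qed

lemma feller_evolution_system_cong:
  assumes P: "\<And>s. 0 \<le> s \<Longrightarrow> P s = P' s" and "feller_evolution_system P"
  shows "feller_evolution_system P'"
proof -
  have k: "kernel_op P s t = kernel_op P' s t" if "0 \<le> s" for s t
    using P[OF that] by (simp add: kernel_op_def fun_eq_iff)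
  have "continuous_on {(s, t, x). 0 \<le> s \<and> s \<le> t} (\<lambda>(s, t, x). kernel_op P s t F x) =
      continuous_on {(s, t, x). 0 \<le> s \<and> s \<le> t} (\<lambda>(s, t, x). kernel_op P' s t F x)" for F
    by (rule continuous_on_cong) (auto simp: k)
  then show ?thesis
    using assms evolution_system_cong[of "kernel_op P" "kernel_op P'" Cb sup_norm] k
    unfolding feller_evolution_system_def by auto
qed

lemma solves_backward_cong:
  assumes Q: "\<And>s. 0 \<le> s \<Longrightarrow> Q s = Q' s" and P: "\<And>s. 0 \<le> s \<Longrightarrow> P s = P' s"
    and sol: "solves_backward Q P F"
  shows "solves_backward Q' P' F"
  unfolding solves_backward_def
proof (intro allI impI conjI ballI)
  fix t :: real and x assume t: "0 < t"
  have k: "kernel_op P s t F = kernel_op P' s t F" if "0 \<le> s" for s using P[OF that] by (rule kernel_op_cong)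
  have L: "L_op Q s (kernel_op P s t F) x = L_op Q' s (kernel_op P' s t F) x" if "0 \<le> s" for s
    using Q[OF that] k[OF that] by (simp add: L_op_def)
  show "((\<lambda>r. kernel_op P' r t F x) has_real_derivative - L_op Q' s (kernel_op P' s t F) x) (at s within {0..t})"
    if s: "s \<in> {0..t}" for s
  proof (rule has_field_derivative_transform_within[where d = 1])
    have s0: "0 \<le> s" using s by simp
    show "((\<lambda>r. kernel_op P r t F x) has_real_derivative - L_op Q' s (kernel_op P' s t F) x) (at s within {0..t})"
      unfolding L[OF s0, symmetric] using sol t s unfolding solves_backward_def by blast
  qed (use s k in auto)
  have "continuous_on {0..t} (\<lambda>s. - L_op Q s (kernel_op P s t F) x)"
    using sol t unfolding solves_backward_def by blast
  then show "continuous_on {0..t} (\<lambda>s. - L_op Q' s (kernel_op P' s t F) x)"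
    by (rule continuous_on_eq) (simp add: L)
qed

lemma solves_backward_ae_cong:
  assumes Q: "\<And>s. 0 \<le> s \<Longrightarrow> Q s = Q' s" and P: "\<And>s. 0 \<le> s \<Longrightarrow> P s = P' s"
    and sol: "solves_backward_ae Q P F"
  shows "solves_backward_ae Q' P' F"
  unfolding solves_backward_ae_def
proof (intro allI impI conjI)
  fix t :: real and x assume t: "0 < t"
  have k: "kernel_op P s t F = kernel_op P' s t F" if "0 \<le> s" for s using P[OF that] by (rule kernel_op_cong)
  have L: "L_op Q s (kernel_op P s t F) x = L_op Q' s (kernel_op P' s t F) x" if "0 \<le> s" for s
    using Q[OF that] k[OF that] by (simp add: L_op_def)
  have "abs_continuous_on 0 t (\<lambda>s. kernel_op P s t F x)"
    using sol t unfolding solves_backward_ae_def by blast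
  then show "abs_continuous_on 0 t (\<lambda>s. kernel_op P' s t F x)"
    by (rule abs_continuous_on_cong[THEN iffD1, rotated]) (simp add: k)
  have "AE s in lborel. s \<in> {0..t} \<longrightarrow> integrable (Q s x) (kernel_op P s t F) \<and>
      ((\<lambda>r. kernel_op P r t F x) has_real_derivative - L_op Q s (kernel_op P s t F) x) (at s within {0..t})"
    using sol t unfolding solves_backward_ae_def by blast
  then show "AE s in lborel. s \<in> {0..t} \<longrightarrow> integrable (Q' s x) (kernel_op P' s t F) \<and>
      ((\<lambda>r. kernel_op P' r t F x) has_real_derivative - L_op Q' s (kernel_op P' s t F) x) (at s within {0..t})"
  proof eventually_elim
    case (elim s)
    show ?case
    proof
      assume s: "s \<in> {0..t}"
      then have "((\<lambda>r. kernel_op P r t F x) has_real_derivative - L_op Q' s (kernel_op P' s t F) x) (at s within {0..t})"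
        using elim L[of s] by auto
      then have "((\<lambda>r. kernel_op P' r t F x) has_real_derivative - L_op Q' s (kernel_op P' s t F) x) (at s within {0..t})"
        by (rule has_field_derivative_transform_within[where d = 1]) (use s k in auto)
      then show "integrable (Q' s x) (kernel_op P' s t F) \<and>
        ((\<lambda>r. kernel_op P' r t F x) has_real_derivative - L_op Q' s (kernel_op P' s t F) x) (at s within {0..t})"
        using elim s Q[of s] k[of s] by auto
    qed
  qed
qed

lemma solves_forward_cong:
  assumes Q: "\<And>s. 0 \<le> s \<Longrightarrow> Q s = Q' s" and P: "\<And>s. 0 \<le> s \<Longrightarrow> P s = P' s"
    and sol: "solves_forward Q P F"
  shows "solves_forward Q' P' F"
  unfolding solves_forward_def
proof (intro allI impI)
  fix s :: real and x assume s: "0 \<le> s"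
  have L: "L_op Q t F = L_op Q' t F" if "s \<le> t" for t using Q[of t] s that by (simp add: L_op_def fun_eq_iff)
  have k: "kernel_op P s t G = kernel_op P' s t G" for t G using P[OF s] by (rule kernel_op_cong)
  have *: "(\<forall>T>s. abs_continuous_on s T (\<lambda>t. kernel_op P s t F x)) \<and>
      (AE t in lborel. s \<le> t \<longrightarrow> integrable (P s x t) (L_op Q t F) \<and>
        ((\<lambda>r. kernel_op P s r F x) has_real_derivative kernel_op P s t (L_op Q t F) x) (at t within {s..}))"
    using sol s unfolding solves_forward_def by blast
  then have "AE t in lborel. s \<le> t \<longrightarrow> integrable (P' s x t) (L_op Q' t F) \<and>
        ((\<lambda>r. kernel_op P' s r F x) has_real_derivative kernel_op P' s t (L_op Q' t F) x) (at t within {s..})"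
    using P[OF s] by (auto simp: k L elim!: eventually_mono)
  then show "(\<forall>T>s. abs_continuous_on s T (\<lambda>t. kernel_op P' s t F x)) \<and>
      (AE t in lborel. s \<le> t \<longrightarrow> integrable (P' s x t) (L_op Q' t F) \<and>
        ((\<lambda>r. kernel_op P' s r F x) has_real_derivative kernel_op P' s t (L_op Q' t F) x) (at t within {s..}))"
    using * by (simp add: k)
qed

lemma minimal_transition_cong:
  assumes Q: "\<And>s. 0 \<le> s \<Longrightarrow> Q s = Q' s" and s: "0 \<le> s"
  shows "minimal_transition Q s = minimal_transition Q' s"
proof -
  have e: "(LINT \<tau>:{s..r}|lborel. rate Q \<tau> x) = (LINT \<tau>:{s..r}|lborel. rate Q' \<tau> x)" if "0 \<le> s" for s r x
    using that Q by (intro set_lebesgue_integral_cong) (auto simp: rate_def)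
  have "jump_part Q n s x t A = jump_part Q' n s x t A" if "0 \<le> s" for n x t A
    using that
  proof (induction n arbitrary: s x)
    case (Suc n)
    then show ?case
      by (auto simp: e Q indicator_def intro!: nn_integral_cong)
  qed (simp add: e)
  then show ?thesis using s by (simp add: minimal_transition_def fun_eq_iff)
qed

text \<open>Freezing the rates before time \<open>0\<close> preserves the continuity in time, and the bound on \<open>[0, T]\<close> becomes
  one for all times up to \<open>T\<close>. Continuity of the rate is the case \<open>F = 1\<close> of the continuity of
  \<open>Q(t) F(x)\<close>.\<close>

lemma lyapunov_kernel_extension:
  fixes Q :: "real \<Rightarrow> 'a::polish_space \<Rightarrow> 'a measure"
    and V :: "'a \<Rightarrow> real" and c :: "real \<Rightarrow> real"
  assumes tf: "transition_function Q"
    and V: "continuous_on UNIV V" "\<And>x. 0 \<le> V x"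
    and QC: "\<And>F. F \<in> C_V V \<Longrightarrow> continuous_on ({0..} \<times> UNIV) (\<lambda>(t, x). Q_op Q t F x)"
    and c: "continuous_on {0..} c" "\<And>t. 0 \<le> t \<Longrightarrow> 0 \<le> c t"
    and bnd: "\<And>T. 0 < T \<Longrightarrow> \<exists>a>0. \<forall>t\<in>{0..T}. \<forall>x. rate Q t x \<le> a * V x"
    and drift: "\<And>t x. 0 \<le> t \<Longrightarrow>
           (\<integral>\<^sup>+y. ennreal (V y) \<partial>Q t x) \<le> ennreal (c t * V x + rate Q t x * V x)"
  shows "lyapunov_kernel (\<lambda>t. Q (max 0 t)) V (\<lambda>t. c (max 0 t))"
proof -
  let ?Q = "\<lambda>t. Q (max 0 t)"
  have setsQ: "sets (?Q t x) = sets borel" and finQ: "finite_measure (?Q t x)" for t x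
    using tf by (auto simp: transition_function_def)
  have Q_cont: "continuous_on UNIV (\<lambda>(t, x). Q_op ?Q t F x)" if F: "F \<in> C_V V" for F
  proof -
    have "continuous_on UNIV (\<lambda>p::real \<times> 'a. (\<lambda>(t, x). Q_op Q t F x) (max 0 (fst p), snd p))"
      by (rule continuous_on_compose2[OF QC[OF F]]) (auto intro!: continuous_intros)
    then show ?thesis by (simp add: case_prod_unfold Q_op_def)
  qed
  have one: "(\<lambda>_. 1) \<in> C_V V"
    using V(2) by (auto simp: C_V_def intro!: BM_V_I[where K = 1])
  have rate1: "rate ?Q t x = Q_op ?Q t (\<lambda>_. 1) x" for t x
  proof -
    interpret finite_measure "?Q t x" by (rule finQ)
    have "space (?Q t x) = UNIV" using sets_eq_imp_space_eq[OF setsQ] by simp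
    then show ?thesis by (simp add: rate_def Q_op_def)
  qed
  show ?thesis
  proof (intro lyapunov_kernel.intro jump_kernel.intro lyapunov_kernel_axioms.intro)
    fix A :: "'a set" assume A: "A \<in> sets borel"
    have m: "(\<lambda>(t, x). measure (Q t x) A) \<in> borel_measurable (restrict_space borel {0..} \<Otimes>\<^sub>M borel)"
      using tf A by (auto simp: transition_function_def)
    have g: "(\<lambda>p. (max 0 (fst p), snd p)) \<in> measurable (borel \<Otimes>\<^sub>M borel) (restrict_space borel {0::real..} \<Otimes>\<^sub>M (borel :: 'a measure))"
      by (intro measurable_Pair measurable_restrict_space2) auto
    show "(\<lambda>(t, x). measure (Q (max 0 t) x) A) \<in> borel_measurable (borel \<Otimes>\<^sub>M borel)"
      using measurable_compose[OF g m] by (simp add: case_prod_unfold)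
  next
    show "continuous_on UNIV (\<lambda>(t, x). rate ?Q t x)"
      unfolding rate1 by (rule Q_cont[OF one])
    show "continuous_on UNIV (\<lambda>t. c (max 0 t))"
      by (rule continuous_on_compose2[OF c(1)]) (auto intro!: continuous_intros)
    fix T :: real
    have "0 < max 1 T" by simp
    from bnd[OF this] obtain a where "a > 0" "\<forall>t\<in>{0..max 1 T}. \<forall>x. rate Q t x \<le> a * V x" by blast
    then show "\<exists>a>0. \<forall>t\<le>T. \<forall>x. rate ?Q t x \<le> a * V x"
    proof (intro exI[of _ a] conjI allI impI)
      fix t x assume "t \<le> T"
      then have "max 0 t \<in> {0..max 1 T}" by auto
      with \<open>\<forall>t\<in>{0..max 1 T}. \<forall>x. rate Q t x \<le> a * V x\<close>
      have "rate Q (max 0 t) x \<le> a * V x" by blast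
      then show "rate ?Q t x \<le> a * V x" by (simp add: rate_def)
    qed
  next
    fix t x
    show "(\<integral>\<^sup>+y. ennreal (V y) \<partial>Q (max 0 t) x) \<le> ennreal (c (max 0 t) * V x + rate ?Q t x * V x)"
      using drift[of "max 0 t" x] by (simp add: rate_def)
  next
    show "0 \<le> c (max 0 t)" for t by (rule c(2)) simp
  qed (fact setsQ finQ V Q_cont)+
qed

theorem proposition2p1:
  fixes Q :: "real \<Rightarrow> 'a::polish_space \<Rightarrow> 'a measure"
    and V :: "'a \<Rightarrow> real" and c :: "real \<Rightarrow> real"
  assumes "locally_compact_space (euclidean :: 'a topology)"
    and "transition_function Q"
    and "continuous_on UNIV V" and "\<And>x. 0 \<le> V x"
    and "\<And>F. F \<in> C_V V \<Longrightarrow> continuous_on ({0..} \<times> UNIV) (\<lambda>(t, x). Q_op Q t F x)"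
    and "continuous_on {0..} c" and "\<And>t. 0 \<le> t \<Longrightarrow> 0 \<le> c t"
    and "\<And>T. 0 < T \<Longrightarrow> \<exists>a>0. \<forall>t\<in>{0..T}. \<forall>x. rate Q t x \<le> a * V x"
    and "\<And>t x. 0 \<le> t \<Longrightarrow>
           (\<integral>\<^sup>+y. ennreal (V y) \<partial>Q t x) \<le> ennreal (c t * V x + rate Q t x * V x)"
    and "\<And>\<epsilon> B T. 0 < \<epsilon> \<Longrightarrow> compact B \<Longrightarrow> 0 < T \<Longrightarrow>
           \<exists>A. compact A \<and> (\<forall>x\<in>B. (LINT r:{0..T}|lborel. measure (Q r x) (- A)) < \<epsilon>)"
  shows "feller_evolution_system (minimal_transition Q) \<and>
         conservative (minimal_transition Q) \<and>
         evolution_system (BM_V V) (weighted_norm V) (kernel_op (minimal_transition Q)) \<and>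
         (\<forall>F \<in> BM_V V. \<forall>s t. 0 \<le> s \<and> s \<le> t \<longrightarrow>
           (\<forall>x. integrable (minimal_transition Q s x t) F) \<and>
           weighted_norm V (kernel_op (minimal_transition Q) s t F)
             \<le> exp (LINT r:{s..t}|lborel. c r) * weighted_norm V F) \<and>
         (\<forall>F \<in> Cb. solves_backward Q (minimal_transition Q) F) \<and>
         (\<forall>F \<in> BM \<union> C_V V. solves_backward_ae Q (minimal_transition Q) F) \<and>
         (\<forall>F \<in> BM. solves_forward Q (minimal_transition Q) F) \<and>
         (\<forall>W. feller_evolution_system W \<and>
           (\<forall>F \<in> Cb. solves_backward Q W F \<or> solves_forward Q W F) \<longrightarrow>
           (\<forall>F \<in> Cb. \<forall>s t. 0 \<le> s \<and> s \<le> t \<longrightarrow>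
              kernel_op W s t F = kernel_op (minimal_transition Q) s t F))"
proof -
  let ?Q = "\<lambda>t. Q (max 0 t)"
  let ?P = "minimal_transition ?Q"
  interpret lyapunov_kernel ?Q V "\<lambda>t. c (max 0 t)"
    using assms(2-9) by (rule lyapunov_kernel_extension)
  have Q: "?Q s = Q s" if "0 \<le> s" for s using that by simp
  have P: "?P s = minimal_transition Q s" if "0 \<le> s" for s
    using Q that by (rule minimal_transition_cong)
  have k: "kernel_op ?P s t = kernel_op (minimal_transition Q) s t" if "0 \<le> s" for s t
    using P[OF that] by (simp add: kernel_op_def fun_eq_iff)
  have g: "growth s t = exp (LINT r:{s..t}|lborel. c r)" if "0 \<le> s" for s t
    unfolding growth_def
    using that by (intro arg_cong[where f = exp] set_lebesgue_integral_cong) auto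
  show ?thesis
  proof (intro conjI ballI allI impI; (elim conjE)?)
    show "feller_evolution_system (minimal_transition Q)"
      using P feller_evolution_system_P by (rule feller_evolution_system_cong)
    show "conservative (minimal_transition Q)"
      using conservative_P k by (simp add: conservative_def)
    show "evolution_system (BM_V V) (weighted_norm V) (kernel_op (minimal_transition Q))"
      using k evolution_system_BM_V by (rule evolution_system_cong)
  next
    fix F and s t :: real and x :: 'a assume F: "F \<in> BM_V V" and s: "0 \<le> s"
    show "integrable (minimal_transition Q s x t) F"
      using integrable_P[OF F, of s x t] P[OF s] by simp
    show "weighted_norm V (kernel_op (minimal_transition Q) s t F)
             \<le> exp (LINT r:{s..t}|lborel. c r) * weighted_norm V F"
      using weighted_norm_U_le[OF F, of s t] k[OF s] g[OF s] by simp
  next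
    fix F :: "'a \<Rightarrow> real" assume "F \<in> Cb"
    then show "solves_backward Q (minimal_transition Q) F"
      using solves_backward_cong[OF Q P solves_backward_U] by blast
  next
    fix F :: "'a \<Rightarrow> real" assume "F \<in> BM \<union> C_V V"
    then have "F \<in> BM_V V" using BM_subset_BM_V by (auto simp: C_V_def)
    then show "solves_backward_ae Q (minimal_transition Q) F"
      using solves_backward_ae_cong[OF Q P solves_backward_ae_U] by blast
  next
    fix F :: "'a \<Rightarrow> real" assume "F \<in> BM"
    then show "solves_forward Q (minimal_transition Q) F"
      using solves_forward_cong[OF Q P solves_forward_U] by blast
  next
    fix W :: "real \<Rightarrow> 'a \<Rightarrow> real \<Rightarrow> 'a measure" and F :: "'a \<Rightarrow> real" and s t :: real
    assume W: "feller_evolution_system W" and sol: "\<forall>F\<in>Cb. solves_backward Q W F \<or> solves_forward Q W F"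
      and F: "F \<in> Cb" and st: "0 \<le> s" "s \<le> t"
    have Q': "Q s = ?Q s" if "0 \<le> s" for s using that by simp
    have sol': "solves_backward ?Q W F \<or> solves_forward ?Q W F" if "F \<in> Cb" for F
      using sol that
        solves_backward_cong[where Q = Q and Q' = ?Q and P = W and P' = W, OF Q' refl]
        solves_forward_cong[where Q = Q and Q' = ?Q and P = W and P' = W, OF Q' refl] by blast
    have "kernel_op W s t F = U s t F"
      by (rule W_eq_U[OF W _ F st]) (rule sol')
    then show "kernel_op W s t F = kernel_op (minimal_transition Q) s t F"
      using k[OF st(1)] by simp
  qed
qed

end
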